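(* Let $\epsilon > 0$ and let $k$ be a positive integer. If a given point set $P \subseteq \mathbb{R}^d$ of $n$ points is $\left(k, \frac{\epsilon}{(1+\epsilon/2)\cdot k}\right)$-irreducible, then there is a (randomized) algorithm that gives a $\left(1 + \frac{\epsilon}{(1+\epsilon/2)\cdot k}\right)$-approximation to the $k$-means objective for $P$, i.e. outputs $C \subseteq \mathbb{R}^d$ with $|C| \le k$ and $\Delta(P,C) \leq \left(1 + \frac{\epsilon}{(1+\epsilon/2)\cdot k}\right)\Delta_k(P)$, and that runs in time $O\left(nd \cdot 2^{\tilde{O}(k^2/\epsilon)}\right)$.
   Context: For a finite set $P \subseteq \mathbb{R}^d$ and a finite set $C \subseteq \mathbb{R}^d$, $\Delta(P,C) = \sum_{p\in P} d(p,C)^2$, where $d(p,C)$ is the Euclidean distance from $p$ to the nearest point of $C$; $\Delta_j(P)$ is the minimum of $\Delta(P,C)$ over all $C \subseteq \mathbb{R}^d$ with $|C| = j$. A point set $P$ is $(k,\gamma)$-irreducible if $\Delta_{k-1}(P) \geq (1+\gamma)\cdot \Delta_k(P)$. The $\tilde{O}$ notation hides a factor $O(\log(k/\epsilon))$ in the exponent. The approximation guarantee of the randomized algorithm holds with high probability. *)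

theory Defs
  imports "HOL-Probability.Probability"
begin

section \<open>The k-means objective\<close>

text \<open>
  The dimension has to vary inside the statement, so the space of dimension \<open>d\<close> is the library's
  \<open>topspace (Euclidean_space d)\<close>: the functions \<open>x :: nat \<Rightarrow> real\<close> with \<open>x i = 0\<close> for \<open>i \<ge> d\<close>.
\<close>

type_synonym point = "nat \<Rightarrow> real"

abbreviation space_of_dim :: "nat \<Rightarrow> point set" where
  "space_of_dim d \<equiv> topspace (Euclidean_space d)"

definition edist :: "nat \<Rightarrow> point \<Rightarrow> point \<Rightarrow> real" where
  "edist d x y = L2_set (\<lambda>i. x i - y i) {..<d}"

text \<open>
  Costs are extended nonnegative reals: the distance to the empty set is \<open>\<infinity>\<close>, hence
  \<open>opt_cost d 0 P = \<infinity>\<close> for nonempty \<open>P\<close>, and every nonempty set is irreducible for \<open>k = 1\<close>.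
  (The library's \<open>infdist\<close> would give distance \<open>0\<close> to the empty set.)
\<close>

definition dist_to_set :: "nat \<Rightarrow> point \<Rightarrow> point set \<Rightarrow> ennreal" where
  "dist_to_set d p C = (INF c\<in>C. ennreal (edist d p c))"

definition kmeans_cost :: "nat \<Rightarrow> point set \<Rightarrow> point set \<Rightarrow> ennreal" where
  "kmeans_cost d P C = (\<Sum>p\<in>P. (dist_to_set d p C)\<^sup>2)"

definition opt_cost :: "nat \<Rightarrow> nat \<Rightarrow> point set \<Rightarrow> ennreal" where
  "opt_cost d j P =
     (INF C\<in>{C. C \<subseteq> space_of_dim d \<and> finite C \<and> card C = j}. kmeans_cost d P C)"

definition kmeans_irreducible :: "nat \<Rightarrow> nat \<Rightarrow> real \<Rightarrow> point set \<Rightarrow> bool" where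
  "kmeans_irreducible d k \<gamma> P \<longleftrightarrow> opt_cost d (k - 1) P \<ge> ennreal (1 + \<gamma>) * opt_cost d k P"

text \<open>\<open>C\<close> is a feasible output whose cost is within the factor \<open>\<alpha>\<close> of the optimum.\<close>

definition kmeans_approx :: "nat \<Rightarrow> nat \<Rightarrow> real \<Rightarrow> point set \<Rightarrow> point set \<Rightarrow> bool" where
  "kmeans_approx d k \<alpha> P C \<longleftrightarrow>
     C \<subseteq> space_of_dim d \<and> finite C \<and> card C \<le> k \<and>
     kmeans_cost d P C \<le> ennreal \<alpha> * opt_cost d k P"


section \<open>Randomized algorithms on a real RAM\<close>

text \<open>
  A program is a structured program for a real RAM: there are finitely many index registers
  (naturals) and real registers in use, an unbounded real memory addressed by naturals, exact
  arithmetic and comparisons, and a source of independent uniform random reals from \<open>[0,1]\<close>.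
  There is no rounding and no other conversion from reals to naturals, and the only
  constants are naturals.
\<close>

datatype iexp =
    IConst nat
  | IReg nat
  | IAdd iexp iexp
  | ISub iexp iexp
  | IMul iexp iexp

datatype rexp =
    ROfNat iexp
  | RReg nat
  | RMem iexp
  | RAdd rexp rexp
  | RSub rexp rexp
  | RMul rexp rexp
  | RDiv rexp rexp

datatype test =
    ILess iexp iexp
  | RLess rexp rexp
  | TNot test
  | TAnd test test

datatype prog =
    Skip
  | SetI nat iexp
  | SetR nat rexp
  | Store iexp rexp
  | Rand nat
  | Seq prog prog
  | Cond test prog prog
  | While test prog

text \<open>The field \<open>used\<close> counts the random reals consumed so far.\<close>

record state =
  ireg :: "nat \<Rightarrow> nat"
  rreg :: "nat \<Rightarrow> real"
  mem :: "nat \<Rightarrow> real"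
  used :: nat

fun ival :: "state \<Rightarrow> iexp \<Rightarrow> nat" where
  "ival s (IConst n) = n"
| "ival s (IReg r) = ireg s r"
| "ival s (IAdd a b) = ival s a + ival s b"
| "ival s (ISub a b) = ival s a - ival s b"
| "ival s (IMul a b) = ival s a * ival s b"

fun rval :: "state \<Rightarrow> rexp \<Rightarrow> real" where
  "rval s (ROfNat a) = real (ival s a)"
| "rval s (RReg r) = rreg s r"
| "rval s (RMem a) = mem s (ival s a)"
| "rval s (RAdd a b) = rval s a + rval s b"
| "rval s (RSub a b) = rval s a - rval s b"
| "rval s (RMul a b) = rval s a * rval s b"
| "rval s (RDiv a b) = rval s a / rval s b"

fun tval :: "state \<Rightarrow> test \<Rightarrow> bool" where
  "tval s (ILess a b) = (ival s a < ival s b)"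
| "tval s (RLess a b) = (rval s a < rval s b)"
| "tval s (TNot b) = (\<not> tval s b)"
| "tval s (TAnd a b) = (tval s a \<and> tval s b)"

text \<open>
  \<open>exec \<omega> c s t s'\<close>: with random tape \<open>\<omega>\<close>, program \<open>c\<close> started in \<open>s\<close> halts in \<open>s'\<close> after \<open>t\<close>
  steps.  Each elementary command and each evaluation of a test is one step; the expressions of
  a fixed program have bounded size, so charging for each arithmetic operation instead would only
  change the running time by a constant factor.
\<close>

inductive exec :: "(nat \<Rightarrow> real) \<Rightarrow> prog \<Rightarrow> state \<Rightarrow> nat \<Rightarrow> state \<Rightarrow> bool" for \<omega> where
  Skip: "exec \<omega> Skip s 1 s"
| SetI: "exec \<omega> (SetI r a) s 1 (s\<lparr>ireg := (ireg s)(r := ival s a)\<rparr>)"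
| SetR: "exec \<omega> (SetR r a) s 1 (s\<lparr>rreg := (rreg s)(r := rval s a)\<rparr>)"
| Store: "exec \<omega> (Store a b) s 1 (s\<lparr>mem := (mem s)(ival s a := rval s b)\<rparr>)"
| Rand: "exec \<omega> (Rand r) s 1 (s\<lparr>rreg := (rreg s)(r := \<omega> (used s)), used := Suc (used s)\<rparr>)"
| Seq: "exec \<omega> c1 s t1 s1 \<Longrightarrow> exec \<omega> c2 s1 t2 s2 \<Longrightarrow> exec \<omega> (Seq c1 c2) s (t1 + t2) s2"
| CondT: "tval s b \<Longrightarrow> exec \<omega> c1 s t s1 \<Longrightarrow> exec \<omega> (Cond b c1 c2) s (1 + t) s1"
| CondF: "\<not> tval s b \<Longrightarrow> exec \<omega> c2 s t s1 \<Longrightarrow> exec \<omega> (Cond b c1 c2) s (1 + t) s1"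
| WhileT: "tval s b \<Longrightarrow> exec \<omega> c s t1 s1 \<Longrightarrow> exec \<omega> (While b c) s1 t2 s2 \<Longrightarrow>
    exec \<omega> (While b c) s (1 + t1 + t2) s2"
| WhileF: "\<not> tval s b \<Longrightarrow> exec \<omega> (While b c) s 1 s"

inductive_cases SkipE: "exec \<omega> Skip s t s'"
inductive_cases SetIE: "exec \<omega> (SetI r a) s t s'"
inductive_cases SetRE: "exec \<omega> (SetR r a) s t s'"
inductive_cases StoreE: "exec \<omega> (Store a b) s t s'"
inductive_cases RandE: "exec \<omega> (Rand r) s t s'"
inductive_cases SeqE: "exec \<omega> (Seq c1 c2) s t s'"
inductive_cases CondE: "exec \<omega> (Cond b c1 c2) s t s'"
inductive_cases WhileE: "exec \<omega> (While b c) s t s'"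

lemma exec_deterministic:
  assumes "exec \<omega> c s t s1" "exec \<omega> c s u s2"
  shows "u = t \<and> s2 = s1"
  using assms
proof (induction arbitrary: u s2 rule: exec.induct)
  case (Skip s)
  then show ?case by (rule SkipE) simp
next
  case (SetI r a s)
  then show ?case by (rule SetIE) simp
next
  case (SetR r a s)
  then show ?case by (rule SetRE) simp
next
  case (Store a b s)
  then show ?case by (rule StoreE) simp
next
  case (Rand r s)
  then show ?case by (rule RandE) simp
next
  case (Seq c1 s t1 s1 c2 t2 s2')
  from Seq.prems show ?case by (rule SeqE) (use Seq.IH in metis)
next
  case (CondT s b c1 t s1 c2)
  from CondT.prems show ?case by (rule CondE) (use CondT.hyps CondT.IH in \<open>metis plus_1_eq_Suc add_Suc\<close>)+
next
  case (CondF s b c2 t s1 c1)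
  from CondF.prems show ?case by (rule CondE) (use CondF.hyps CondF.IH in \<open>metis plus_1_eq_Suc add_Suc\<close>)+
next
  case (WhileT s b c t1 s1 t2 s2')
  from WhileT.prems show ?case by (rule WhileE) (use WhileT.hyps WhileT.IH in \<open>metis plus_1_eq_Suc add_Suc\<close>)+
next
  case (WhileF s b c)
  from WhileF.prems show ?case by (rule WhileE) (use WhileF.hyps in simp_all)
qed

definition random_tape :: "(nat \<Rightarrow> real) measure" where
  "random_tape = PiM UNIV (\<lambda>_. restrict_space lborel {0..1})"

text \<open>
  Input: \<open>n, d, k\<close> in index registers 0, 1, 2; \<open>\<epsilon>\<close> in real register 0; coordinate \<open>j\<close> of the
  \<open>i\<close>-th point at address \<open>i * d + j\<close>; everything else is 0.
\<close>

definition kmeans_input :: "real \<Rightarrow> nat \<Rightarrow> nat \<Rightarrow> point list \<Rightarrow> state" where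
  "kmeans_input \<epsilon> k d ps =
     \<lparr>ireg = (\<lambda>_. 0)(0 := length ps, 1 := d, 2 := k),
      rreg = (\<lambda>_. 0)(0 := \<epsilon>),
      mem = (\<lambda>a. if a < length ps * d then (ps ! (a div d)) (a mod d) else 0),
      used = 0\<rparr>"

text \<open>
  Output: index register 0 holds the number of centers and index register 1 the address from
  which on they are stored, in the format of the input.
\<close>

definition kmeans_output :: "nat \<Rightarrow> state \<Rightarrow> point set" where
  "kmeans_output d s =
     (\<lambda>i j. if j < d then mem s (ireg s 1 + i * d + j) else 0) ` {..<ireg s 0}"

text \<open>
  The bound \<open>K n d 2^E\<close> with \<open>E = c (k\<^sup>2 / \<epsilon>) log (k / \<epsilon>)\<close>.  The hidden logarithmic factor is taken
  to be at least 1, since it would vanish or be negative for \<open>k \<le> \<epsilon>\<close>.  \<open>K\<close> and \<open>c\<close> are meant to be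
  uniform in everything except for an upper bound on \<open>\<epsilon>\<close>: uniformity also for \<open>\<epsilon> \<rightarrow> \<infinity>\<close> would turn
  the bound into \<open>O(n d)\<close> with a constant independent of \<open>k\<close>.
\<close>

definition kmeans_time_bound :: "real \<Rightarrow> real \<Rightarrow> real \<Rightarrow> nat \<Rightarrow> nat \<Rightarrow> nat \<Rightarrow> real" where
  "kmeans_time_bound K c \<epsilon> k d n =
     K * (real n * real d * 2 powr (c * ((real k)\<^sup>2 / \<epsilon>) * max 1 (log 2 (real k / \<epsilon>))))"

definition gap :: "real \<Rightarrow> nat \<Rightarrow> real" where
  "gap \<epsilon> k = \<epsilon> / ((1 + \<epsilon> / 2) * real k)"

end

theory Submission
  imports Defs
begin

text \<open>
  Repeated \<open>D\<^sup>2\<close>-sampling.  Centers are chosen one after the other; the next one is the mean of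
  \<open>m = O(1/\<gamma>)\<close> draws, where a point is drawn with probability proportional to its squared distance to
  the centers found so far and each of these centers is a further candidate.  If the centers found so
  far are nearly optimal for distinct optimal clusters, irreducibility forces some other cluster to
  carry a fraction \<open>\<Omega>(\<gamma>/k)\<close> of the current cost.  Replacing the points of that cluster which are
  close to a center by this center hardly moves its centroid, and the draws dominate the uniform
  distribution on the modified cluster up to a factor polynomial in \<open>1/m\<close>.  By Markov's inequality each
  draw therefore keeps the squared norm of the sum of deviations from the modified centroid below
  \<open>(1 + 1/m)\<close> times its expectation with probability at least \<open>1 / m ^ 5\<close>, and \<open>(1 + 1/m) ^ m \<le> 3\<close>.  So all \<open>k m\<close>
  draws succeed with probability at least \<open>1 / m ^ (5 k m)\<close>, and the best of \<open>L m ^ (5 k m)\<close> independent attempts fails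
  with probability at most \<open>exp (- L)\<close>.
\<close>

section \<open>Squared distances\<close>

text \<open>For bounded \<epsilon> the number \<open>gap\<close> is of order \<epsilon> / k, so m =
  O(k / \<epsilon>), and the exponent lets each of the \<open>k * m\<close> draws lose only a factor
  polynomial in \<open>m\<close>. Markov's inequality with a factor 2 for each draw would inflate
  the squared deviation to order 2 ^ m; the factor 1 + 1 / m keeps the inflation constant and still
  accepts a fraction 1 / (m + 1). Because deviations are controlled draw by draw, the draws need not
  be uniform on the cluster: only lower bounds for the probabilities of sets of candidates enter,
  and they multiply by conditioning on the past. Centers are candidates because a point next to a
  center has almost no weight and yet must contribute to the mean. The condition m * \<gamma> \<ge>
  96 is what finally turns an error of 48 / m times the variance into the slack \<gamma> / 2. Inputs
  with n \<le> k are treated apart, since there a few centers may already have cost 0 and no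
  distribution proportional to the cost exists.\<close>

definition dsq :: "nat \<Rightarrow> point \<Rightarrow> point \<Rightarrow> real" where
  "dsq d x y = (\<Sum>l<d. (x l - y l)\<^sup>2)"

definition nsq :: "nat \<Rightarrow> point \<Rightarrow> real" where
  "nsq d v = (\<Sum>l<d. (v l)\<^sup>2)"

definition centroid :: "'a set \<Rightarrow> ('a \<Rightarrow> point) \<Rightarrow> point" where
  "centroid A f = (\<lambda>l. (\<Sum>p\<in>A. f p l) / card A)"

lemma dsq_nonneg [simp]: "0 \<le> dsq d x y"
  by (simp add: dsq_def sum_nonneg)

lemma nsq_nonneg [simp]: "0 \<le> nsq d x"
  by (simp add: nsq_def sum_nonneg)

lemma dsq_self [simp]: "dsq d x x = 0"
  by (simp add: dsq_def)

lemma dsq_commute: "dsq d x y = dsq d y x"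
  by (simp add: dsq_def power2_commute)

lemma dsq_triangle: "dsq d x z \<le> 2 * dsq d x y + 2 * dsq d y z"
proof -
  have "(x l - z l)\<^sup>2 \<le> 2 * (x l - y l)\<^sup>2 + 2 * (y l - z l)\<^sup>2" for l
    using zero_le_power2[of "(x l - y l) - (y l - z l)"] by (simp add: power2_eq_square algebra_simps)
  then show ?thesis
    unfolding dsq_def sum_distrib_left sum.distrib[symmetric] by (intro sum_mono) auto
qed

lemma edist_sq: "(edist d x y)\<^sup>2 = dsq d x y"
  by (simp add: edist_def L2_set_def dsq_def sum_nonneg)

lemma sum_sq_decomp:
  fixes f :: "'a \<Rightarrow> real" and M :: real
  assumes "finite A" "A \<noteq> {}" and M_def: "M = (\<Sum>p\<in>A. f p) / card A"
  shows "(\<Sum>p\<in>A. (f p - c)\<^sup>2) = (\<Sum>p\<in>A. (f p - M)\<^sup>2) + card A * (M - c)\<^sup>2"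
proof -
  have "card A \<noteq> 0" using assms by simp
  then have S: "(\<Sum>p\<in>A. f p) = card A * M" by (simp add: M_def)
  have "(f p - c)\<^sup>2 = (f p - M)\<^sup>2 + (2 * (M - c) * f p - 2 * (M - c) * M + (M - c)\<^sup>2)" for p
    by (simp add: power2_eq_square algebra_simps)
  then have "(\<Sum>p\<in>A. (f p - c)\<^sup>2) = (\<Sum>p\<in>A. (f p - M)\<^sup>2) +
      (2 * (M - c) * (\<Sum>p\<in>A. f p) - card A * (2 * (M - c) * M) + card A * (M - c)\<^sup>2)"
    by (simp add: sum.distrib sum_subtractf sum_distrib_left[symmetric])
  then show ?thesis unfolding S by (simp add: algebra_simps)
qed

text \<open>Parallel axis identity. The points form a family over an index set, since a modified
  cluster may represent many of its points by the same center.\<close>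

lemma sum_dsq_decomp:
  assumes "finite A" "A \<noteq> {}"
  shows "(\<Sum>p\<in>A. dsq d (f p) c) =
    (\<Sum>p\<in>A. dsq d (f p) (centroid A f)) + card A * dsq d (centroid A f) c"
proof -
  let ?M = "centroid A f"
  have sw: "(\<Sum>p\<in>A. dsq d (f p) c) = (\<Sum>l<d. \<Sum>p\<in>A. (f p l - c l)\<^sup>2)" for c
    unfolding dsq_def by (rule sum.swap)
  have "(\<Sum>p\<in>A. (f p l - c l)\<^sup>2) = (\<Sum>p\<in>A. (f p l - ?M l)\<^sup>2) + card A * (?M l - c l)\<^sup>2" for l
    by (rule sum_sq_decomp[OF assms]) (simp add: centroid_def)
  then show ?thesis
    unfolding sw by (simp add: sum.distrib dsq_def sum_distrib_left)
qed

lemma sum_dsq_centroid_le: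
  assumes "finite A"
  shows "(\<Sum>p\<in>A. dsq d (f p) (centroid A f)) \<le> (\<Sum>p\<in>A. dsq d (f p) c)"
proof (cases "A = {}")
  case False
  then show ?thesis using sum_dsq_decomp[OF assms, of d f c] by simp
qed simp

text \<open>The displacements \<open>f p - g p\<close> have the difference of the two centroids as
  their own centroid; the parallel axis identity about the origin bounds its squared norm.\<close>

lemma centroid_shift:
  assumes "finite A" "A \<noteq> {}"
  shows "card A * dsq d (centroid A f) (centroid A g) \<le> (\<Sum>p\<in>A. dsq d (f p) (g p))"
proof -
  let ?h = "\<lambda>p l. f p l - g p l"
  have "dsq d (centroid A f) (centroid A g) = dsq d (centroid A ?h) (\<lambda>_. 0)"
    by (simp add: dsq_def centroid_def sum_subtractf diff_divide_distrib)
  moreover have "(\<Sum>p\<in>A. dsq d (f p) (g p)) = (\<Sum>p\<in>A. dsq d (?h p) (\<lambda>_. 0))"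
    by (simp add: dsq_def)
  ultimately show ?thesis
    using sum_dsq_decomp[OF assms, of d ?h "\<lambda>_. 0"] by (simp add: sum_nonneg)
qed

text \<open>Markov's inequality with a threshold just above the mean \<open>E\<close>: at most a
  fraction m / (m + 1) of \<open>A\<close> can exceed it. The mean 0 is separate because the
  argument divides by \<open>E\<close>.\<close>

lemma card_markov:
  fixes Y :: "'a \<Rightarrow> real" and m :: nat and E :: real
  assumes "finite A" "\<And>p. p \<in> A \<Longrightarrow> 0 \<le> Y p" "(\<Sum>p\<in>A. Y p) = card A * E" "0 \<le> E" "1 \<le> m"
  shows "real (card A) / (m + 1) \<le> card {p\<in>A. Y p \<le> (1 + 1 / m) * E}"
proof (cases "E = 0")
  case True
  then have "Y p = 0" if "p \<in> A" for p
    using assms sum_nonneg_eq_0_iff[of A Y] that by auto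
  then have "{p\<in>A. Y p \<le> (1 + 1 / m) * E} = A" using True by auto
  then show ?thesis by (simp add: field_simps)
next
  case False
  with assms have E: "E > 0" by simp
  let ?G = "{p\<in>A. Y p \<le> (1 + 1 / m) * E}" and ?B = "{p\<in>A. Y p > (1 + 1 / m) * E}"
  have "card ?G + card ?B = card A"
  proof (subst card_Un_disjoint[symmetric])
    show "card (?G \<union> ?B) = card A" by (rule arg_cong[of _ _ card]) auto
  qed (use assms in auto)
  then have GB: "real (card ?G) + card ?B = card A" by linarith
  have "card ?B * ((1 + 1 / m) * E) = (\<Sum>p\<in>?B. (1 + 1 / m) * E)" by simp
  also have "\<dots> \<le> (\<Sum>p\<in>?B. Y p)" by (intro sum_mono) auto
  also have "\<dots> \<le> (\<Sum>p\<in>A. Y p)" using assms by (intro sum_mono2) auto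
  also have "\<dots> = card A * E" by fact
  finally have "(card ?B * (1 + 1 / m)) * E \<le> card A * E" by (simp add: mult.assoc)
  then have "card ?B * (1 + 1 / m) \<le> card A" using E by (rule mult_right_le_imp_le)
  then have "card ?B * (m + 1) \<le> real (card A) * m"
    using \<open>1 \<le> m\<close> by (simp add: field_simps)
  then have "real (card A) \<le> card ?G * (m + 1)"
    unfolding GB[symmetric] by (simp add: algebra_simps)
  then show ?thesis by (simp add: field_simps)
qed

section \<open>One attempt of the sampling algorithm\<close>

locale sampling =
  fixes d n k m :: nat and x :: "nat \<Rightarrow> point"
begin

text \<open>With no center present all points get weight 1: the first center is sampled uniformly.\<close>

definition wt :: "point list \<Rightarrow> nat \<Rightarrow> real" where
  "wt C p = (if C = [] then 1 else Min (dsq d (x p) ` set C))"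

definition mass :: "point list \<Rightarrow> real" where
  "mass C = (\<Sum>p<n. wt C p)"

definition cand :: "point list \<Rightarrow> nat \<Rightarrow> point" where
  "cand C j = (if j < n then x j else C ! (j - n))"

text \<open>A center weighs as much as all points together. If the mass is positive, it is drawn
  with probability 1 / (1 + length C), at least 1 / k while centers are missing, however close the
  points lie to it.\<close>

definition cwt :: "point list \<Rightarrow> nat \<Rightarrow> real" where
  "cwt C j = (if j < n then wt C j else mass C)"

definition total :: "point list \<Rightarrow> real" where
  "total C = mass C * (1 + real (length C))"

text \<open>The least index whose cumulative weight exceeds \<open>u * total C\<close>, capped at the last candidate so that
  it is valid also for \<open>u = 1\<close>.\<close>

definition pick :: "point list \<Rightarrow> real \<Rightarrow> nat" where
  "pick C u = (LEAST j. \<not> (Suc j < n + length C \<and> (\<Sum>i\<le>j. cwt C i) \<le> u * total C))"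

definition mean :: "point list \<Rightarrow> (nat \<Rightarrow> nat) \<Rightarrow> point" where
  "mean C f = (\<lambda>l. if l < d then (\<Sum>s<m. cand C (f s) l / m) else 0)"

lemma wt_nonneg [simp]: "0 \<le> wt C p"
  by (auto simp: wt_def)

lemma wt_le: "c \<in> set C \<Longrightarrow> wt C p \<le> dsq d (x p) c"
  by (auto simp: wt_def)

lemma wt_attained: "C \<noteq> [] \<Longrightarrow> \<exists>c\<in>set C. wt C p = dsq d (x p) c"
proof -
  assume C: "C \<noteq> []"
  then have "Min (dsq d (x p) ` set C) \<in> dsq d (x p) ` set C" by (intro Min_in) auto
  then obtain c where "c \<in> set C" "Min (dsq d (x p) ` set C) = dsq d (x p) c" by blast
  with C show ?thesis unfolding wt_def by auto
qed

lemma wt_snoc: "wt (C @ [c]) p = (if C = [] then dsq d (x p) c else min (wt C p) (dsq d (x p) c))"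
  by (auto simp: wt_def min.commute)

lemma mass_nonneg [simp]: "0 \<le> mass C"
  by (simp add: mass_def sum_nonneg)

lemma cwt_nonneg [simp]: "0 \<le> cwt C p"
  by (auto simp: cwt_def)

lemma sum_cwt: "(\<Sum>j<n + length C. cwt C j) = total C"
proof -
  have "(\<Sum>j<n + i. cwt C j) = mass C * (1 + real i)" for i
    by (induction i) (auto simp: cwt_def mass_def algebra_simps)
  then show ?thesis by (simp add: total_def)
qed

text \<open>\<open>u\<close> is the tape position at which the attempt starts. Round
  \<open>i\<close> reads the \<open>m\<close> entries from \<open>u + i * m\<close> on, so that
  rounds and attempts read disjoint parts of the tape.\<close>

fun rounds :: "(nat \<Rightarrow> real) \<Rightarrow> nat \<Rightarrow> nat \<Rightarrow> point list" where
  "rounds \<omega> u 0 = []"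
| "rounds \<omega> u (Suc i) = rounds \<omega> u i @
     [mean (rounds \<omega> u i) (\<lambda>s. pick (rounds \<omega> u i) (\<omega> (u + i * m + s)))]"

definition run :: "(nat \<Rightarrow> real) \<Rightarrow> nat \<Rightarrow> point list" where
  "run \<omega> r = rounds \<omega> (r * (k * m)) k"

text \<open>The first attempt is taken unconditionally: \<open>mass []\<close> is \<open>n\<close>,
  a count of points and not a cost to compare with.\<close>

fun best :: "(nat \<Rightarrow> real) \<Rightarrow> nat \<Rightarrow> point list" where
  "best \<omega> 0 = []"
| "best \<omega> (Suc r) = (if r = 0 \<or> mass (run \<omega> r) < mass (best \<omega> r) then run \<omega> r else best \<omega> r)"

lemma length_rounds [simp]: "length (rounds \<omega> u i) = i"
  by (induction i) auto

lemma length_run [simp]: "length (run \<omega> r) = k"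
  by (simp add: run_def)

lemma best_is_run: "1 \<le> R \<Longrightarrow> \<exists>r<R. best \<omega> R = run \<omega> r"
  by (induction R) (auto simp: less_Suc_eq)

lemma mass_best_le: "r < R \<Longrightarrow> mass (best \<omega> R) \<le> mass (run \<omega> r)"
  by (induction R) (fastforce simp: less_Suc_eq)+

lemma pick_less:
  assumes "1 \<le> n"
  shows "pick C u < n + length C"
proof -
  have "pick C u \<le> n + length C - 1"
    unfolding pick_def by (rule Least_le) (use assms in auto)
  then show ?thesis using assms by simp
qed

lemma mean_cong: "(\<And>s. s < m \<Longrightarrow> f s = g s) \<Longrightarrow> mean C f = mean C g"
  by (auto simp: mean_def fun_eq_iff intro!: sum.cong)

lemma rounds_cong:
  "(\<And>t. t < u + i * m \<Longrightarrow> \<omega> t = \<omega>' t) \<Longrightarrow> rounds \<omega> u i = rounds \<omega>' u i"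
proof (induction i)
  case (Suc i)
  have "rounds \<omega> u i = rounds \<omega>' u i" by (rule Suc.IH) (use Suc.prems in auto)
  then show ?case using Suc.prems by (auto intro!: mean_cong)
qed simp

end

section \<open>Irreducible clusterings\<close>

locale clustering = sampling +
  fixes a :: "nat \<Rightarrow> nat" and \<gamma> :: real
begin

definition cl :: "nat \<Rightarrow> nat set" where
  "cl j = {p. p < n \<and> a p = j}"

definition V :: "nat \<Rightarrow> real" where
  "V j = (\<Sum>p\<in>cl j. dsq d (x p) (centroid (cl j) x))"

text \<open>The slack \<gamma> / 2 is half of what irreducibility provides; the other half
  guarantees weight outside the covered clusters.\<close>

definition covers :: "point list \<Rightarrow> bool" where
  "covers C \<longleftrightarrow> (\<exists>\<sigma>. inj_on \<sigma> {..<length C} \<and> \<sigma> ` {..<length C} \<subseteq> {..<k} \<and>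
     (\<forall>l<length C. (\<Sum>p\<in>cl (\<sigma> l). dsq d (x p) (C ! l)) \<le> (1 + \<gamma> / 2) * V (\<sigma> l)))"

lemma finite_cl [simp]: "finite (cl j)"
  by (simp add: cl_def)

lemma V_nonneg [simp]: "0 \<le> V j"
  by (simp add: V_def sum_nonneg)

lemma covers_Nil [simp]: "covers []"
  by (auto simp: covers_def)

end

text \<open>\<open>\<Sum>j<k. V j\<close> stands for the optimal cost. The assumption
  \<open>irred\<close> concerns nonempty \<open>C\<close> because \<open>mass []\<close> counts
  points. The assumption \<open>mass_pos\<close> makes the draws well-defined.\<close>

locale irreducible_clustering = clustering +
  assumes assignment: "\<And>p. p < n \<Longrightarrow> a p < k"
    and k: "1 \<le> k" "k \<le> m" and m: "48 \<le> m" "96 \<le> real m * \<gamma>" and \<gamma>: "0 < \<gamma>" "\<gamma> < 2"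
    and n: "1 \<le> n"
    and irred: "\<And>C. C \<noteq> [] \<Longrightarrow> length C < k \<Longrightarrow> (1 + \<gamma>) * (\<Sum>j<k. V j) \<le> mass C"
    and mass_pos: "\<And>C. length C < k \<Longrightarrow> 0 < mass C"
begin

lemma sum_clusters: "(\<Sum>j<k. \<Sum>p\<in>cl j. f p) = (\<Sum>p<n. f p :: real)"
proof -
  have "{..<n} = (\<Union>j<k. cl j)" using assignment by (auto simp: cl_def)
  moreover have "(\<Sum>p\<in>(\<Union>j<k. cl j). f p) = (\<Sum>j<k. \<Sum>p\<in>cl j. f p)"
    by (rule sum.UNION_disjoint) (auto simp: cl_def)
  ultimately show ?thesis by simp
qed

text \<open>With \<open>k\<close> centers the injection \<open>\<sigma>\<close> permutes the
  clusters, so every cluster is charged to the center that serves it.\<close>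

lemma mass_covers:
  assumes "covers C" "length C = k"
  shows "mass C \<le> (1 + \<gamma> / 2) * (\<Sum>j<k. V j)"
proof -
  obtain \<sigma> where \<sigma>: "inj_on \<sigma> {..<k}" "\<sigma> ` {..<k} \<subseteq> {..<k}"
    "\<And>l. l < k \<Longrightarrow> (\<Sum>p\<in>cl (\<sigma> l). dsq d (x p) (C ! l)) \<le> (1 + \<gamma> / 2) * V (\<sigma> l)"
    using assms unfolding covers_def by auto
  have bij: "\<sigma> ` {..<k} = {..<k}" using \<sigma> endo_inj_surj by blast
  have "mass C = (\<Sum>j<k. \<Sum>p\<in>cl j. wt C p)" by (simp add: mass_def sum_clusters)
  also have "\<dots> = (\<Sum>j\<in>\<sigma> ` {..<k}. \<Sum>p\<in>cl j. wt C p)" by (simp add: bij)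
  also have "\<dots> = (\<Sum>l<k. \<Sum>p\<in>cl (\<sigma> l). wt C p)" by (simp add: sum.reindex \<sigma>)
  also have "\<dots> \<le> (\<Sum>l<k. \<Sum>p\<in>cl (\<sigma> l). dsq d (x p) (C ! l))"
    using assms by (intro sum_mono wt_le) auto
  also have "\<dots> \<le> (\<Sum>l<k. (1 + \<gamma> / 2) * V (\<sigma> l))" by (intro sum_mono \<sigma>) auto
  also have "\<dots> = (\<Sum>j\<in>\<sigma> ` {..<k}. (1 + \<gamma> / 2) * V j)" by (simp add: sum.reindex \<sigma>)
  finally show ?thesis by (simp add: bij sum_distrib_left)
qed

lemma covers_snoc:
  assumes "inj_on \<sigma> {..<length C}" "\<sigma> ` {..<length C} \<subseteq> {..<k}"
    "\<forall>l<length C. (\<Sum>p\<in>cl (\<sigma> l). dsq d (x p) (C ! l)) \<le> (1 + \<gamma> / 2) * V (\<sigma> l)"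
    "j < k" "j \<notin> \<sigma> ` {..<length C}" "(\<Sum>p\<in>cl j. dsq d (x p) c) \<le> (1 + \<gamma> / 2) * V j"
  shows "covers (C @ [c])"
  unfolding covers_def
proof (intro exI[of _ "\<sigma>(length C := j)"] conjI)
  show "inj_on (\<sigma>(length C := j)) {..<length (C @ [c])}"
    using assms(1,5) by (auto simp: inj_on_def less_Suc_eq)
  show "(\<sigma>(length C := j)) ` {..<length (C @ [c])} \<subseteq> {..<k}"
    using assms(2,4) by (auto simp: less_Suc_eq image_subset_iff)
qed (use assms(3,6) in \<open>auto simp: less_Suc_eq nth_append\<close>)

text \<open>Let O be \<open>\<Sum>j<k. V j\<close>. The covered clusters weigh at most (1 + \<gamma>
  / 2) O and all together at least (1 + \<gamma>) O. So the others carry a fraction (\<gamma> / 2) /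
  (1 + \<gamma>), at least \<gamma> / 6 as \<gamma> < 2, and the heaviest of at most
  \<open>k\<close> clusters has a k-th of that.\<close>

lemma heavy_uncovered_cluster:
  assumes "covers C" "length C < k"
  obtains j where "j < k" "cl j \<noteq> {}"
    "\<And>c. (\<Sum>p\<in>cl j. dsq d (x p) c) \<le> (1 + \<gamma> / 2) * V j \<Longrightarrow> covers (C @ [c])"
    "\<gamma> / (6 * k) * mass C \<le> (\<Sum>p\<in>cl j. wt C p)"
proof -
  obtain \<sigma> where \<sigma>: "inj_on \<sigma> {..<length C}" "\<sigma> ` {..<length C} \<subseteq> {..<k}"
    "\<forall>l<length C. (\<Sum>p\<in>cl (\<sigma> l). dsq d (x p) (C ! l)) \<le> (1 + \<gamma> / 2) * V (\<sigma> l)"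
    using assms unfolding covers_def by auto
  let ?I = "\<sigma> ` {..<length C}" and ?U = "{..<k} - \<sigma> ` {..<length C}"
  let ?W = "\<lambda>j. \<Sum>p\<in>cl j. wt C p"
  have split: "mass C = sum ?W ?I + sum ?W ?U"
  proof -
    have "mass C = sum ?W {..<k}" by (simp add: mass_def sum_clusters)
    then show ?thesis using \<sigma>(2) by (subst (asm) sum.subset_diff[of ?I]) auto
  qed
  have U: "\<gamma> / 6 * mass C \<le> sum ?W ?U"
  proof (cases "C = []")
    case True
    then have "mass C = sum ?W ?U" using split by simp
    moreover have "\<gamma> / 6 * mass C \<le> 1 * mass C" using \<gamma> by (intro mult_right_mono) auto
    ultimately show ?thesis by simp
  next
    case False
    have "sum ?W ?I = (\<Sum>l<length C. ?W (\<sigma> l))" by (simp add: sum.reindex \<sigma>)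
    also have "\<dots> \<le> (\<Sum>l<length C. \<Sum>p\<in>cl (\<sigma> l). dsq d (x p) (C ! l))"
      by (intro sum_mono wt_le) auto
    also have "\<dots> \<le> (\<Sum>l<length C. (1 + \<gamma> / 2) * V (\<sigma> l))" using \<sigma>(3) by (intro sum_mono) auto
    also have "\<dots> = (\<Sum>j\<in>?I. (1 + \<gamma> / 2) * V j)" by (simp add: sum.reindex \<sigma>)
    also have "\<dots> \<le> (\<Sum>j<k. (1 + \<gamma> / 2) * V j)" using \<sigma>(2) \<gamma> by (intro sum_mono2) auto
    also have "\<dots> = (1 + \<gamma> / 2) * (\<Sum>j<k. V j)" by (simp add: sum_distrib_left)
    finally have 1: "sum ?W ?I \<le> (1 + \<gamma> / 2) * (\<Sum>j<k. V j)" .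
    have 2: "(1 + \<gamma>) * (\<Sum>j<k. V j) \<le> mass C" using False assms irred by blast
    have "(1 + \<gamma>) * sum ?W ?I \<le> (1 + \<gamma>) * ((1 + \<gamma> / 2) * (\<Sum>j<k. V j))"
      using 1 \<gamma> by (intro mult_left_mono) auto
    also have "\<dots> = (1 + \<gamma> / 2) * ((1 + \<gamma>) * (\<Sum>j<k. V j))" by simp
    also have "\<dots> \<le> (1 + \<gamma> / 2) * mass C"
      using 2 \<gamma> by (intro mult_left_mono) auto
    finally have "(\<gamma> / 2) * mass C \<le> (1 + \<gamma>) * sum ?W ?U" using split by (simp add: algebra_simps)
    also have "\<dots> \<le> 3 * sum ?W ?U" using \<gamma> by (intro mult_right_mono) (auto intro!: sum_nonneg)
    finally show ?thesis by simp
  qed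
  have "\<exists>j\<in>?U. \<gamma> / (6 * k) * mass C \<le> ?W j"
  proof (rule ccontr)
    assume neg: "\<not> ?thesis"
    have ne: "?U \<noteq> {}"
    proof
      assume "?U = {}"
      then have "card {..<k} \<le> card ?I" by (intro card_mono) auto
      also have "\<dots> \<le> card {..<length C}" by (rule card_image_le) simp
      finally show False using assms by simp
    qed
    have "sum ?W ?U < (\<Sum>j\<in>?U. \<gamma> / (6 * k) * mass C)"
      using neg ne by (intro sum_strict_mono) (auto simp: not_le)
    also have "\<dots> \<le> (\<Sum>j<k. \<gamma> / (6 * k) * mass C)" using \<gamma> by (intro sum_mono2) auto
    also have "\<dots> = \<gamma> / 6 * mass C" using k by simp
    finally show False using U by simp
  qed
  then obtain j where j: "j < k" "j \<notin> ?I" "\<gamma> / (6 * k) * mass C \<le> ?W j" by auto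
  have "0 < \<gamma> / (6 * k) * mass C" using \<gamma> k mass_pos[OF assms(2)] by simp
  then have "cl j \<noteq> {}" using j(3) by auto
  then show ?thesis using that[of j] j covers_snoc[OF \<sigma> j(1,2)] by blast
qed

text \<open>Points much closer to \<open>C\<close> than the average of their cluster are hardly ever drawn; they are
  represented by their nearest center, which displaces them little.\<close>

lemma proxies:
  assumes "A \<noteq> {}" "A \<subseteq> {..<n}" and C: "length C < k"
    and heavy: "\<gamma> / (6 * k) * mass C \<le> (\<Sum>p\<in>A. wt C p)"
    and \<mu>_def: "\<mu> = centroid A x"
  obtains \<phi> where "\<phi> ` A \<subseteq> {..<n + length C}"
    "(\<Sum>p\<in>A. dsq d (cand C (\<phi> p)) (x p)) \<le> 12 / m * (\<Sum>p\<in>A. dsq d (x p) \<mu>)"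
    "\<And>j. \<gamma> / (6 * k ^ 2 * m) * card {p\<in>A. \<phi> p = j} / card A \<le> cwt C j / total C"
proof -
  have fin: "finite A" using assms(2) finite_subset by blast
  have cA: "card A > 0" using fin assms(1) by auto
  let ?W = "\<Sum>p\<in>A. wt C p" and ?VA = "\<Sum>p\<in>A. dsq d (x p) \<mu>"
  have mass: "0 < mass C" using mass_pos C by simp
  have tot: "0 < total C" "total C \<le> k * mass C"
    using mass C by (auto simp: total_def mult.commute[of _ "mass C"])
  \<comment> \<open>The threshold is 1 / m of the average weight in \<open>A\<close>. The remaining
    points are heavy enough for a lower bound on their own draw probability.\<close>
  define near where "near p \<longleftrightarrow> C \<noteq> [] \<and> wt C p < 1 / m * (?W / card A)" for p
  have "\<exists>l. l < length C \<and> wt C p = dsq d (x p) (C ! l)" if "near p" for p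
    using wt_attained[of C p] that by (auto simp: near_def in_set_conv_nth)
  then obtain nc where nc: "\<And>p. near p \<Longrightarrow> nc p < length C"
    "\<And>p. near p \<Longrightarrow> wt C p = dsq d (x p) (C ! nc p)" by metis
  define \<phi> where "\<phi> p = (if near p then n + nc p else p)" for p
  have disp: "dsq d (cand C (\<phi> p)) (x p) \<le> 4 / m * (?VA / card A) + 8 / m * dsq d (x p) \<mu>"
    if p: "p \<in> A" for p
  proof (cases "near p")
    case False
    then show ?thesis using p assms(2) by (auto simp: \<phi>_def cand_def sum_nonneg)
  next
    case True
    \<comment> \<open>Serving all of \<open>A\<close> by \<open>?c\<close> bounds the average weight
      by the variance of \<open>A\<close>, the distance of \<open>p\<close> from
      \<open>\<mu>\<close> and \<open>wt C p\<close> itself. Nearness scales this by 1 / m, so the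
      term with \<open>wt C p\<close> can be absorbed on the left.\<close>
    let ?c = "C ! nc p"
    have "?W \<le> (\<Sum>p'\<in>A. 2 * dsq d (x p') \<mu> + 2 * dsq d \<mu> ?c)"
      using nc(1)[OF True]
      by (intro sum_mono order_trans[OF wt_le dsq_triangle]) auto
    also have "\<dots> = 2 * ?VA + 2 * card A * dsq d \<mu> ?c" by (simp add: sum.distrib sum_distrib_left)
    finally have W: "?W / card A \<le> 2 * (?VA / card A) + 2 * dsq d \<mu> ?c"
      using cA by (simp add: field_simps)
    have "dsq d \<mu> ?c \<le> 2 * dsq d (x p) \<mu> + 2 * wt C p"
      using dsq_triangle[of d \<mu> ?c "x p"] nc(2)[OF True] by (simp add: dsq_commute)
    with W have "?W / card A \<le> 2 * (?VA / card A) + 4 * dsq d (x p) \<mu> + 4 * wt C p" by simp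
    then have "1 / m * (?W / card A) \<le> 1 / m * (2 * (?VA / card A) + 4 * dsq d (x p) \<mu> + 4 * wt C p)"
      by (intro mult_left_mono) auto
    then have "wt C p \<le> 1 / m * (2 * (?VA / card A) + 4 * dsq d (x p) \<mu> + 4 * wt C p)"
      using True by (simp add: near_def)
    also have "\<dots> = 2 / m * (?VA / card A) + 4 / m * dsq d (x p) \<mu> + 4 / m * wt C p"
      by (simp add: distrib_left)
    also have "4 / m * wt C p \<le> 1 / 2 * wt C p"
      using m by (intro mult_right_mono) (auto simp: field_simps)
    finally have "wt C p \<le> 4 / m * (?VA / card A) + 8 / m * dsq d (x p) \<mu>" by simp
    then show ?thesis using True nc by (simp add: \<phi>_def cand_def dsq_commute)
  qed
  have lb1: "\<gamma> / (6 * k ^ 2 * m) \<le> 1 / k"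
  proof -
    have "\<gamma> \<le> 6 * k * m" using \<gamma> k m mult_mono[of 1 "real k" 1 "real m"] by simp
    then show ?thesis using k m by (simp add: field_simps power2_eq_square)
  qed
  \<comment> \<open>The factors are \<gamma> / (6 k) for the share of \<open>A\<close> in the mass,
    1 / m for the threshold of nearness, and another 1 / k because \<open>total C\<close> is at most
    \<open>k * mass C\<close>.\<close>
  have main: "\<gamma> / (6 * k ^ 2 * m) * card {p\<in>A. \<phi> p = j} / card A \<le> cwt C j / total C" for j
  proof (cases "{p\<in>A. \<phi> p = j} = {}")
    case True
    then show ?thesis using tot by (simp only: True) simp
  next
    case False
    then obtain p0 where p0: "p0 \<in> A" "\<phi> p0 = j" by auto
    have g0: "0 \<le> \<gamma> / (6 * k ^ 2 * m)" using \<gamma> by simp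
    show ?thesis
    proof (cases "j < n")
      case j: True
      have "{p\<in>A. \<phi> p = j} \<subseteq> {j}" using j by (auto simp: \<phi>_def split: if_splits)
      then have "card {p\<in>A. \<phi> p = j} \<le> 1" using card_mono[of "{j}"] by fastforce
      then have 1: "\<gamma> / (6 * k ^ 2 * m) * card {p\<in>A. \<phi> p = j} / card A \<le> \<gamma> / (6 * k ^ 2 * m) / card A"
        using g0 by (intro divide_right_mono mult_left_le) auto
      have p0': "p0 = j" "\<not> near j" using p0 j by (auto simp: \<phi>_def split: if_splits)
      have "1 / m * (?W / card A) \<le> wt C j"
      proof (cases "C = []")
        case True
        then have "?W = card A" "wt C j = 1" by (auto simp: wt_def)
        then show ?thesis using cA m by simp
      next
        case False
        then show ?thesis using p0' by (simp add: near_def)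
      qed
      moreover have "1 / m * (\<gamma> / (6 * k) * mass C / card A) \<le> 1 / m * (?W / card A)"
        using heavy by (intro mult_left_mono divide_right_mono) auto
      ultimately have "1 / m * (\<gamma> / (6 * k) * mass C / card A) \<le> wt C j" by simp
      then have "1 / m * (\<gamma> / (6 * k) * mass C / card A) / (k * mass C) \<le> wt C j / (k * mass C)"
        by (intro divide_right_mono) auto
      also have "\<dots> \<le> wt C j / total C" using tot k mass by (intro divide_left_mono) auto
      also have "1 / m * (\<gamma> / (6 * k) * mass C / card A) / (k * mass C) = \<gamma> / (6 * k ^ 2 * m) / card A"
        using mass by (simp add: field_simps power2_eq_square)
      finally show ?thesis using 1 j by (simp add: cwt_def)
    next
      \<comment> \<open>A center may represent all of \<open>A\<close>, but its own probability is
        at least 1 / k.\<close>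
      case j: False
      have "card {p\<in>A. \<phi> p = j} \<le> card A" using fin by (intro card_mono) auto
      then have "\<gamma> / (6 * k ^ 2 * m) * (card {p\<in>A. \<phi> p = j} / card A) \<le> \<gamma> / (6 * k ^ 2 * m) * 1"
        using cA by (intro mult_left_mono g0) (simp add: field_simps)
      also have "\<dots> \<le> 1 / k" using lb1 by simp
      also have "\<dots> \<le> mass C / total C"
        using tot mass k by (simp add: field_simps)
      finally show ?thesis using j by (simp add: cwt_def)
    qed
  qed
  have "(\<Sum>p\<in>A. dsq d (cand C (\<phi> p)) (x p)) \<le> (\<Sum>p\<in>A. 4 / m * (?VA / card A) + 8 / m * dsq d (x p) \<mu>)"
    by (intro sum_mono disp)
  also have "\<dots> = card A * (4 / m * (?VA / card A)) + 8 / m * ?VA"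
    by (simp add: sum.distrib sum_distrib_left)
  also have "\<dots> = 12 / m * ?VA" using cA by (simp add: field_simps)
  finally have "(\<Sum>p\<in>A. dsq d (cand C (\<phi> p)) (x p)) \<le> 12 / m * ?VA" .
  moreover have "\<phi> ` A \<subseteq> {..<n + length C}" using nc assms(2) by (force simp: \<phi>_def)
  ultimately show ?thesis using that main by blast
qed

text \<open>\<open>y\<close> is a point to aim at and \<open>v\<close> a variance around it: whatever the sum \<open>S\<close> of the earlier
  deviations is, a single draw increases \<open>nsq d S\<close> by hardly more than \<open>v\<close> with probability at least
  \<open>1 / m ^ 5\<close>.  This reduces the analysis of a mean of independent draws to single draws.\<close>

definition target :: "point list \<Rightarrow> point \<Rightarrow> real \<Rightarrow> bool" where
  "target C y v \<longleftrightarrow> 0 \<le> v \<and>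
     (\<forall>c. dsq d c y \<le> 3 * v / m \<longrightarrow> covers (C @ [c])) \<and>
     (\<forall>S. \<exists>J\<subseteq>{..<n + length C}. 1 / real m ^ 5 \<le> (\<Sum>j\<in>J. cwt C j / total C) \<and>
        (\<forall>j\<in>J. nsq d (\<lambda>l. S l + (cand C j l - y l)) \<le> (1 + 1 / m) * (nsq d S + v)))"

text \<open>The aim \<open>y\<close> is the centroid of the proxies and \<open>v\<close> their mean
  squared deviation. Over the cluster the squared norm of S + z - y averages to exactly
  \<open>nsq d S + v\<close>, as the cross term vanishes for every \<open>S\<close>;
  \<open>card_markov\<close> then selects the good proxies.\<close>

lemma target_exists:
  assumes "covers C" "length C < k"
  shows "\<exists>y v. target C y v"
proof -
  obtain j where j: "j < k" "cl j \<noteq> {}"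
    "\<And>c. (\<Sum>p\<in>cl j. dsq d (x p) c) \<le> (1 + \<gamma> / 2) * V j \<Longrightarrow> covers (C @ [c])"
    "\<gamma> / (6 * k) * mass C \<le> (\<Sum>p\<in>cl j. wt C p)"
    using heavy_uncovered_cluster[OF assms] by metis
  define A where "A = cl j"
  define \<mu> where "\<mu> = centroid A x"
  have A: "A \<noteq> {}" "A \<subseteq> {..<n}" "finite A" using j by (auto simp: A_def cl_def)
  then have cA: "card A > 0" by auto
  obtain \<phi> where \<phi>: "\<phi> ` A \<subseteq> {..<n + length C}"
    "(\<Sum>p\<in>A. dsq d (cand C (\<phi> p)) (x p)) \<le> 12 / m * (\<Sum>p\<in>A. dsq d (x p) \<mu>)"
    "\<And>j. \<gamma> / (6 * k ^ 2 * m) * card {p\<in>A. \<phi> p = j} / card A \<le> cwt C j / total C"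
    using proxies[OF A(1,2) assms(2) j(4)[folded A_def] \<mu>_def] by blast
  have VA: "V j = (\<Sum>p\<in>A. dsq d (x p) \<mu>)" by (simp add: V_def A_def \<mu>_def)
  define z where "z p = cand C (\<phi> p)" for p
  define y where "y = centroid A z"
  define v where "v = (\<Sum>p\<in>A. dsq d (z p) y) / card A"
  have m0: "m > 0" using m by simp
  have v0: "0 \<le> v" by (simp add: v_def sum_nonneg)
  have zx: "(\<Sum>p\<in>A. dsq d (z p) (x p)) \<le> 12 / m * V j" using \<phi>(2) by (simp add: z_def VA)
  have v4: "v \<le> 4 * (V j / card A)"
  proof -
    have "(\<Sum>p\<in>A. dsq d (z p) y) \<le> (\<Sum>p\<in>A. dsq d (z p) \<mu>)"
      unfolding y_def by (rule sum_dsq_centroid_le[OF A(3)])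
    also have "\<dots> \<le> (\<Sum>p\<in>A. 2 * dsq d (z p) (x p) + 2 * dsq d (x p) \<mu>)"
      by (intro sum_mono dsq_triangle)
    also have "\<dots> = 2 * (\<Sum>p\<in>A. dsq d (z p) (x p)) + 2 * V j"
      by (simp add: sum.distrib sum_distrib_left VA)
    also have "\<dots> \<le> 24 / m * V j + 2 * V j" using zx by simp
    also have "24 / m * V j \<le> 2 * V j" using m by (intro mult_right_mono) (auto simp: field_simps)
    finally show ?thesis using cA by (simp add: v_def field_simps)
  qed
  \<comment> \<open>Both \<open>c\<close> and \<open>\<mu>\<close> have squared distance at most 12
    / m times the variance from \<open>y\<close>: \<open>c\<close> because v is at most 4 variances,
    \<open>\<mu>\<close> by the displacement of the proxies. The triangle inequality doubles the sum
    to 48 / m, which is at most \<gamma> / 2.\<close>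
  have cov: "covers (C @ [c])" if c: "dsq d c y \<le> 3 * v / m" for c
  proof (rule j(3))
    have "card A * dsq d y \<mu> \<le> 12 / m * V j"
      using centroid_shift[OF A(3,1), of d z x] zx by (simp add: y_def \<mu>_def)
    then have 1: "dsq d y \<mu> \<le> 12 / m * (V j / card A)"
      using cA m0 by (simp add: pos_le_divide_eq mult_ac)
    have "dsq d c y \<le> 12 / m * (V j / card A)"
    proof -
      have "3 * v / m \<le> 3 * (4 * (V j / card A)) / m"
        using v4 by (intro divide_right_mono mult_left_mono) auto
      with c show ?thesis by (simp add: mult.commute)
    qed
    then have "dsq d c \<mu> \<le> 48 / m * (V j / card A)"
      using 1 dsq_triangle[of d c \<mu> y] by linarith
    also have "\<dots> \<le> \<gamma> / 2 * (V j / card A)"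
      using m by (intro mult_right_mono) (auto simp: field_simps)
    finally have "card A * dsq d \<mu> c \<le> \<gamma> / 2 * V j" using cA by (simp add: field_simps dsq_commute)
    then show "(\<Sum>p\<in>cl j. dsq d (x p) c) \<le> (1 + \<gamma> / 2) * V j"
      using sum_dsq_decomp[OF A(3,1), of d x c] by (simp add: A_def[symmetric] VA \<mu>_def algebra_simps)
  qed
  have draw: "\<exists>J\<subseteq>{..<n + length C}. 1 / real m ^ 5 \<le> (\<Sum>j\<in>J. cwt C j / total C) \<and>
        (\<forall>j\<in>J. nsq d (\<lambda>l. S l + (cand C j l - y l)) \<le> (1 + 1 / m) * (nsq d S + v))" for S
  proof -
    define Y where "Y i = nsq d (\<lambda>l. S l + (cand C i l - y l))" for i
    define G where "G = {p\<in>A. Y (\<phi> p) \<le> (1 + 1 / m) * (nsq d S + v)}"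
    have "(\<Sum>p\<in>A. Y (\<phi> p)) = (\<Sum>p\<in>A. dsq d (z p) (\<lambda>l. y l - S l))"
      by (simp add: Y_def z_def nsq_def dsq_def algebra_simps)
    also have "\<dots> = card A * v + card A * dsq d y (\<lambda>l. y l - S l)"
      unfolding sum_dsq_decomp[OF A(3,1), of d z "\<lambda>l. y l - S l"] using cA
      by (simp add: y_def[symmetric] v_def)
    also have "\<dots> = card A * (nsq d S + v)" by (simp add: nsq_def dsq_def algebra_simps)
    finally have sY: "(\<Sum>p\<in>A. Y (\<phi> p)) = card A * (nsq d S + v)" .
    have G: "real (card A) / (m + 1) \<le> card G"
      unfolding G_def using card_markov[OF A(3) _ sY] v0 m0 by (simp add: Y_def)
    have fG: "finite G" using A by (simp add: G_def)
    define b where "b = \<gamma> / (6 * k ^ 2 * m)"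
    have b0: "0 \<le> b" using \<gamma> by (simp add: b_def)
    \<comment> \<open>As k \<le> m, the denominator 6 k ^ 2 m (m + 1) is at most 12 m ^ 4, while m *
      \<gamma> \<ge> 96 makes m ^ 5 \<gamma> at least 96 m ^ 4.\<close>
    have "1 / real m ^ 5 \<le> b / (m + 1)"
    proof -
      have "6 * real k ^ 2 * m * (m + 1) * m \<le> 6 * real m ^ 2 * m * (2 * m) * m"
        using k m by (intro mult_mono power_mono) auto
      also have "\<dots> = 12 * real m ^ 5" by (simp add: eval_nat_numeral)
      also have "\<dots> \<le> real m ^ 5 * (real m * \<gamma>)" using m by (simp add: mult.commute[of "real m ^ 5"] mult_right_mono)
      finally have "6 * real k ^ 2 * m * (m + 1) * m \<le> real m ^ 5 * \<gamma> * m" by (simp add: mult_ac)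
      then have "6 * real k ^ 2 * m * (m + 1) \<le> real m ^ 5 * \<gamma>" using m0 by (simp add: mult_ac)
      moreover have D: "0 < 6 * real k ^ 2 * m * (m + 1)" and P: "0 < real m ^ 5" using k m0 by auto
      ultimately have "1 / real m ^ 5 \<le> \<gamma> / (6 * real k ^ 2 * m * (m + 1))"
        unfolding pos_le_divide_eq[OF D] times_divide_eq_left pos_divide_le_eq[OF P] by (simp add: mult_ac)
      then show ?thesis by (simp add: b_def)
    qed
    also have "\<dots> = b * (real (card A) / (m + 1)) / card A" using cA by simp
    also have "\<dots> \<le> b * card G / card A" using G b0 by (intro divide_right_mono mult_left_mono) auto
    \<comment> \<open>Several points may share a proxy, so the good points are grouped by proxy
      before the bound for single candidates is applied.\<close>
    also have "real (card G) = (\<Sum>j\<in>\<phi> ` G. real (card {p\<in>G. \<phi> p = j}))"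
    proof -
      have "card G = (\<Sum>j\<in>\<phi> ` G. card {p\<in>G. \<phi> p = j})"
        using sum.image_gen[OF fG, of "\<lambda>_. 1::nat" \<phi>] by simp
      then show ?thesis by simp
    qed
    also have "b * \<dots> / card A = (\<Sum>j\<in>\<phi> ` G. b * card {p\<in>G. \<phi> p = j} / card A)"
      by (simp add: sum_distrib_left sum_divide_distrib)
    also have "\<dots> \<le> (\<Sum>j\<in>\<phi> ` G. b * card {p\<in>A. \<phi> p = j} / card A)"
      using A b0 by (intro sum_mono divide_right_mono mult_left_mono of_nat_mono card_mono) (auto simp: G_def)
    also have "\<dots> \<le> (\<Sum>j\<in>\<phi> ` G. cwt C j / total C)" using \<phi>(3) by (intro sum_mono) (simp add: b_def)
    finally have "1 / real m ^ 5 \<le> (\<Sum>j\<in>\<phi> ` G. cwt C j / total C)" .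
    moreover have "\<phi> ` G \<subseteq> {..<n + length C}" using \<phi>(1) by (auto simp: G_def)
    moreover have "\<forall>j\<in>\<phi> ` G. Y j \<le> (1 + 1 / m) * (nsq d S + v)" by (auto simp: G_def)
    ultimately show ?thesis unfolding Y_def by blast
  qed
  show ?thesis unfolding target_def using v0 cov draw by blast
qed

end

section \<open>The cost functions\<close>

lemma kmeans_cost_le:
  assumes "\<And>p. p \<in> P \<Longrightarrow> \<exists>c\<in>C. dsq d p c \<le> w p"
  shows "kmeans_cost d P C \<le> ennreal (\<Sum>p\<in>P. w p)"
proof -
  have w: "0 \<le> w p" if "p \<in> P" for p
    using assms[OF that] dsq_nonneg order_trans by blast
  have "(dist_to_set d p C)\<^sup>2 \<le> ennreal (w p)" if p: "p \<in> P" for p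
  proof -
    obtain c where c: "c \<in> C" "dsq d p c \<le> w p" using assms[OF p] by blast
    have "dist_to_set d p C \<le> ennreal (edist d p c)"
      unfolding dist_to_set_def by (rule INF_lower) fact
    then have "(dist_to_set d p C)\<^sup>2 \<le> (ennreal (edist d p c))\<^sup>2" by (rule power_mono) simp
    also have "\<dots> = ennreal (dsq d p c)"
      by (simp add: ennreal_power edist_def edist_sq[symmetric])
    also have "\<dots> \<le> ennreal (w p)" using c by (intro ennreal_leI)
    finally show ?thesis .
  qed
  then have "kmeans_cost d P C \<le> (\<Sum>p\<in>P. ennreal (w p))"
    unfolding kmeans_cost_def by (rule sum_mono)
  also have "\<dots> = ennreal (\<Sum>p\<in>P. w p)" using w by (rule sum_ennreal)
  finally show ?thesis .
qed

lemma kmeans_cost_attained: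
  assumes "finite C" "C \<noteq> {}"
  obtains b where "b ` P \<subseteq> C" "kmeans_cost d P C = ennreal (\<Sum>p\<in>P. dsq d p (b p))"
proof -
  have "\<exists>c\<in>C. dist_to_set d p C = ennreal (edist d p c)" for p
  proof -
    have "Min ((\<lambda>c. ennreal (edist d p c)) ` C) \<in> (\<lambda>c. ennreal (edist d p c)) ` C"
      using assms by (intro Min_in) auto
    moreover have "Min ((\<lambda>c. ennreal (edist d p c)) ` C) = dist_to_set d p C"
      unfolding dist_to_set_def using assms by (subst Min_Inf) auto
    ultimately show ?thesis by auto
  qed
  then obtain b where b: "\<And>p. b p \<in> C" "\<And>p. dist_to_set d p C = ennreal (edist d p (b p))" by metis
  have "kmeans_cost d P C = (\<Sum>p\<in>P. ennreal (dsq d p (b p)))"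
    unfolding kmeans_cost_def b
    by (simp add: ennreal_power edist_def edist_sq[symmetric])
  also have "\<dots> = ennreal (\<Sum>p\<in>P. dsq d p (b p))" by (simp add: sum_ennreal)
  finally show ?thesis using that[of b] b(1) by blast
qed

lemma infinite_space_of_dim:
  assumes "1 \<le> d"
  shows "infinite (space_of_dim d)"
proof -
  let ?f = "\<lambda>(r::nat) i::nat. if i = 0 then real r else 0"
  have "inj ?f" by (auto simp: inj_on_def fun_eq_iff)
  then have "infinite (range ?f)" by (simp add: finite_image_iff)
  moreover have "range ?f \<subseteq> space_of_dim d" using assms by (auto simp: topspace_Euclidean_space)
  ultimately show ?thesis using finite_subset by blast
qed

text \<open>The infimum runs over sets of exactly \<open>j\<close> centers. A smaller set is padded
  with fresh centers, which exist since the space is infinite for d \<ge> 1 and can only lower the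
  cost.\<close>

lemma opt_cost_le:
  assumes "1 \<le> d" "C \<subseteq> space_of_dim d" "finite C" "card C \<le> j"
  shows "opt_cost d j P \<le> kmeans_cost d P C"
proof -
  have "infinite (space_of_dim d - C)" using infinite_space_of_dim assms by simp
  then obtain B where B: "finite B" "card B = j - card C" "B \<subseteq> space_of_dim d - C"
    using infinite_arbitrarily_large by blast
  have "card (C \<union> B) = j" using B assms by (subst card_Un_disjoint) auto
  then have "opt_cost d j P \<le> kmeans_cost d P (C \<union> B)"
    unfolding opt_cost_def using B assms by (intro INF_lower) auto
  also have "\<dots> \<le> kmeans_cost d P C"
    unfolding kmeans_cost_def dist_to_set_def
    by (intro sum_mono power_mono INF_superset_mono) auto
  finally show ?thesis .
qed

lemma kmeans_approx_self:
  assumes "P \<subseteq> space_of_dim d" "finite P" "card P \<le> k"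
  shows "kmeans_approx d k \<alpha> P P"
proof -
  have "kmeans_cost d P P \<le> ennreal (\<Sum>p\<in>P. 0)"
    by (rule kmeans_cost_le) (metis dsq_self order_refl)
  then show ?thesis using assms by (simp add: kmeans_approx_def)
qed

text \<open>Existence of an optimal center set is bypassed: each center set induces one of finitely
  many assignments, and replacing its centers by the centroids of the parts does not raise the cost.
  A minimal assignment therefore bounds the infimum from below, which serves irreducibility and the
  final comparison alike.\<close>

lemma optimal_assignment:
  assumes "1 \<le> k" "inj_on x {..<n}"
  obtains a where "\<And>p. p < n \<Longrightarrow> a p < k"
    "ennreal (\<Sum>j<k. clustering.V d n x a j) \<le> opt_cost d k (x ` {..<n})"
proof -
  let ?V = "\<lambda>a. \<Sum>j<k. clustering.V d n x a j"
  let ?F = "{..<n} \<rightarrow>\<^sub>E {..<k}"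
  have cl_cong: "clustering.cl n a = clustering.cl n b" if "\<And>p. p < n \<Longrightarrow> a p = b p" for a b
    using that by (auto simp: clustering.cl_def fun_eq_iff)
  have fin: "finite ?F" by (intro finite_PiE) auto
  have ne: "?F \<noteq> {}" using assms by (auto simp: PiE_eq_empty_iff lessThan_empty_iff)
  define a where "a = arg_min_on ?V ?F"
  have a: "a \<in> ?F" "\<And>b. b \<in> ?F \<Longrightarrow> ?V a \<le> ?V b"
    unfolding a_def by (rule arg_min_if_finite(1)[OF fin ne], rule arg_min_least[OF fin ne])
  have "ennreal (?V a) \<le> kmeans_cost d (x ` {..<n}) C"
    if C: "finite C" "card C = k" for C
  proof -
    have "C \<noteq> {}" using C assms by auto
    obtain b where b: "b ` (x ` {..<n}) \<subseteq> C"
      "kmeans_cost d (x ` {..<n}) C = ennreal (\<Sum>p\<in>x ` {..<n}. dsq d p (b p))"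
      using kmeans_cost_attained[OF C(1) \<open>C \<noteq> {}\<close>] by metis
    obtain h where h: "bij_betw h {..<k} C"
      using ex_bij_betw_nat_finite[OF C(1)] C(2) by (auto simp: atLeast0LessThan)
    define g where "g = restrict (\<lambda>p. inv_into {..<k} h (b (x p))) {..<n}"
    have hg: "h (g p) = b (x p)" "g p < k" if "p < n" for p
    proof -
      have "b (x p) \<in> h ` {..<k}" using b(1) h that by (auto simp: bij_betw_def)
      then show "h (g p) = b (x p)" "g p < k"
        using that f_inv_into_f[of "b (x p)" h "{..<k}"] inv_into_into[of "b (x p)" h "{..<k}"]
        by (auto simp: g_def)
    qed
    have gF: "g \<in> ?F" using hg by (auto simp: g_def)
    have "?V g \<le> (\<Sum>j<k. \<Sum>p\<in>clustering.cl n g j. dsq d (x p) (h j))"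
      unfolding clustering.V_def by (intro sum_mono sum_dsq_centroid_le) (simp add: clustering.cl_def)
    also have "\<dots> = (\<Sum>j<k. \<Sum>p\<in>clustering.cl n g j. dsq d (x p) (b (x p)))"
      using hg by (intro sum.cong refl) (auto simp: clustering.cl_def)
    also have "\<dots> = (\<Sum>p\<in>(\<Union>j<k. clustering.cl n g j). dsq d (x p) (b (x p)))"
      by (rule sum.UNION_disjoint[symmetric]) (auto simp: clustering.cl_def)
    also have "(\<Union>j<k. clustering.cl n g j) = {..<n}" using hg by (auto simp: clustering.cl_def)
    also have "(\<Sum>p<n. dsq d (x p) (b (x p))) = (\<Sum>p\<in>x ` {..<n}. dsq d p (b p))"
      using assms(2) by (simp add: sum.reindex)
    finally have "?V a \<le> (\<Sum>p\<in>x ` {..<n}. dsq d p (b p))" using a(2)[OF gF] by linarith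
    then show ?thesis unfolding b(2) by (rule ennreal_leI)
  qed
  then have "ennreal (?V a) \<le> opt_cost d k (x ` {..<n})"
    unfolding opt_cost_def by (intro INF_greatest) auto
  then show ?thesis using that[of a] a(1) by (auto simp: PiE_iff)
qed

section \<open>From sampling weights to k-means costs\<close>

context sampling begin

definition trunc :: "point \<Rightarrow> point" where
  "trunc c = (\<lambda>l. if l < d then c l else 0)"

lemma dsq_trunc [simp]: "dsq d y (trunc c) = dsq d y c"
  by (simp add: dsq_def trunc_def)

lemma trunc_in: "trunc c \<in> space_of_dim d"
  by (simp add: trunc_def topspace_Euclidean_space)

lemma kmeans_cost_le_mass:
  assumes "inj_on x {..<n}" "C \<noteq> []"
  shows "kmeans_cost d (x ` {..<n}) (trunc ` set C) \<le> ennreal (mass C)"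
proof -
  let ?w = "\<lambda>p. wt C (inv_into {..<n} x p)"
  have "kmeans_cost d (x ` {..<n}) (trunc ` set C) \<le> ennreal (\<Sum>p\<in>x ` {..<n}. ?w p)"
  proof (rule kmeans_cost_le)
    fix y assume "y \<in> x ` {..<n}"
    then obtain p where p: "p < n" "y = x p" by auto
    then obtain c where "c \<in> set C" "wt C p = dsq d (x p) c" using wt_attained assms(2) by blast
    then show "\<exists>c\<in>trunc ` set C. dsq d y c \<le> ?w y"
      using p assms(1) by (auto simp: inv_into_f_f)
  qed
  also have "(\<Sum>p\<in>x ` {..<n}. ?w p) = mass C"
    using assms(1) by (simp add: sum.reindex mass_def)
  finally show ?thesis .
qed

end

text \<open>A nonempty list of fewer than \<open>k\<close> centers is feasible for
  \<open>k - 1\<close> centers, hence its mass is at least 1 + \<gamma> times the optimum for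
  \<open>k\<close>.\<close>

lemma irreducible_clusteringI:
  assumes "1 \<le> d" "1 \<le> k" "k < n" "k \<le> m" "48 \<le> m" "96 \<le> real m * \<gamma>" "0 < \<gamma>" "\<gamma> < 2"
    and inj: "inj_on x {..<n}" and sp: "x ` {..<n} \<subseteq> space_of_dim d"
    and irr: "kmeans_irreducible d k \<gamma> (x ` {..<n})"
  obtains a where "irreducible_clustering d n k m x a \<gamma>"
    "ennreal (\<Sum>j<k. clustering.V d n x a j) \<le> opt_cost d k (x ` {..<n})"
proof -
  let ?P = "x ` {..<n}"
  obtain a where a: "\<And>p. p < n \<Longrightarrow> a p < k"
    "ennreal (\<Sum>j<k. clustering.V d n x a j) \<le> opt_cost d k ?P"
    using optimal_assignment[OF assms(2) inj] by metis
  interpret clustering d n k m x a \<gamma> .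
  have "irreducible_clustering d n k m x a \<gamma>"
  proof
    fix C :: "point list" assume C: "C \<noteq> []" "length C < k"
    have "ennreal ((1 + \<gamma>) * (\<Sum>j<k. V j)) = ennreal (1 + \<gamma>) * ennreal (\<Sum>j<k. V j)"
      using assms by (intro ennreal_mult) (auto intro: sum_nonneg)
    also have "\<dots> \<le> ennreal (1 + \<gamma>) * opt_cost d k ?P" by (intro mult_left_mono a) auto
    also have "\<dots> \<le> opt_cost d (k - 1) ?P" using irr by (simp add: kmeans_irreducible_def)
    also have "\<dots> \<le> kmeans_cost d ?P (trunc ` set C)"
    proof (rule opt_cost_le)
      have "card (trunc ` set C) \<le> length C"
        using card_image_le[of "set C" trunc] card_length[of C] by simp
      then show "card (trunc ` set C) \<le> k - 1" using C by simp
    qed (use assms trunc_in in auto)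
    also have "\<dots> \<le> ennreal (mass C)" by (rule kmeans_cost_le_mass[OF inj C(1)])
    finally show "(1 + \<gamma>) * (\<Sum>j<k. V j) \<le> mass C" by (simp add: ennreal_le_iff)
  next
    fix C :: "point list" assume C: "length C < k"
    show "0 < mass C"
    proof (cases "C = []")
      case True
      then show ?thesis using assms by (simp add: mass_def wt_def)
    next
      case False
      \<comment> \<open>Zero mass would place every one of the n > k distinct points on one of fewer
        than \<open>k\<close> centers.\<close>
      have "mass C \<noteq> 0"
      proof
        assume "mass C = 0"
        then have 0: "wt C p = 0" if "p < n" for p
          using that sum_nonneg_eq_0_iff[of "{..<n}" "wt C"] by (auto simp: mass_def)
        have "x p \<in> trunc ` set C" if p: "p < n" for p
        proof -
          obtain c where c: "c \<in> set C" "dsq d (x p) c = 0"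
            using wt_attained[OF False, of p] 0[OF p] by auto
          then have "x p l = c l" if "l < d" for l
            using that sum_nonneg_eq_0_iff[of "{..<d}" "\<lambda>l. (x p l - c l)\<^sup>2"] by (auto simp: dsq_def)
          moreover have "x p l = 0" if "\<not> l < d" for l
            using sp p that by (auto simp: topspace_Euclidean_space)
          ultimately have "x p = trunc c" by (auto simp: trunc_def fun_eq_iff)
          with c show ?thesis by blast
        qed
        then have "?P \<subseteq> trunc ` set C" by auto
        then have "card ?P \<le> card (trunc ` set C)" by (intro card_mono) auto
        then show False
          using card_image_le[of "set C" trunc] card_length[of C] C assms by (simp add: card_image)
      qed
      then show ?thesis using mass_nonneg[of C] by linarith
    qed
  qed (use a assms in auto)
  then show ?thesis using that a(2) by blast
qed

text \<open>One covering attempt \<open>C\<close> suffices: the selected \<open>C'\<close> is at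
  most as heavy and inherits the bound, whether or not it covers.\<close>

lemma (in irreducible_clustering) covers_approx:
  assumes "inj_on x {..<n}" "covers C" "length C = k"
    and opt: "ennreal (\<Sum>j<k. V j) \<le> opt_cost d k (x ` {..<n})"
    and C': "C' \<noteq> []" "mass C' \<le> mass C" "length C' = k"
  shows "kmeans_approx d k (1 + \<gamma>) (x ` {..<n}) (trunc ` set C')"
proof -
  have "kmeans_cost d (x ` {..<n}) (trunc ` set C') \<le> ennreal (mass C')"
    by (rule kmeans_cost_le_mass) fact+
  also have "\<dots> \<le> ennreal ((1 + \<gamma>) * (\<Sum>j<k. V j))"
  proof (rule ennreal_leI)
    have "mass C' \<le> (1 + \<gamma> / 2) * (\<Sum>j<k. V j)" using mass_covers[OF assms(2,3)] C' by simp
    also have "\<dots> \<le> (1 + \<gamma>) * (\<Sum>j<k. V j)" using \<gamma> by (intro mult_right_mono) (auto intro: sum_nonneg)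
    finally show "mass C' \<le> (1 + \<gamma>) * (\<Sum>j<k. V j)" .
  qed
  also have "\<dots> = ennreal (1 + \<gamma>) * ennreal (\<Sum>j<k. V j)"
    using \<gamma> by (intro ennreal_mult) (auto intro: sum_nonneg)
  also have "\<dots> \<le> ennreal (1 + \<gamma>) * opt_cost d k (x ` {..<n})" by (intro mult_left_mono opt) auto
  finally show ?thesis
    using trunc_in card_image_le[of "set C'" trunc] card_length[of C'] C'
    by (auto simp: kmeans_approx_def)
qed

section \<open>The random tape\<close>

abbreviation unit_uniform :: "real measure" where
  "unit_uniform \<equiv> restrict_space lborel {0..1}"

lemma prob_space_unit_uniform: "prob_space unit_uniform"
  by (rule prob_spaceI) (simp add: emeasure_restrict_space space_restrict_space)

lemma sequence_space_unit_uniform: "sequence_space unit_uniform"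
  by (intro sequence_space.intro product_prob_space.intro product_sigma_finite.intro
      product_prob_space_axioms.intro prob_space_unit_uniform prob_space_imp_sigma_finite)

interpretation tape_prob: prob_space random_tape
  unfolding random_tape_def by (intro prob_space_PiM prob_space_unit_uniform)

lemma measurable_tape_component [measurable]: "(\<lambda>\<omega>. \<omega> t) \<in> borel_measurable random_tape"
proof -
  have "(\<lambda>\<omega>. \<omega> t) \<in> measurable random_tape unit_uniform"
    unfolding random_tape_def by (rule measurable_component_singleton) simp
  then show ?thesis by (simp add: measurable_restrict_space2_iff)
qed

lemma comb_seq_in_space:
  "\<omega> \<in> space random_tape \<Longrightarrow> \<omega>' \<in> space random_tape \<Longrightarrow> comb_seq N \<omega> \<omega>' \<in> space random_tape"
  by (auto simp: random_tape_def space_PiM PiE_iff comb_seq_def)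

text \<open>Splitting the tape after \<open>N\<close> entries conditions on the past.\<close>

lemma prob_step:
  assumes [measurable]: "E \<in> sets random_tape" "E' \<in> sets random_tape" and "0 \<le> q"
    and step: "\<And>\<omega>. \<omega> \<in> E \<Longrightarrow>
      q \<le> measure random_tape {\<omega>' \<in> space random_tape. comb_seq N \<omega> \<omega>' \<in> E'}"
  shows "q * measure random_tape E \<le> measure random_tape E'"
proof -
  let ?S = "random_tape" and ?g = "\<lambda>(\<omega>, \<omega>'). comb_seq N \<omega> \<omega>'"
  have g: "?g \<in> measurable (?S \<Otimes>\<^sub>M ?S) ?S"
    unfolding random_tape_def by (rule measurable_comb_seq)
  have [measurable]: "?g -` E' \<inter> space (?S \<Otimes>\<^sub>M ?S) \<in> sets (?S \<Otimes>\<^sub>M ?S)"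
    by (rule measurable_sets[OF g]) simp
  have "ennreal q * emeasure ?S E = (\<integral>\<^sup>+\<omega>. ennreal q * indicator E \<omega> \<partial>?S)"
    by (simp add: nn_integral_cmult_indicator)
  also have "\<dots> \<le> (\<integral>\<^sup>+\<omega>. emeasure ?S (Pair \<omega> -` (?g -` E' \<inter> space (?S \<Otimes>\<^sub>M ?S))) \<partial>?S)"
  proof (rule nn_integral_mono)
    fix \<omega> assume \<omega>: "\<omega> \<in> space ?S"
    have eq: "Pair \<omega> -` (?g -` E' \<inter> space (?S \<Otimes>\<^sub>M ?S)) = {\<omega>' \<in> space ?S. comb_seq N \<omega> \<omega>' \<in> E'}"
      using \<omega> by (auto simp: space_pair_measure)
    show "ennreal q * indicator E \<omega> \<le> emeasure ?S (Pair \<omega> -` (?g -` E' \<inter> space (?S \<Otimes>\<^sub>M ?S)))"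
      unfolding eq using step[of \<omega>]
      by (auto simp: indicator_def tape_prob.emeasure_eq_measure ennreal_leI)
  qed
  also have "\<dots> = emeasure (?S \<Otimes>\<^sub>M ?S) (?g -` E' \<inter> space (?S \<Otimes>\<^sub>M ?S))"
    by (rule tape_prob.emeasure_pair_measure_alt[symmetric]) simp
  also have "\<dots> = emeasure (distr (?S \<Otimes>\<^sub>M ?S) ?S ?g) E'"
    by (rule emeasure_distr[symmetric, OF g]) simp
  \<comment> \<open>A prefix of one tape continued by an independent second tape is again
    distributed like the tape; this makes the fresh entries independent of the past.\<close>
  also have "distr (?S \<Otimes>\<^sub>M ?S) ?S ?g = ?S"
    unfolding random_tape_def by (rule sequence_space.PiM_comb_seq[OF sequence_space_unit_uniform])
  finally have "ennreal (q * measure ?S E) \<le> ennreal (measure ?S E')"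
    using \<open>0 \<le> q\<close> by (simp add: tape_prob.emeasure_eq_measure ennreal_mult)
  then show ?thesis by (simp add: ennreal_le_iff)
qed

lemma prob_first:
  assumes "B \<in> sets borel"
  shows "measure random_tape {\<omega> \<in> space random_tape. \<omega> 0 \<in> B} = measure lborel (B \<inter> {0..1})"
proof -
  have B: "B \<inter> {0..1} \<in> sets unit_uniform"
    using assms by (auto simp: sets_restrict_space)
  have "measure unit_uniform (B \<inter> {0..1}) = measure (distr random_tape unit_uniform (\<lambda>\<omega>. \<omega> 0)) (B \<inter> {0..1})"
    unfolding random_tape_def by (subst distr_PiM_component) (auto intro: prob_space_unit_uniform)
  also have "\<dots> = measure random_tape ((\<lambda>\<omega>. \<omega> 0) -` (B \<inter> {0..1}) \<inter> space random_tape)"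
    by (rule measure_distr[OF _ B]) (auto simp: random_tape_def)
  also have "(\<lambda>\<omega>. \<omega> 0) -` (B \<inter> {0..1}) \<inter> space random_tape = {\<omega> \<in> space random_tape. \<omega> 0 \<in> B}"
    by (auto simp: random_tape_def space_PiM space_restrict_space PiE_iff)
  also have "measure unit_uniform (B \<inter> {0..1}) = measure lborel (B \<inter> {0..1})"
    by (rule measure_restrict_space) auto
  finally show ?thesis by simp
qed

section \<open>Measurability through finitely many values\<close>

lemma simple_function_dependent:
  assumes f: "simple_function M f" and g: "\<And>c. simple_function M (g c)"
  shows "simple_function M (\<lambda>\<omega>. g (f \<omega>) \<omega>)"
  unfolding simple_function_def
proof (intro conjI ballI)
  let ?U = "\<Union>c\<in>f ` space M. g c ` space M"
  have "finite ?U" using f g by (intro finite_UN_I) (auto simp: simple_function_def)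
  then show "finite ((\<lambda>\<omega>. g (f \<omega>) \<omega>) ` space M)" by (rule finite_subset[rotated]) auto
next
  fix y
  have "(\<lambda>\<omega>. g (f \<omega>) \<omega>) -` {y} \<inter> space M =
    (\<Union>c\<in>f ` space M. (f -` {c} \<inter> space M) \<inter> (g c -` {y} \<inter> space M))" by auto
  also have "\<dots> \<in> sets M"
    using f g by (intro sets.finite_UN sets.Int simple_functionD(2)) (auto simp: simple_function_def)
  finally show "(\<lambda>\<omega>. g (f \<omega>) \<omega>) -` {y} \<inter> space M \<in> sets M" .
qed

text \<open>Every predicate of a finite-valued result is an event, so lists of points need no
  measurable structure.\<close>

lemma simple_function_event:
  assumes "simple_function M f"
  shows "{\<omega> \<in> space M. Q (f \<omega>)} \<in> sets M"
proof -
  have "f -` {y. Q y} \<inter> space M \<in> sets M" by (rule simple_functionD(2)[OF assms])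
  also have "f -` {y. Q y} \<inter> space M = {\<omega> \<in> space M. Q (f \<omega>)}" by auto
  finally show ?thesis .
qed

context sampling begin

lemma measurable_pick [measurable]: "pick C \<in> measurable borel (count_space UNIV)"
  unfolding pick_def by measurable

lemma simple_pick:
  assumes "1 \<le> n"
  shows "simple_function random_tape (\<lambda>\<omega>. pick C (\<omega> t))"
  unfolding simple_function_def
proof (intro conjI ballI)
  show "finite ((\<lambda>\<omega>. pick C (\<omega> t)) ` space random_tape)"
    by (rule finite_subset[of _ "{..<n + length C}"]) (use pick_less[OF assms] in auto)
qed measurable

lemma simple_picks:
  assumes "1 \<le> n"
  shows "simple_function random_tape (\<lambda>\<omega>. map (\<lambda>s. pick C (\<omega> (u + s))) [0..<t])"
proof (induction t)
  case (Suc t)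
  have "simple_function random_tape
      (\<lambda>\<omega>. map (\<lambda>s. pick C (\<omega> (u + s))) [0..<t] @ [pick C (\<omega> (u + t))])"
    by (rule simple_function_compose2[OF Suc.IH simple_pick[OF assms]])
  then show ?case by simp
qed simp

text \<open>The tape is read only through \<open>pick\<close>, which takes finitely many values for
  fixed \<open>C\<close>; \<open>simple_function_dependent\<close> then substitutes the random
  \<open>C\<close>.\<close>

lemma simple_rounds:
  assumes "1 \<le> n"
  shows "simple_function random_tape (\<lambda>\<omega>. rounds \<omega> u i)"
proof (induction i)
  case (Suc i)
  have m: "mean C (\<lambda>s. pick C (\<omega> (u + i * m + s))) =
      mean C ((!) (map (\<lambda>s. pick C (\<omega> (u + i * m + s))) [0..<m]))" for C \<omega>
    by (rule mean_cong) simp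
  have "simple_function random_tape (\<lambda>\<omega>. mean C (\<lambda>s. pick C (\<omega> (u + i * m + s))))" for C
    unfolding m by (rule simple_function_compose1[OF simple_picks[OF assms]])
  then have "simple_function random_tape
      (\<lambda>\<omega>. mean (rounds \<omega> u i) (\<lambda>s. pick (rounds \<omega> u i) (\<omega> (u + i * m + s))))"
    by (rule simple_function_dependent[OF Suc.IH])
  from simple_function_compose2[OF Suc.IH this, of "\<lambda>C c. C @ [c]"] show ?case by simp
qed simp

lemma simple_run: "1 \<le> n \<Longrightarrow> simple_function random_tape (\<lambda>\<omega>. run \<omega> r)"
  unfolding run_def by (rule simple_rounds)

lemma simple_best:
  assumes "1 \<le> n"
  shows "simple_function random_tape (\<lambda>\<omega>. best \<omega> r)"
proof (induction r)
  case (Suc r)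
  show ?case
    using simple_function_compose2[OF simple_run[OF assms, of r] Suc.IH,
        of "\<lambda>a b. if r = 0 \<or> mass a < mass b then a else b"] by simp
qed simp

text \<open>The candidates own consecutive half-open intervals of lengths
  \<open>cwt C j / total C\<close>. On the interval of \<open>j\<close> the value of
  \<open>pick\<close> is \<open>j\<close>; an inequality suffices, and the endpoint
  \<open>u = 1\<close> lies in none of them.\<close>

lemma prob_pick:
  assumes "1 \<le> n" "0 < total C" "J \<subseteq> {..<n + length C}"
  shows "(\<Sum>j\<in>J. cwt C j / total C) \<le>
    measure random_tape {\<omega> \<in> space random_tape. pick C (\<omega> 0) \<in> J}"
proof -
  let ?pre = "\<lambda>j. \<Sum>i<j. cwt C i"
  let ?B = "\<lambda>j. {?pre j / total C ..< ?pre (Suc j) / total C}"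
  have fin: "finite J" using assms(3) finite_subset by blast
  have pre_mono: "?pre i \<le> ?pre j" if "i \<le> j" for i j
    using that by (intro sum_mono2) auto
  have sub: "?B j \<subseteq> {0..1}" if "j \<in> J" for j
  proof -
    have "?pre (Suc j) \<le> total C"
      using that assms(3) pre_mono[of "Suc j" "n + length C"] by (auto simp: sum_cwt)
    then have "?pre (Suc j) / total C \<le> 1" using assms(2) by simp
    moreover have "0 \<le> ?pre j / total C" using assms(2) by (simp add: sum_nonneg)
    ultimately show ?thesis by fastforce
  qed
  have pick: "pick C u = j" if "j \<in> J" "u \<in> ?B j" for j u
    unfolding pick_def
  proof (rule Least_equality)
    have u: "?pre j \<le> u * total C" "u * total C < ?pre (Suc j)"
      using that assms(2) by (auto simp: field_simps)
    show "\<not> (Suc j < n + length C \<and> (\<Sum>i\<le>j. cwt C i) \<le> u * total C)"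
      using u by (simp add: lessThan_Suc_atMost)
    fix i assume i: "\<not> (Suc i < n + length C \<and> (\<Sum>i\<le>i. cwt C i) \<le> u * total C)"
    show "j \<le> i"
    proof (rule ccontr)
      assume "\<not> j \<le> i"
      then have "Suc i \<le> j" by simp
      then have "?pre (Suc i) \<le> u * total C" using pre_mono[of "Suc i" j] u by simp
      moreover have "Suc i < n + length C" using \<open>Suc i \<le> j\<close> that(1) assms(3) by auto
      ultimately show False using i by (simp add: lessThan_Suc_atMost)
    qed
  qed
  have "(\<Sum>j\<in>J. cwt C j / total C) = (\<Sum>j\<in>J. measure lborel (?B j))"
    using assms(2) by (intro sum.cong refl) (simp add: divide_right_mono diff_divide_distrib[symmetric])
  also have "\<dots> = measure lborel (\<Union>j\<in>J. ?B j)"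
  proof (rule measure_finite_Union[symmetric])
    \<comment> \<open>A common point of two intervals would have both indices as its
      \<open>pick\<close>.\<close>
    show "disjoint_family_on ?B J" unfolding disjoint_family_on_def
      using pick by (metis (no_types, lifting) disjoint_iff)
    fix j assume "j \<in> J"
    then have "emeasure lborel (?B j) \<le> emeasure lborel {0..1::real}"
      by (intro emeasure_mono sub) auto
    then show "emeasure lborel (?B j) \<noteq> \<infinity>" by (auto simp: top_unique)
  qed (auto simp: fin)
  also have "\<dots> \<le> measure lborel ({u. pick C u \<in> J} \<inter> {0..1})"
  proof (rule measure_mono_fmeasurable)
    show "(\<Union>j\<in>J. ?B j) \<subseteq> {u. pick C u \<in> J} \<inter> {0..1}"
    proof
      fix u assume "u \<in> (\<Union>j\<in>J. ?B j)"
      then obtain j where j: "j \<in> J" "u \<in> ?B j" by blast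
      then show "u \<in> {u. pick C u \<in> J} \<inter> {0..1}" using pick[OF j] sub[OF j(1)] by blast
    qed
    show "{u. pick C u \<in> J} \<inter> {0..1} \<in> fmeasurable lborel"
      by (rule fmeasurableI2[of "{0..1}"]) (auto intro!: fmeasurableI)
  qed (auto intro!: sets.finite_UN fin)
  also have "\<dots> = measure random_tape {\<omega> \<in> space random_tape. \<omega> 0 \<in> {u. pick C u \<in> J}}"
    by (rule prob_first[symmetric]) measurable
  finally show ?thesis by simp
qed

lemma run_cong:
  "(\<And>t. t < Suc r * (k * m) \<Longrightarrow> \<omega> t = \<omega>' t) \<Longrightarrow> run \<omega> r = run \<omega>' r"
  unfolding run_def by (rule rounds_cong) auto

end

section \<open>Probability that all attempts fail\<close>

context irreducible_clustering begin

text \<open>The target is a fixed function of \<open>C\<close>, so that the events below depend only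
  on tape entries already read.\<close>

definition aim :: "point list \<Rightarrow> point" where
  "aim C = (SOME y. \<exists>v. target C y v)"

definition spread :: "point list \<Rightarrow> real" where
  "spread C = (SOME v. target C (aim C) v)"

lemma target: "covers C \<Longrightarrow> length C < k \<Longrightarrow> target C (aim C) (spread C)"
  unfolding spread_def aim_def using target_exists[of C] by (metis (mono_tags, lifting) someI_ex)

lemma target_draw:
  "target C y v \<Longrightarrow> \<exists>J\<subseteq>{..<n + length C}. 1 / real m ^ 5 \<le> (\<Sum>j\<in>J. cwt C j / total C) \<and>
     (\<forall>j\<in>J. nsq d (\<lambda>l. S l + (cand C j l - y l)) \<le> (1 + 1 / m) * (nsq d S + v))"
  unfolding target_def by (elim conjE) (erule spec)

definition dev :: "point list \<Rightarrow> (nat \<Rightarrow> nat) \<Rightarrow> nat \<Rightarrow> point" where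
  "dev C f t = (\<lambda>l. \<Sum>s<t. cand C (f s) l - aim C l)"

text \<open>The bound dominates the recursion in which an accepted draw turns e into at most (1 + 1
  / m) (e + \<open>spread C\<close>). At \<open>t = 0\<close> it is trivial and only coverage
  remains.\<close>

definition on_track :: "(nat \<Rightarrow> real) \<Rightarrow> nat \<Rightarrow> nat \<Rightarrow> nat \<Rightarrow> bool" where
  "on_track \<omega> u i t \<longleftrightarrow> (let C = rounds \<omega> u i in covers C \<and>
     nsq d (dev C (\<lambda>s. pick C (\<omega> (u + i * m + s))) t) \<le> (1 + 1 / m) ^ t * t * spread C)"

definition failed :: "(nat \<Rightarrow> real) \<Rightarrow> nat \<Rightarrow> bool" where
  "failed \<omega> r \<longleftrightarrow> (\<forall>r'<r. \<not> covers (run \<omega> r'))"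

text \<open>Failure of all earlier attempts is included, so that success of attempt \<open>r\<close>
  counts as a first success and the failure probabilities can be chained.\<close>

definition track_event :: "nat \<Rightarrow> nat \<Rightarrow> nat \<Rightarrow> (nat \<Rightarrow> real) set" where
  "track_event r i t = {\<omega> \<in> space random_tape. failed \<omega> r \<and> on_track \<omega> (r * (k * m)) i t}"

definition fail_event :: "nat \<Rightarrow> (nat \<Rightarrow> real) set" where
  "fail_event r = {\<omega> \<in> space random_tape. failed \<omega> r}"

lemma fail_event_measurable [measurable]: "fail_event r \<in> sets random_tape"
proof -
  have "fail_event r = space random_tape \<inter> (\<Inter>r'\<in>{..<r}. {\<omega> \<in> space random_tape. \<not> covers (run \<omega> r')}) "
    if "r > 0" using that by (auto simp: fail_event_def failed_def)
  moreover have "{\<omega> \<in> space random_tape. \<not> covers (run \<omega> r')} \<in> sets random_tape" for r'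
    by (rule simple_function_event[OF simple_run[OF n]])
  moreover have "fail_event 0 = space random_tape" by (auto simp: fail_event_def failed_def)
  ultimately show ?thesis by (cases "r = 0") (auto intro!: sets.finite_INT)
qed

lemma dev_cong: "(\<And>s. s < t \<Longrightarrow> f s = g s) \<Longrightarrow> dev C f t = dev C g t"
  by (simp add: dev_def)

lemma track_event_measurable [measurable]: "track_event r i t \<in> sets random_tape"
proof -
  let ?u = "r * (k * m)"
  let ?Q = "\<lambda>C js. covers C \<and> nsq d (dev C ((!) js) t) \<le> (1 + 1 / m) ^ t * t * spread C"
  have dv: "dev C ((!) (map f [0..<t])) t = dev C f t" for C f by (rule dev_cong) simp
  have "simple_function random_tape (\<lambda>\<omega>.
      (rounds \<omega> ?u i, map (\<lambda>s. pick (rounds \<omega> ?u i) (\<omega> (?u + i * m + s))) [0..<t]))"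
    by (rule simple_function_compose2[OF simple_rounds[OF n]
          simple_function_dependent[OF simple_rounds[OF n] simple_picks[OF n]]])
  then have "{\<omega> \<in> space random_tape. ?Q (rounds \<omega> ?u i)
      (map (\<lambda>s. pick (rounds \<omega> ?u i) (\<omega> (?u + i * m + s))) [0..<t])} \<in> sets random_tape"
    using simple_function_event[of random_tape _ "\<lambda>(C, js). ?Q C js"] by fastforce
  then have "{\<omega> \<in> space random_tape. on_track \<omega> ?u i t} \<in> sets random_tape"
    by (simp add: dv on_track_def Let_def)
  moreover have "track_event r i t = fail_event r \<inter> {\<omega> \<in> space random_tape. on_track \<omega> ?u i t}"
    by (auto simp: track_event_def fail_event_def)
  ultimately show ?thesis by simp
qed

text \<open>\<open>N\<close> entries are read before draw \<open>t\<close> of round \<open>i\<close>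
  in attempt \<open>r\<close>. They fix the earlier runs, \<open>C\<close> and the deviation so far;
  the draw itself uses entry 0 of a fresh tape.\<close>

lemma track_event_Suc:
  assumes "i < k" "t < m"
  shows "1 / real m ^ 5 * measure random_tape (track_event r i t) \<le>
    measure random_tape (track_event r i (Suc t))"
proof (rule prob_step)
  fix \<omega> assume \<omega>: "\<omega> \<in> track_event r i t"
  define u where "u = r * (k * m)"
  define N where "N = u + i * m + t"
  define C where "C = rounds \<omega> u i"
  define f where "f = (\<lambda>s. pick C (\<omega> (u + i * m + s)))"
  define D where "D = dev C f t"
  have sp: "\<omega> \<in> space random_tape" and fl: "failed \<omega> r" and cov: "covers C"
    and D: "nsq d D \<le> (1 + 1 / m) ^ t * t * spread C"
    using \<omega> by (auto simp: track_event_def on_track_def Let_def u_def C_def D_def f_def)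
  have len: "length C = i" by (simp add: C_def)
  have tg: "target C (aim C) (spread C)" using target[OF cov] assms len by simp
  obtain J where J: "J \<subseteq> {..<n + length C}" "1 / real m ^ 5 \<le> (\<Sum>j\<in>J. cwt C j / total C)"
    "\<And>j. j \<in> J \<Longrightarrow> nsq d (\<lambda>l. D l + (cand C j l - aim C l)) \<le> (1 + 1 / m) * (nsq d D + spread C)"
    using target_draw[OF tg, of D] by blast
  have "0 < total C" using mass_pos[of C] assms len by (simp add: total_def)
  then have "1 / real m ^ 5 \<le> measure random_tape {\<omega> \<in> space random_tape. pick C (\<omega> 0) \<in> J}"
    using prob_pick[OF n _ J(1)] J(2) by simp
  also have "\<dots> \<le> measure random_tape {\<omega>' \<in> space random_tape. comb_seq N \<omega> \<omega>' \<in> track_event r i (Suc t)}"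
  proof (rule tape_prob.finite_measure_mono)
    show "{\<omega>' \<in> space random_tape. comb_seq N \<omega> \<omega>' \<in> track_event r i (Suc t)} \<in> sets random_tape"
    proof -
      have "(\<lambda>\<omega>'. comb_seq N \<omega> \<omega>') \<in> measurable random_tape random_tape"
        using sp unfolding random_tape_def by (intro measurable_comb_seq') auto
      from measurable_sets[OF this track_event_measurable[of r i "Suc t"]]
      show ?thesis by (simp add: vimage_def Int_def conj_commute)
    qed
  next
    show "{\<omega> \<in> space random_tape. pick C (\<omega> 0) \<in> J} \<subseteq>
        {\<omega>' \<in> space random_tape. comb_seq N \<omega> \<omega>' \<in> track_event r i (Suc t)}"
    proof safe
      fix \<omega>' assume \<omega>': "\<omega>' \<in> space random_tape" "pick C (\<omega>' 0) \<in> J"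
      let ?\<omega> = "comb_seq N \<omega> \<omega>'"
      have old: "?\<omega> s = \<omega> s" if "s < N" for s using that by (simp add: comb_seq_def)
      have new: "?\<omega> N = \<omega>' 0" by (simp add: comb_seq_def)
      have run_eq: "run ?\<omega> r' = run \<omega> r'" if "r' < r" for r'
      proof (rule run_cong)
        fix s assume "s < Suc r' * (k * m)"
        also have "\<dots> \<le> r * (k * m)" using that by (intro mult_right_mono) auto
        finally show "?\<omega> s = \<omega> s" by (intro old) (simp add: N_def u_def)
      qed
      have C_eq: "rounds ?\<omega> u i = C"
        unfolding C_def by (rule rounds_cong, rule old) (simp add: N_def)
      let ?f = "\<lambda>s. pick C (?\<omega> (u + i * m + s))"
      have "dev C ?f t = D" unfolding D_def f_def by (rule dev_cong, subst old) (simp_all add: N_def)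
      moreover have "?f t = pick C (\<omega>' 0)" using new by (simp add: N_def)
      ultimately have dS: "dev C ?f (Suc t) = (\<lambda>l. D l + (cand C (pick C (\<omega>' 0)) l - aim C l))"
        by (auto simp: dev_def fun_eq_iff)
      have sp0: "0 \<le> spread C" using tg by (simp add: target_def)
      have one: "1 \<le> (1 + 1 / real m) ^ t" by (rule one_le_power) simp
      have "nsq d (dev C ?f (Suc t)) \<le> (1 + 1 / m) * (nsq d D + spread C)"
        unfolding dS by (rule J(3)[OF \<omega>'(2)])
      also have "\<dots> \<le> (1 + 1 / m) * ((1 + 1 / m) ^ t * t * spread C + (1 + 1 / m) ^ t * spread C)"
        using D mult_right_mono[OF one sp0] by (intro mult_left_mono add_mono) auto
      also have "\<dots> = (1 + 1 / m) ^ Suc t * Suc t * spread C" by (simp add: algebra_simps add_divide_distrib)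
      finally have "on_track ?\<omega> u i (Suc t)" by (simp add: on_track_def C_eq cov)
      moreover have "failed ?\<omega> r" using fl run_eq by (simp add: failed_def)
      ultimately show "?\<omega> \<in> track_event r i (Suc t)"
        using comb_seq_in_space[OF sp \<omega>'(1)] by (simp add: track_event_def u_def)
    qed
  qed
  finally show "1 / real m ^ 5 \<le> \<dots>" .
qed auto

text \<open>The squared error of the mean is the squared norm of the sum divided by m ^ 2. Since (1
  + 1 / m) ^ m \<le> exp 1 \<le> 3, it is at most 3 / m times \<open>spread C\<close>, the radius
  within which \<open>target\<close> promises coverage.\<close>

lemma track_event_round:
  assumes "i < k"
  shows "track_event r i m \<subseteq> track_event r (Suc i) 0"
proof
  fix \<omega> assume \<omega>: "\<omega> \<in> track_event r i m"
  define u where "u = r * (k * m)"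
  define C where "C = rounds \<omega> u i"
  define f where "f = (\<lambda>s. pick C (\<omega> (u + i * m + s)))"
  have m0: "m > 0" using m by simp
  have fl: "\<omega> \<in> space random_tape" "failed \<omega> r" and cov: "covers C"
    and D: "nsq d (dev C f m) \<le> (1 + 1 / m) ^ m * m * spread C"
    using \<omega> by (auto simp: track_event_def on_track_def Let_def u_def C_def f_def)
  have tg: "target C (aim C) (spread C)" using target[OF cov] assms by (simp add: C_def)
  have "dsq d (mean C f) (aim C) = nsq d (dev C f m) / (real m)\<^sup>2"
  proof -
    have "mean C f l - aim C l = dev C f m l / m" if "l < d" for l
      using that m0 by (simp add: mean_def dev_def sum_subtractf diff_divide_distrib sum_divide_distrib)
    then show ?thesis by (simp add: dsq_def nsq_def power_divide sum_divide_distrib)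
  qed
  also have "\<dots> \<le> (3 * m * spread C) / (real m)\<^sup>2"
  proof (rule divide_right_mono)
    have "(1 + 1 / real m) ^ m \<le> exp (1 / real m) ^ m"
      by (intro power_mono exp_ge_add_one_self) auto
    also have "\<dots> = exp 1" using m0 by (simp add: exp_of_nat_mult[symmetric])
    also have "\<dots> \<le> 3" by (rule exp_le)
    finally have "(1 + 1 / real m) ^ m * (m * spread C) \<le> 3 * (m * spread C)"
      using tg by (intro mult_right_mono) (auto simp: target_def)
    then show "nsq d (dev C f m) \<le> 3 * m * spread C" using D by (simp add: mult.assoc)
  qed simp
  also have "\<dots> = 3 * spread C / m" using m0 by (simp add: power2_eq_square)
  finally have "covers (C @ [mean C f])" using tg by (simp add: target_def)
  moreover have "rounds \<omega> u (Suc i) = C @ [mean C f]" by (simp add: C_def f_def)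
  ultimately have "on_track \<omega> u (Suc i) 0"
    by (simp only: on_track_def Let_def) (simp add: dev_def nsq_def)
  then show "\<omega> \<in> track_event r (Suc i) 0" using fl by (simp add: track_event_def u_def)
qed

lemma track_event_prob:
  assumes "i < k" "t \<le> m"
  shows "(1 / real m ^ 5) ^ t * measure random_tape (track_event r i 0) \<le>
    measure random_tape (track_event r i t)"
  using assms(2)
proof (induction t)
  case (Suc t)
  have "(1 / real m ^ 5) ^ Suc t * measure random_tape (track_event r i 0) \<le>
      1 / real m ^ 5 * measure random_tape (track_event r i t)"
    using mult_left_mono[OF Suc.IH, of "1 / real m ^ 5"] Suc.prems by (simp add: mult_ac)
  then show ?case using track_event_Suc[OF assms(1), of t r] Suc.prems by linarith
qed simp

lemma rounds_prob:
  assumes "i \<le> k"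
  shows "(1 / real m ^ 5) ^ (i * m) * measure random_tape (fail_event r) \<le>
    measure random_tape (track_event r i 0)"
  using assms
proof (induction i)
  case 0
  have "track_event r 0 0 = fail_event r"
    by (simp add: track_event_def fail_event_def on_track_def dev_def nsq_def)
  then show ?case by simp
next
  case (Suc i)
  let ?q = "1 / real m ^ 5"
  have "?q ^ (Suc i * m) * measure random_tape (fail_event r) =
      ?q ^ m * (?q ^ (i * m) * measure random_tape (fail_event r))"
    by (simp only: mult_Suc power_add mult.assoc)
  also have "\<dots> \<le> ?q ^ m * measure random_tape (track_event r i 0)"
    using Suc by (intro mult_left_mono) auto
  also have "\<dots> \<le> measure random_tape (track_event r i m)"
    using Suc.prems by (intro track_event_prob) auto
  also have "\<dots> \<le> measure random_tape (track_event r (Suc i) 0)"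
    using Suc.prems by (intro tape_prob.finite_measure_mono track_event_round) auto
  finally show ?case .
qed

text \<open>\<open>track_event r k 0\<close> says that attempt \<open>r\<close> covers after
  \<open>r\<close> failures. It takes away from \<open>fail_event r\<close> at least the fraction (1
  / m ^ 5) ^ (k m).\<close>

lemma fail_event_prob:
  "measure random_tape (fail_event r) \<le> (1 - (1 / real m ^ 5) ^ (k * m)) ^ r"
proof (induction r)
  case 0
  then show ?case by simp
next
  case (Suc r)
  let ?p = "(1 / real m ^ 5) ^ (k * m)"
  have p: "?p \<le> 1" using m by (intro power_le_one) auto
  have sub: "track_event r k 0 \<subseteq> fail_event r - fail_event (Suc r)"
    by (auto simp: track_event_def fail_event_def failed_def on_track_def Let_def run_def)
  have sub2: "fail_event (Suc r) \<subseteq> fail_event r" by (auto simp: fail_event_def failed_def)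
  have "?p * measure random_tape (fail_event r) \<le> measure random_tape (track_event r k 0)"
    by (rule rounds_prob) simp
  also have "\<dots> \<le> measure random_tape (fail_event r - fail_event (Suc r))"
    by (intro tape_prob.finite_measure_mono sub) auto
  also have "\<dots> = measure random_tape (fail_event r) - measure random_tape (fail_event (Suc r))"
    by (intro tape_prob.finite_measure_Diff sub2) auto
  finally have "measure random_tape (fail_event (Suc r)) \<le> (1 - ?p) * measure random_tape (fail_event r)"
    by (simp add: algebra_simps)
  also have "\<dots> \<le> (1 - ?p) * (1 - ?p) ^ r" using Suc p by (intro mult_left_mono) auto
  finally show ?case by simp
qed

end

section \<open>Total correctness with running times\<close>

fun imods :: "prog \<Rightarrow> nat set" where
  "imods (SetI r a) = {r}"
| "imods (Seq a b) = imods a \<union> imods b"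
| "imods (Cond t a b) = imods a \<union> imods b"
| "imods (While t a) = imods a"
| "imods _ = {}"

fun rmods :: "prog \<Rightarrow> nat set" where
  "rmods (SetR r a) = {r}"
| "rmods (Rand r) = {r}"
| "rmods (Seq a b) = rmods a \<union> rmods b"
| "rmods (Cond t a b) = rmods a \<union> rmods b"
| "rmods (While t a) = rmods a"
| "rmods _ = {}"

fun stores :: "prog \<Rightarrow> bool" where
  "stores (Store a b) = True"
| "stores (Seq a b) = (stores a \<or> stores b)"
| "stores (Cond t a b) = (stores a \<or> stores b)"
| "stores (While t a) = stores a"
| "stores _ = False"

fun draws :: "prog \<Rightarrow> bool" where
  "draws (Rand r) = True"
| "draws (Seq a b) = (draws a \<or> draws b)"
| "draws (Cond t a b) = (draws a \<or> draws b)"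
| "draws (While t a) = draws a"
| "draws _ = False"

text \<open>A frame condition read off the syntax. The rules \<open>wp_mono\<close> and
  \<open>wp_For\<close> supply it, which spares the invariants from listing the registers that stay
  fixed.\<close>

definition keeps :: "prog \<Rightarrow> state \<Rightarrow> state \<Rightarrow> bool" where
  "keeps c s s' \<longleftrightarrow>
     (\<forall>r. r \<notin> imods c \<longrightarrow> ireg s' r = ireg s r) \<and>
     (\<forall>r. r \<notin> rmods c \<longrightarrow> rreg s' r = rreg s r) \<and>
     (\<not> stores c \<longrightarrow> mem s' = mem s) \<and> (\<not> draws c \<longrightarrow> used s' = used s)"

lemma exec_keeps: "exec \<omega> c s t s' \<Longrightarrow> keeps c s s'"
  by (induction rule: exec.induct) (auto simp: keeps_def)

lemma keeps_refl [simp]: "keeps c s s"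
  by (simp add: keeps_def)

definition wp :: "(nat \<Rightarrow> real) \<Rightarrow> prog \<Rightarrow> nat \<Rightarrow> (state \<Rightarrow> bool) \<Rightarrow> state \<Rightarrow> bool" where
  "wp \<omega> c T Q s \<longleftrightarrow> (\<exists>t s'. exec \<omega> c s t s' \<and> t \<le> T \<and> Q s')"

lemma wp_mono:
  assumes "wp \<omega> c T Q s" "T \<le> T'" "\<And>s'. keeps c s s' \<Longrightarrow> Q s' \<Longrightarrow> Q' s'"
  shows "wp \<omega> c T' Q' s"
  using assms exec_keeps unfolding wp_def by (meson order_trans)

lemma wp_Skip: "Q s \<Longrightarrow> wp \<omega> Skip 1 Q s"
  unfolding wp_def using exec.Skip by blast

lemma wp_SetI: "Q (s\<lparr>ireg := (ireg s)(r := ival s a)\<rparr>) \<Longrightarrow> wp \<omega> (SetI r a) 1 Q s"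
  unfolding wp_def using exec.SetI by blast

lemma wp_SetR: "Q (s\<lparr>rreg := (rreg s)(r := rval s a)\<rparr>) \<Longrightarrow> wp \<omega> (SetR r a) 1 Q s"
  unfolding wp_def using exec.SetR by blast

lemma wp_Store: "Q (s\<lparr>mem := (mem s)(ival s a := rval s b)\<rparr>) \<Longrightarrow> wp \<omega> (Store a b) 1 Q s"
  unfolding wp_def using exec.Store by blast

lemma wp_Rand:
  "Q (s\<lparr>rreg := (rreg s)(r := \<omega> (used s)), used := Suc (used s)\<rparr>) \<Longrightarrow> wp \<omega> (Rand r) 1 Q s"
  unfolding wp_def using exec.Rand by blast

lemma wp_Seq: "wp \<omega> a T1 (wp \<omega> b T2 Q) s \<Longrightarrow> wp \<omega> (Seq a b) (T1 + T2) Q s"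
  unfolding wp_def using exec.Seq by (meson add_mono)

lemma wp_Cond:
  assumes "tval s b \<Longrightarrow> wp \<omega> c1 T Q s" "\<not> tval s b \<Longrightarrow> wp \<omega> c2 T Q s"
  shows "wp \<omega> (Cond b c1 c2) (1 + T) Q s"
  using assms exec.CondT[of s b \<omega> c1 _ _ c2] exec.CondF[of s b \<omega> c2 _ _ c1] unfolding wp_def
  by (metis add_left_mono)

text \<open>The measure \<open>f\<close> bounds the number of iterations; each costs the body plus a
  test, and the last 1 is the failing test.\<close>

lemma wp_While:
  assumes Inv: "Inv s"
    and step: "\<And>s'. Inv s' \<Longrightarrow> tval s' b \<Longrightarrow> wp \<omega> c T (\<lambda>s''. Inv s'' \<and> (f s'' :: nat) < f s') s'"
    and exit: "\<And>s'. Inv s' \<Longrightarrow> \<not> tval s' b \<Longrightarrow> Q s'"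
  shows "wp \<omega> (While b c) (f s * (T + 1) + 1) Q s"
  using Inv
proof (induction "f s" arbitrary: s rule: less_induct)
  case less
  show ?case
  proof (cases "tval s b")
    case False
    then show ?thesis using exit[OF less.prems] exec.WhileF[of s b \<omega> c] by (auto simp: wp_def)
  next
    case True
    obtain t1 s1 where 1: "exec \<omega> c s t1 s1" "t1 \<le> T" "Inv s1" "f s1 < f s"
      using step[OF less.prems True] by (auto simp: wp_def)
    obtain t2 s2 where 2: "exec \<omega> (While b c) s1 t2 s2" "t2 \<le> f s1 * (T + 1) + 1" "Q s2"
      using less.hyps[OF 1(4,3)] by (auto simp: wp_def)
    have "1 + t1 + t2 \<le> Suc (f s1) * (T + 1) + 1" using 1 2 by simp
    also have "\<dots> \<le> f s * (T + 1) + 1" using 1(4) by (intro add_mono mult_right_mono) auto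
    finally show ?thesis using exec.WhileT[OF True 1(1) 2(1)] 2(3) unfolding wp_def by blast
  qed
qed

definition For :: "nat \<Rightarrow> iexp \<Rightarrow> prog \<Rightarrow> prog" where
  "For r e c = Seq (SetI r (IConst 0))
     (While (ILess (IReg r) e) (Seq c (SetI r (IAdd (IReg r) (IConst 1)))))"

lemma For_mods [simp]:
  "imods (For r e c) = insert r (imods c)" "rmods (For r e c) = rmods c"
  "stores (For r e c) = stores c" "draws (For r e c) = draws c"
  by (auto simp: For_def)

text \<open>The invariant sees memory, real registers and tape position; index registers other than
  the counter are left to the frame. An iteration pays for test, body and increment; the final 2 is
  initialization and the failing test.\<close>

lemma wp_For:
  assumes r: "r \<notin> imods c"
    and bound: "\<And>s'. keeps (For r e c) s s' \<Longrightarrow> ival s' e = N"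
    and init: "Inv 0 (mem s) (rreg s) (used s)"
    and step: "\<And>i s'. i < N \<Longrightarrow> keeps (For r e c) s s' \<Longrightarrow> ireg s' r = i \<Longrightarrow>
      Inv i (mem s') (rreg s') (used s') \<Longrightarrow>
      wp \<omega> c T (\<lambda>s''. Inv (Suc i) (mem s'') (rreg s'') (used s'')) s'"
    and post: "\<And>s'. keeps (For r e c) s s' \<Longrightarrow> Inv N (mem s') (rreg s') (used s') \<Longrightarrow> Q s'"
  shows "wp \<omega> (For r e c) (N * (T + 2) + 2) Q s"
proof -
  let ?I = "\<lambda>s'. keeps (For r e c) s s' \<and> ireg s' r \<le> N \<and> Inv (ireg s' r) (mem s') (rreg s') (used s')"
  let ?s = "s\<lparr>ireg := (ireg s)(r := 0)\<rparr>"
  have "wp \<omega> (While (ILess (IReg r) e) (Seq c (SetI r (IAdd (IReg r) (IConst 1)))))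
    ((N - ireg ?s r) * ((T + 1) + 1) + 1) Q ?s"
  proof (rule wp_While[where Inv = ?I and f = "\<lambda>s'. N - ireg s' r"])
    show "?I ?s" using init by (simp add: keeps_def)
  next
    fix s' assume I: "?I s'" and t: "tval s' (ILess (IReg r) e)"
    have i: "ireg s' r < N" using t bound I by auto
    show "wp \<omega> (Seq c (SetI r (IAdd (IReg r) (IConst 1)))) (T + 1)
      (\<lambda>s''. ?I s'' \<and> N - ireg s'' r < N - ireg s' r) s'"
    proof (intro wp_Seq wp_mono[OF step[OF i]])
      fix s'' assume s'': "keeps c s' s''" "Inv (Suc (ireg s' r)) (mem s'') (rreg s'') (used s'')"
      then have "ireg s'' r = ireg s' r" using r by (simp add: keeps_def)
      then show "wp \<omega> (SetI r (IAdd (IReg r) (IConst 1))) 1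
          (\<lambda>s''. ?I s'' \<and> N - ireg s'' r < N - ireg s' r) s''"
        using I s'' i by (intro wp_SetI) (auto simp: keeps_def)
    qed (use I in auto)
  next
    fix s' assume I: "?I s'" and "\<not> tval s' (ILess (IReg r) e)"
    then have "ireg s' r = N" using bound by auto
    then show "Q s'" using I post[of s'] by auto
  qed
  then have "wp \<omega> (For r e c) (1 + (N * ((T + 1) + 1) + 1)) Q s"
    unfolding For_def by (intro wp_Seq wp_SetI) simp
  then show ?thesis by (rule wp_mono) auto
qed

section \<open>The program\<close>

text \<open>Coordinates from \<open>d\<close> on are cleared, so that a block equals the stored
  point as a function.\<close>

definition block :: "nat \<Rightarrow> (nat \<Rightarrow> real) \<Rightarrow> nat \<Rightarrow> point" where
  "block d M a = (\<lambda>l. if l < d then M (a * d + l) else 0)"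

lemma block_less: "a < b \<Longrightarrow> l < d \<Longrightarrow> a * d + l < b * (d::nat)"
  using mult_le_mono1[of "Suc a" b d] by simp

lemma block_eq: "l < d \<Longrightarrow> l' < d \<Longrightarrow> a * d + l = b * d + l' \<longleftrightarrow> a = b \<and> l = (l'::nat)"
  using block_less[of a b l d] block_less[of b a l' d] by (cases a b rule: linorder_cases) auto

lemma block_Store: "l < d \<Longrightarrow>
    block d (M(a * d + l := v)) b = (if b = a then (block d M a)(l := v) else block d M b)"
  by (auto simp: block_def fun_eq_iff block_eq)

lemma block_Store_weight: "b < B \<Longrightarrow> block d (M(B * d + p := v)) b = block d M b"
  using block_less[of b B _ d] by (force simp: block_def fun_eq_iff)

abbreviation addr :: "iexp \<Rightarrow> iexp \<Rightarrow> iexp" where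
  "addr a l \<equiv> IAdd (IMul a (IReg 1)) l"

abbreviation weight_addr :: "iexp \<Rightarrow> iexp" where
  "weight_addr p \<equiv> addr (IAdd (IReg 0) (IAdd (IReg 2) (IReg 2))) p"

abbreviation new_center :: iexp where
  "new_center \<equiv> IAdd (IReg 0) (IReg 6)"

text \<open>
  Index registers: 3 holds \<open>m\<close>, 4 the number of attempts, 5, 6, 7 count attempts, rounds and draws;
  8 is the drawn candidate or a loop counter, 9 a coordinate.  Real registers: 2 is the threshold
  \<open>u * total C\<close>, 3 a running sum, 4 the current cost, 5 the least cost so far.  Memory consists of
  blocks of \<open>d\<close> cells: points in blocks \<open>0 ..< n\<close>, current centers in \<open>n ..< n + k\<close>, the best centers
  in \<open>n + k ..< n + 2 k\<close>; after them come the weights of the candidates.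
\<close>

definition walk_prog :: prog where
  "walk_prog = While (TAnd (ILess (IAdd (IReg 8) (IConst 1)) new_center) (TNot (RLess (RReg 2) (RReg 3))))
     (Seq (SetI 8 (IAdd (IReg 8) (IConst 1))) (SetR 3 (RAdd (RReg 3) (RMem (weight_addr (IReg 8))))))"

definition add_prog :: prog where
  "add_prog = For 9 (IReg 1) (Store (addr new_center (IReg 9))
     (RAdd (RMem (addr new_center (IReg 9))) (RDiv (RMem (addr (IReg 8) (IReg 9))) (ROfNat (IReg 3)))))"

definition sample_prog :: prog where
  "sample_prog =
     Seq (Rand 2)
    (Seq (SetR 2 (RMul (RReg 2) (RMul (RReg 4) (ROfNat (IAdd (IConst 1) (IReg 6))))))
    (Seq (SetI 8 (IConst 0))
    (Seq (SetR 3 (RMem (weight_addr (IConst 0))))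
    (Seq walk_prog add_prog))))"

definition dist_prog :: prog where
  "dist_prog = For 9 (IReg 1) (SetR 6 (RAdd (RReg 6) (RMul
     (RSub (RMem (addr (IReg 8) (IReg 9))) (RMem (addr new_center (IReg 9))))
     (RSub (RMem (addr (IReg 8) (IReg 9))) (RMem (addr new_center (IReg 9)))))))"

text \<open>Tests have no disjunction; the condition means that this is round 0 or that the new
  distance is smaller. In round 0 the initial weight 1 must be overwritten even by a larger
  distance. \<open>rep_prog\<close> accepts the first attempt in the same way.\<close>

definition update_point_prog :: prog where
  "update_point_prog =
     Seq (SetR 6 (ROfNat (IConst 0)))
    (Seq dist_prog
    (Seq (Cond (TNot (TAnd (TNot (ILess (IReg 6) (IConst 1)))
                           (TNot (RLess (RReg 6) (RMem (weight_addr (IReg 8)))))))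
            (Store (weight_addr (IReg 8)) (RReg 6)) Skip)
         (SetR 3 (RAdd (RReg 3) (RMem (weight_addr (IReg 8)))))))"

definition update_prog :: prog where
  "update_prog = Seq (SetR 3 (ROfNat (IConst 0)))
    (Seq (For 8 (IReg 0) update_point_prog) (SetR 4 (RReg 3)))"

definition round_prog :: prog where
  "round_prog =
     Seq (For 8 (IReg 6) (Store (weight_addr (IAdd (IReg 0) (IReg 8))) (RReg 4)))
    (Seq (For 9 (IReg 1) (Store (addr new_center (IReg 9)) (ROfNat (IConst 0))))
    (Seq (For 7 (IReg 3) sample_prog) update_prog))"

definition copy_prog :: prog where
  "copy_prog = For 8 (IReg 2) (For 9 (IReg 1)
     (Store (addr (IAdd (IReg 0) (IAdd (IReg 2) (IReg 8))) (IReg 9))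
            (RMem (addr (IAdd (IReg 0) (IReg 8)) (IReg 9)))))"

definition rep_prog :: prog where
  "rep_prog =
     Seq (For 8 (IReg 0) (Store (weight_addr (IReg 8)) (ROfNat (IConst 1))))
    (Seq (SetR 4 (ROfNat (IReg 0)))
    (Seq (For 6 (IReg 2) round_prog)
         (Cond (TNot (TAnd (TNot (ILess (IReg 5) (IConst 1))) (TNot (RLess (RReg 4) (RReg 5)))))
           (Seq (SetR 5 (RReg 4)) copy_prog) Skip)))"

definition pow5 :: "iexp \<Rightarrow> iexp" where
  "pow5 e = IMul e (IMul e (IMul e (IMul e e)))"

text \<open>Reals cannot be rounded to naturals, so \<open>m\<close> is found by counting up to the
  least value with m * gap \<ge> 96, and the number L * m ^ (5 k m) of attempts by repeated
  multiplication.\<close>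

definition init_prog :: "nat \<Rightarrow> prog" where
  "init_prog L =
     Seq (SetR 1 (RDiv (RReg 0) (RMul (RAdd (ROfNat (IConst 1)) (RDiv (RReg 0) (ROfNat (IConst 2)))) (ROfNat (IReg 2)))))
    (Seq (While (RLess (RMul (ROfNat (IReg 3)) (RReg 1)) (ROfNat (IConst 96))) (SetI 3 (IAdd (IReg 3) (IConst 1))))
    (Seq (SetI 4 (IConst L))
         (For 10 (IMul (IReg 2) (IReg 3)) (SetI 4 (IMul (IReg 4) (pow5 (IReg 3)))))))"

text \<open>For n \<le> k the points themselves are a solution of cost 0: register 0 already holds
  \<open>n\<close>, and address 0 makes the input the output.\<close>

definition kmeans_prog :: "nat \<Rightarrow> prog" where
  "kmeans_prog L = Cond (ILess (IReg 2) (IReg 0))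
    (Seq (init_prog L) (Seq (For 5 (IReg 4) rep_prog)
      (Seq (SetI 1 (IMul (IAdd (IReg 0) (IReg 2)) (IReg 1))) (SetI 0 (IReg 2)))))
    (SetI 1 (IConst 0))"

section \<open>Memory layout and correctness of the program\<close>

context sampling begin

text \<open>A frame for memory in units of the layout: \<open>A\<close> are the blocks and
  \<open>W\<close> the weight cells that may differ.\<close>

definition same_but :: "nat set \<Rightarrow> nat set \<Rightarrow> (nat \<Rightarrow> real) \<Rightarrow> (nat \<Rightarrow> real) \<Rightarrow> bool" where
  "same_but A W M M' \<longleftrightarrow> (\<forall>a<n + (k + k). a \<notin> A \<longrightarrow> block d M' a = block d M a) \<and>
     (\<forall>p. p \<notin> W \<longrightarrow> M' ((n + (k + k)) * d + p) = M ((n + (k + k)) * d + p))"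

lemma same_but_refl [simp]: "same_but A W M M"
  by (simp add: same_but_def)

lemma same_but_blockD: "same_but A W M M' \<Longrightarrow> a < n + (k + k) \<Longrightarrow> a \<notin> A \<Longrightarrow> block d M' a = block d M a"
  by (simp add: same_but_def)

lemma same_but_weightD: "same_but A W M M' \<Longrightarrow> p \<notin> W \<Longrightarrow>
    M' ((n + (k + k)) * d + p) = M ((n + (k + k)) * d + p)"
  by (simp add: same_but_def)

lemma same_but_trans:
  "same_but A W M M' \<Longrightarrow> same_but A' W' M' M'' \<Longrightarrow> A \<union> A' \<subseteq> B \<Longrightarrow> W \<union> W' \<subseteq> X \<Longrightarrow> same_but B X M M''"
  unfolding same_but_def by (metis Un_iff subset_eq)

lemma same_but_Store:
  assumes "same_but A W M M'" "a \<in> A" "a < n + (k + k)" "l < d"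
  shows "same_but A W M (M'(a * d + l := v))"
proof -
  have "(n + (k + k)) * d + p \<noteq> a * d + l" for p
    using block_less[OF assms(3,4)] by simp
  then show ?thesis using assms by (auto simp: same_but_def block_Store)
qed

lemma same_but_Store_weight:
  assumes "same_but A W M M'" "p \<in> W"
  shows "same_but A W M (M'((n + (k + k)) * d + p := v))"
  using assms by (auto simp: same_but_def block_Store_weight)

definition layout :: "(nat \<Rightarrow> real) \<Rightarrow> point list \<Rightarrow> bool" where
  "layout M C \<longleftrightarrow> (\<forall>p<n. block d M p = x p) \<and> (\<forall>c<length C. block d M (n + c) = C ! c)"

definition weights :: "(nat \<Rightarrow> real) \<Rightarrow> point list \<Rightarrow> bool" where
  "weights M C \<longleftrightarrow> (\<forall>p<n. M ((n + (k + k)) * d + p) = wt C p)"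

definition regs :: "state \<Rightarrow> bool" where
  "regs s \<longleftrightarrow> ireg s 0 = n \<and> ireg s 1 = d \<and> ireg s 2 = k \<and> ireg s 3 = m"

lemma layout_same: "layout M C \<Longrightarrow> same_but A W M M' \<Longrightarrow> length C \<le> k \<Longrightarrow>
    A \<inter> {..<n + length C} = {} \<Longrightarrow> layout M' C"
proof -
  assume L: "layout M C" "same_but A W M M'" "length C \<le> k" "A \<inter> {..<n + length C} = {}"
  then have "block d M' a = block d M a" if "a < n + length C" for a
    using that by (intro same_but_blockD) auto
  with L(1) show ?thesis by (simp add: layout_def)
qed

lemma weights_same: "weights M C \<Longrightarrow> same_but A W M M' \<Longrightarrow> W \<inter> {..<n} = {} \<Longrightarrow> weights M' C"
  unfolding weights_def same_but_def by (metis disjoint_iff lessThan_iff)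

lemma layout_cand: "layout M C \<Longrightarrow> j < n + length C \<Longrightarrow> block d M j = cand C j"
  unfolding layout_def cand_def by (metis add_diff_inverse_nat nat_add_left_cancel_less)

text \<open>By the invariant every smaller index satisfies the loop condition, so the exit index is
  the least one in \<open>pick\<close>.\<close>

lemma wp_walk:
  assumes "regs s" "ireg s 6 = length C" "1 \<le> n"
    and w: "\<And>j. j < n + length C \<Longrightarrow> mem s ((n + (k + k)) * d + j) = cwt C j"
    and s: "ireg s 8 = 0" "rreg s 3 = cwt C 0" "rreg s 2 = u * total C"
  shows "wp \<omega> walk_prog (3 * (n + length C) + 1) (\<lambda>s'. ireg s' 8 = pick C u) s"
proof -
  let ?I = "\<lambda>s'. keeps walk_prog s s' \<and> ireg s' 8 < n + length C \<and>
    rreg s' 3 = (\<Sum>i\<le>ireg s' 8. cwt C i) \<and>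
    (\<forall>j<ireg s' 8. Suc j < n + length C \<and> (\<Sum>i\<le>j. cwt C i) \<le> u * total C)"
  let ?f = "\<lambda>s'. n + length C - ireg s' 8"
  have mods: "imods walk_prog = {8}" "rmods walk_prog = {3}" "\<not> stores walk_prog" "\<not> draws walk_prog"
    by (auto simp: walk_prog_def)
  have "wp \<omega> walk_prog (?f s * ((1 + 1) + 1) + 1) (\<lambda>s'. ireg s' 8 = pick C u) s"
    unfolding walk_prog_def
  proof (rule wp_While[where Inv = ?I])
    show "?I s" using assms by simp
  next
    fix s' assume I: "?I s'"
      and t: "tval s' (TAnd (ILess (IAdd (IReg 8) (IConst 1)) new_center) (TNot (RLess (RReg 2) (RReg 3))))"
    have r: "ireg s' 0 = n" "ireg s' (Suc 0) = d" "ireg s' 2 = k" "ireg s' 6 = length C"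
      "rreg s' 2 = u * total C" "mem s' = mem s"
      using I assms by (auto simp: keeps_def mods regs_def)
    show "wp \<omega> (Seq (SetI 8 (IAdd (IReg 8) (IConst 1)))
        (SetR 3 (RAdd (RReg 3) (RMem (weight_addr (IReg 8)))))) (1 + 1)
        (\<lambda>s''. ?I s'' \<and> ?f s'' < ?f s') s'"
      using I t r w[of "Suc (ireg s' 8)"]
      by (intro wp_Seq wp_SetI wp_SetR) (auto simp: keeps_def mods less_Suc_eq)
  next
    fix s' assume I: "?I s'"
      and t: "\<not> tval s' (TAnd (ILess (IAdd (IReg 8) (IConst 1)) new_center) (TNot (RLess (RReg 2) (RReg 3))))"
    have r: "ireg s' 0 = n" "ireg s' 6 = length C" "rreg s' 2 = u * total C"
      using I assms by (auto simp: keeps_def mods regs_def)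
    show "ireg s' 8 = pick C u"
      unfolding pick_def
    proof (rule Least_equality[symmetric])
      show "\<not> (Suc (ireg s' 8) < n + length C \<and> (\<Sum>i\<le>ireg s' 8. cwt C i) \<le> u * total C)"
        using I t r by auto
    qed (use I not_le in blast)
  qed
  then show ?thesis by (rule wp_mono) auto
qed

lemma wp_add:
  assumes "regs s" "ireg s 6 = i" "i < k" "ireg s 8 = j" "j < n + i"
  shows "wp \<omega> add_prog (3 * d + 2) (\<lambda>s'. same_but {n + i} {} (mem s) (mem s') \<and>
    block d (mem s') (n + i) = (\<lambda>l. if l < d then block d (mem s) (n + i) l + block d (mem s) j l / m else 0)) s"
proof -
  let ?Inv = "\<lambda>t M R u. same_but {n + i} {} (mem s) M \<and>
    block d M (n + i) = (\<lambda>l. if l < d then block d (mem s) (n + i) l +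
      (if l < t then block d (mem s) j l / m else 0) else 0)"
  have "wp \<omega> add_prog (d * (1 + 2) + 2) (\<lambda>s'. ?Inv d (mem s') (rreg s') (used s')) s"
    unfolding add_prog_def
  proof (rule wp_For[where Inv = ?Inv])
    show "?Inv 0 (mem s) (rreg s) (used s)" by (auto simp: block_def)
  next
    fix t s'
    assume t: "t < d" and kp: "keeps (For 9 (IReg 1) (Store (addr new_center (IReg 9))
       (RAdd (RMem (addr new_center (IReg 9))) (RDiv (RMem (addr (IReg 8) (IReg 9))) (ROfNat (IReg 3)))))) s s'"
      and "ireg s' 9 = t" and Inv: "?Inv t (mem s') (rreg s') (used s')"
    then have r: "ireg s' 0 = n" "ireg s' (Suc 0) = d" "ireg s' 2 = k" "ireg s' 3 = m" "ireg s' 6 = i"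
        "ireg s' 8 = j" "ireg s' 9 = t"
      using assms by (auto simp: keeps_def regs_def)
    have v1: "mem s' ((n + i) * d + t) = block d (mem s') (n + i) t"
      and v2: "mem s' (j * d + t) = block d (mem s') j t" using t by (auto simp: block_def)
    \<comment> \<open>The summand comes from block \<open>j < n + i\<close>, which the writes to
      block \<open>n + i\<close> leave alone.\<close>
    have v3: "block d (mem s') j = block d (mem s) j"
      by (rule same_but_blockD) (use Inv assms in auto)
    let ?M = "(mem s')((n + i) * d + t := block d (mem s') (n + i) t + block d (mem s) j t / m)"
    have sb: "same_but {n + i} {} (mem s) ?M"
      by (rule same_but_Store) (use Inv assms t in auto)
    have vv: "block d ?M (n + i) = (\<lambda>l. if l < d then block d (mem s) (n + i) l +
      (if l < Suc t then block d (mem s) j l / m else 0) else 0)"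
      using Inv t by (auto simp: block_Store fun_eq_iff less_Suc_eq)
    show "wp \<omega> (Store (addr new_center (IReg 9)) (RAdd (RMem (addr new_center (IReg 9)))
        (RDiv (RMem (addr (IReg 8) (IReg 9))) (ROfNat (IReg 3))))) 1
        (\<lambda>s''. ?Inv (Suc t) (mem s'') (rreg s'') (used s'')) s'"
      by (rule wp_Store) (use sb vv in \<open>simp add: r v1 v2 v3\<close>)
  qed (use assms in \<open>auto simp: keeps_def regs_def\<close>)
  then show ?thesis by (rule wp_mono) (auto simp: fun_eq_iff)
qed

end

lemma prog_mods [simp]:
  "imods walk_prog = {8}" "rmods walk_prog = {3}" "\<not> stores walk_prog" "\<not> draws walk_prog"
  "imods add_prog = {9}" "rmods add_prog = {}" "\<not> draws add_prog"
  "imods sample_prog = {8, 9}" "rmods sample_prog = {2, 3}"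
  "imods dist_prog = {9}" "rmods dist_prog = {6}" "\<not> stores dist_prog" "\<not> draws dist_prog"
  "imods update_point_prog = {9}" "rmods update_point_prog = {3, 6}" "\<not> draws update_point_prog"
  "imods update_prog = {8, 9}" "rmods update_prog = {3, 4, 6}" "\<not> draws update_prog"
  "imods round_prog = {7, 8, 9}" "rmods round_prog = {2, 3, 4, 6}"
  "imods copy_prog = {8, 9}" "rmods copy_prog = {}" "\<not> draws copy_prog"
  "imods rep_prog = {6, 7, 8, 9}" "rmods rep_prog = {2, 3, 4, 5, 6}"
  by (auto simp: walk_prog_def add_prog_def sample_prog_def dist_prog_def update_point_prog_def
      update_prog_def round_prog_def copy_prog_def rep_prog_def)

context sampling begin

lemma same_but_mono: "same_but A W M M' \<Longrightarrow> A \<subseteq> B \<Longrightarrow> W \<subseteq> X \<Longrightarrow> same_but B X M M'"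
  by (auto simp: same_but_def)

lemma wp_sample:
  assumes rg: "regs s" "ireg s 6 = length C" "1 \<le> n" "length C < k"
    and lay: "layout (mem s) C"
    and w: "\<And>j. j < n + length C \<Longrightarrow> mem s ((n + (k + k)) * d + j) = cwt C j"
    and R4: "rreg s 4 = mass C"
    and j_def: "j = pick C (\<omega> (used s))"
  shows "wp \<omega> sample_prog (3 * (n + k) + 3 * d + 7) (\<lambda>s'. used s' = Suc (used s) \<and>
    same_but {n + length C} {} (mem s) (mem s') \<and>
    block d (mem s') (n + length C) =
      (\<lambda>l. if l < d then block d (mem s) (n + length C) l + cand C j l / m else 0)) s"
    (is "wp \<omega> _ _ ?Q s")
proof -
  have j: "j < n + length C" unfolding j_def using rg by (intro pick_less)
  have bj: "block d (mem s) j = cand C j" using layout_cand[OF lay j] .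
  have r: "ireg s 0 = n" "ireg s (Suc 0) = d" "ireg s 2 = k" "ireg s 3 = m"
    using rg by (auto simp: regs_def)
  have w0: "mem s ((n + (k + k)) * d) = cwt C 0" using w[of 0] rg by simp
  have "wp \<omega> sample_prog (1 + (1 + (1 + (1 + ((3 * (n + length C) + 1) + (3 * d + 2)))))) ?Q s"
    unfolding sample_prog_def
  proof (intro wp_Seq wp_Rand wp_SetR wp_SetI, rule wp_mono[OF wp_walk[where C = C and u = "\<omega> (used s)"]], goal_cases)
    case (9 s')
    have e: "ireg s' 0 = n" "ireg s' (Suc 0) = d" "ireg s' 2 = k" "ireg s' 3 = m" "ireg s' 6 = length C"
      "mem s' = mem s" "used s' = Suc (used s)" "ireg s' 8 = j"
      using 9 r rg by (auto simp: keeps_def j_def)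
    show ?case
    proof (rule wp_mono[OF wp_add[where i = "length C" and j = j]], goal_cases)
      case (7 s'')
      have "used s'' = used s'" using 7(1) by (simp add: keeps_def)
      then show ?case using 7(2) unfolding e bj by simp
    qed (use e rg j in \<open>auto simp: regs_def\<close>)
  qed (use r rg w w0 R4 in \<open>auto simp: regs_def total_def\<close>)
  then show ?thesis by (rule wp_mono) (use rg in auto)
qed

lemma wp_dist:
  assumes "regs s" "ireg s 6 = i" "i < k" "ireg s 8 = p" "p < n" "rreg s 6 = 0"
  shows "wp \<omega> dist_prog (3 * d + 2)
    (\<lambda>s'. rreg s' 6 = dsq d (block d (mem s) p) (block d (mem s) (n + i))) s"
proof -
  let ?Inv = "\<lambda>t (M :: nat \<Rightarrow> real) R (u :: nat).
    R 6 = (\<Sum>l<t. (block d (mem s) p l - block d (mem s) (n + i) l)\<^sup>2)"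
  have "wp \<omega> dist_prog (d * (1 + 2) + 2) (\<lambda>s'. ?Inv d (mem s') (rreg s') (used s')) s"
    unfolding dist_prog_def
  proof (rule wp_For[where Inv = ?Inv], goal_cases)
    case (4 t s')
    then have r: "ireg s' 0 = n" "ireg s' (Suc 0) = d" "ireg s' 6 = i" "ireg s' 8 = p" "ireg s' 9 = t"
      "mem s' = mem s"
      using assms by (auto simp: keeps_def regs_def)
    have v: "mem s ((n + i) * d + t) = block d (mem s) (n + i) t"
      "mem s (p * d + t) = block d (mem s) p t" using 4(1) by (auto simp: block_def)
    show ?case by (rule wp_SetR) (use 4 r v in \<open>simp add: power2_eq_square\<close>)
  qed (use assms in \<open>auto simp: keeps_def regs_def\<close>)
  then show ?thesis by (rule wp_mono) (auto simp: dsq_def)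
qed

lemma wp_update_point:
  assumes rg: "regs s" "ireg s 6 = length C" "length C < k" "ireg s 8 = p" "p < n"
    and b: "block d (mem s) p = x p" "block d (mem s) (n + length C) = c"
    and w: "mem s ((n + (k + k)) * d + p) = wt C p"
  shows "wp \<omega> update_point_prog (3 * d + 6) (\<lambda>s'. same_but {} {p} (mem s) (mem s') \<and>
    mem s' ((n + (k + k)) * d + p) = wt (C @ [c]) p \<and> rreg s' 3 = rreg s 3 + wt (C @ [c]) p) s"
    (is "wp \<omega> _ _ ?Q s")
proof -
  have r: "ireg s 0 = n" "ireg s (Suc 0) = d" "ireg s 2 = k"
    using rg by (auto simp: regs_def)
  have "wp \<omega> update_point_prog (1 + ((3 * d + 2) + ((1 + 1) + 1))) ?Q s"
    unfolding update_point_prog_def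
  proof (intro wp_Seq[of _ "SetR 6 (ROfNat (IConst 0))"] wp_SetR wp_Seq[of _ dist_prog],
      rule wp_mono[OF wp_dist[where i = "length C" and p = p]], goal_cases)
    case (8 s')
    have e: "ireg s' 0 = n" "ireg s' (Suc 0) = d" "ireg s' 2 = k" "ireg s' 6 = length C" "ireg s' 8 = p"
      "mem s' = mem s" "rreg s' 3 = rreg s 3" "rreg s' 6 = dsq d (x p) c"
      using 8 r rg b by (auto simp: keeps_def)
    let ?A = "(n + (k + k)) * d + p"
    show ?case
    proof (intro wp_Seq wp_Cond, goal_cases)
      case 1
      then have v: "wt (C @ [c]) p = dsq d (x p) c" using e w by (auto simp: wt_snoc)
      have "same_but {} {p} (mem s) ((mem s)(?A := dsq d (x p) c))"
        by (rule same_but_Store_weight) auto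
      then show ?case using v e by (intro wp_Store wp_SetR) simp
    next
      case 2
      then have v: "wt (C @ [c]) p = wt C p" using e w by (auto simp: wt_snoc)
      then show ?case using e w by (intro wp_Skip wp_SetR) simp
    qed
  qed (use r rg in \<open>auto simp: regs_def\<close>)
  then show ?thesis by (rule wp_mono) auto
qed

lemma wp_update:
  assumes rg: "regs s" "ireg s 6 = length C" "length C < k"
    and lay: "layout (mem s) C" and b: "block d (mem s) (n + length C) = c"
    and w: "weights (mem s) C"
  shows "wp \<omega> update_prog (n * (3 * d + 8) + 4) (\<lambda>s'. same_but {} UNIV (mem s) (mem s') \<and>
    weights (mem s') (C @ [c]) \<and> rreg s' 4 = mass (C @ [c])) s"
    (is "wp \<omega> _ _ ?Q s")
proof -
  have r: "ireg s 0 = n" "ireg s (Suc 0) = d" "ireg s 2 = k" "ireg s 3 = m"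
    using rg by (auto simp: regs_def)
  let ?Inv = "\<lambda>t M R (u :: nat). same_but {} {..<t} (mem s) M \<and>
    (\<forall>p<t. M ((n + (k + k)) * d + p) = wt (C @ [c]) p) \<and> R 3 = (\<Sum>p<t. wt (C @ [c]) p)"
  have "wp \<omega> update_prog (1 + ((n * ((3 * d + 6) + 2) + 2) + 1)) ?Q s"
    unfolding update_prog_def
  proof (intro wp_Seq wp_SetR, rule wp_For[where Inv = ?Inv], goal_cases)
    case (4 t s')
    have e: "ireg s' 0 = n" "ireg s' (Suc 0) = d" "ireg s' 2 = k" "ireg s' 3 = m" "ireg s' 6 = length C"
      "ireg s' 8 = t"
      using 4 r rg by (auto simp: keeps_def)
    have sb: "same_but {} {..<t} (mem s) (mem s')" using 4 by simp
    have bt: "block d (mem s') t = x t" "block d (mem s') (n + length C) = c"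
      using same_but_blockD[OF sb] 4(1) lay b rg by (auto simp: layout_def)
    have wtt: "mem s' ((n + (k + k)) * d + t) = wt C t"
      using same_but_weightD[OF sb] 4(1) w by (auto simp: weights_def)
    show ?case
    proof (rule wp_mono[OF wp_update_point[where C = C and p = t and c = c]], goal_cases)
      case (10 s'')
      have sb'': "same_but {} {..<Suc t} (mem s) (mem s'')"
        by (rule same_but_trans[OF sb conjunct1[OF 10(2)]]) auto
      have "mem s'' ((n + (k + k)) * d + p) = mem s' ((n + (k + k)) * d + p)" if "p < t" for p
        using same_but_weightD[OF conjunct1[OF 10(2)], of p] that by simp
      then show ?case using 10 4 sb'' by (auto simp: less_Suc_eq)
    qed (use e 4(1) rg bt wtt in \<open>auto simp: regs_def\<close>)
  next
    case (5 s')
    then have "same_but {} UNIV (mem s) (mem s')"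
      using same_but_mono[of "{}" "{..<n}" "mem s" "mem s'" "{}" UNIV] by simp
    then show ?case
      using 5 by (intro wp_SetR) (auto simp: weights_def mass_def)
  qed (use r in \<open>auto simp: keeps_def\<close>)
  then show ?thesis by (rule wp_mono) auto
qed

text \<open>\<open>weights\<close> speaks of the points only. The cells of the centers all hold the
  current mass, so they are rewritten at the start of each round. The time bound absorbs
  \<open>k\<close> through k \<le> n.\<close>

lemma wp_round:
  assumes rg: "regs s" "ireg s 6 = length C" "length C < k" "1 \<le> n" "k \<le> n" "1 \<le> d" "1 \<le> m"
    and lay: "layout (mem s) C" and w: "weights (mem s) C" and R4: "rreg s 4 = mass C"
    and c_def: "c = mean C (\<lambda>t. pick C (\<omega> (used s + t)))"
  shows "wp \<omega> round_prog (50 * (m * n * d)) (\<lambda>s'. used s' = used s + m \<and>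
    same_but {n + length C} UNIV (mem s) (mem s') \<and> layout (mem s') (C @ [c]) \<and>
    weights (mem s') (C @ [c]) \<and> rreg s' 4 = mass (C @ [c])) s"
    (is "wp \<omega> _ _ ?Q s")
proof -
  let ?i = "length C"
  have r: "ireg s 0 = n" "ireg s (Suc 0) = d" "ireg s 2 = k" "ireg s 3 = m"
    using rg by (auto simp: regs_def)
  let ?Inv1 = "\<lambda>t M (R :: nat \<Rightarrow> real) (u :: nat). same_but {} {n..<n + t} (mem s) M \<and>
    (\<forall>j<t. M ((n + (k + k)) * d + (n + j)) = mass C)"
  have "wp \<omega> round_prog ((?i * (1 + 2) + 2) + ((d * (1 + 2) + 2) +
      ((m * ((3 * (n + k) + 3 * d + 7) + 2) + 2) + (n * (3 * d + 8) + 4)))) ?Q s"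
    unfolding round_prog_def
  proof (intro wp_Seq[of _ "For 8 _ _"], rule wp_For[where Inv = ?Inv1], goal_cases)
    case (4 t s')
    have e: "ireg s' 0 = n" "ireg s' (Suc 0) = d" "ireg s' 2 = k" "ireg s' 8 = t" "rreg s' 4 = mass C"
      using 4 r R4 by (auto simp: keeps_def)
    let ?M = "(mem s')((n + (k + k)) * d + (n + t) := mass C)"
    have "same_but {} {n..<n + Suc t} (mem s) (mem s')"
      by (rule same_but_mono[OF conjunct1[OF 4(4)]]) auto
    then have "same_but {} {n..<n + Suc t} (mem s) ?M" by (rule same_but_Store_weight) auto
    then show ?case using e 4 by (intro wp_Store) (auto simp: less_Suc_eq)
  next
    case (5 s1)
    have e1: "ireg s1 0 = n" "ireg s1 (Suc 0) = d" "ireg s1 2 = k" "ireg s1 3 = m" "ireg s1 6 = ?i"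
      "rreg s1 4 = mass C" "used s1 = used s"
      using 5 r rg R4 by (auto simp: keeps_def)
    have sb1: "same_but {} {n..<n + ?i} (mem s) (mem s1)" using 5 by simp
    let ?Inv2 = "\<lambda>t M (R :: nat \<Rightarrow> real) (u :: nat). same_but {n + ?i} {} (mem s1) M \<and>
      block d M (n + ?i) = (\<lambda>l. if l < t then 0 else block d (mem s1) (n + ?i) l)"
    show ?case
    proof (intro wp_Seq[of _ "For 9 _ _"], rule wp_For[where Inv = ?Inv2], goal_cases)
      case (4 t s')
      have e: "ireg s' 0 = n" "ireg s' (Suc 0) = d" "ireg s' 6 = ?i" "ireg s' 9 = t"
        using 4 e1 by (auto simp: keeps_def)
      let ?M = "(mem s')((n + ?i) * d + t := 0)"
      have "same_but {n + ?i} {} (mem s1) ?M"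
        by (rule same_but_Store) (use 4 rg in auto)
      moreover have "block d ?M (n + ?i) = (\<lambda>l. if l < Suc t then 0 else block d (mem s1) (n + ?i) l)"
        using 4 by (auto simp: block_Store fun_eq_iff less_Suc_eq)
      ultimately show ?case using e by (intro wp_Store) simp
    next
      case (5 s2)
      have e2: "ireg s2 0 = n" "ireg s2 (Suc 0) = d" "ireg s2 2 = k" "ireg s2 3 = m" "ireg s2 6 = ?i"
        "rreg s2 4 = mass C" "used s2 = used s"
        using 5 e1 by (auto simp: keeps_def)
      have z2: "block d (mem s2) (n + ?i) = (\<lambda>_. 0)" using 5 by (auto simp: block_def fun_eq_iff)
      have sb2: "same_but {n + ?i} {n..<n + ?i} (mem s) (mem s2)"
        by (rule same_but_trans[OF sb1 conjunct1[OF 5(2)]]) auto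
      have lay2: "layout (mem s2) C" by (rule layout_same[OF lay sb2]) (use rg in auto)
      have w2: "weights (mem s2) C" by (rule weights_same[OF w sb2]) auto
      have cw2: "mem s2 ((n + (k + k)) * d + j) = cwt C j" if "j < n + ?i" for j
      proof (cases "j < n")
        case True
        then show ?thesis using w2 by (simp add: cwt_def weights_def)
      next
        case False
        then have "mem s1 ((n + (k + k)) * d + (n + (j - n))) = mass C"
          using conjunct2[OF \<open>?Inv1 ?i (mem s1) (rreg s1) (used s1)\<close>, rule_format, of "j - n"] that by simp
        then show ?thesis using same_but_weightD[OF conjunct1[OF 5(2)], of j] False by (simp add: cwt_def)
      qed
      let ?Inv3 = "\<lambda>t M (R :: nat \<Rightarrow> real) u. u = used s + t \<and> same_but {n + ?i} {} (mem s2) M \<and>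
        block d M (n + ?i) = (\<lambda>l. if l < d then \<Sum>t'<t. cand C (pick C (\<omega> (used s + t'))) l / m else 0)"
      show ?case
      proof (intro wp_Seq[of _ "For 7 _ _"], rule wp_For[where Inv = ?Inv3], goal_cases)
        case (4 t s')
        have e: "ireg s' 0 = n" "ireg s' (Suc 0) = d" "ireg s' 2 = k" "ireg s' 3 = m" "ireg s' 6 = ?i"
          "rreg s' 4 = mass C"
          using 4 e2 by (auto simp: keeps_def)
        have sb: "same_but {n + ?i} {} (mem s2) (mem s')" using 4 by simp
        have lay': "layout (mem s') C" by (rule layout_same[OF lay2 sb]) (use rg in auto)
        have cw': "mem s' ((n + (k + k)) * d + j) = cwt C j" if "j < n + ?i" for j
          using same_but_weightD[OF sb, of j] cw2[OF that] by simp
        show ?case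
        proof (rule wp_mono[OF wp_sample[where C = C and j = "pick C (\<omega> (used s + t))"]], goal_cases)
          case (10 s'')
          have "same_but {n + ?i} {} (mem s2) (mem s'')"
            by (rule same_but_trans[OF sb conjunct1[OF conjunct2[OF 10(2)]]]) auto
          then show ?case using 10 4 by auto
        qed (use e rg lay' cw' 4 in \<open>auto simp: regs_def\<close>)
      next
        case (5 s3)
        have e3: "ireg s3 0 = n" "ireg s3 (Suc 0) = d" "ireg s3 2 = k" "ireg s3 3 = m" "ireg s3 6 = ?i"
          using 5 e2 by (auto simp: keeps_def)
        have sb3: "same_but {n + ?i} {} (mem s2) (mem s3)" using 5 by simp
        have lay3: "layout (mem s3) C" by (rule layout_same[OF lay2 sb3]) (use rg in auto)
        have w3: "weights (mem s3) C" by (rule weights_same[OF w2 sb3]) auto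
        have c3: "block d (mem s3) (n + ?i) = c" using 5 by (simp add: c_def mean_def)
        show ?case
        proof (rule wp_mono[OF wp_update[where C = C and c = c]], goal_cases)
          case (8 s4)
          have sb4: "same_but {} UNIV (mem s3) (mem s4)" using 8 by simp
          have lay4: "layout (mem s4) C" by (rule layout_same[OF lay3 sb4]) (use rg in auto)
          have "block d (mem s4) (n + ?i) = c"
            using same_but_blockD[OF sb4, of "n + ?i"] c3 rg by simp
          then have "layout (mem s4) (C @ [c])"
            using lay4 by (auto simp: layout_def nth_append less_Suc_eq)
          moreover have "same_but {n + ?i} UNIV (mem s) (mem s4)"
            using same_but_trans[OF same_but_trans[OF sb2 sb3, of "{n + ?i}" UNIV] sb4] by auto
          moreover have "used s4 = used s + m" using 5 8 by (simp add: keeps_def)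
          ultimately show ?case using 8 by simp
        qed (use e3 rg lay3 w3 c3 in \<open>auto simp: regs_def\<close>)
      qed (use e2 z2 in \<open>auto simp: keeps_def\<close>)
    qed (use e1 in \<open>auto simp: keeps_def\<close>)
  qed (use r rg in \<open>auto simp: keeps_def\<close>)
  moreover have "(?i * (1 + 2) + 2) + ((d * (1 + 2) + 2) +
      ((m * ((3 * (n + k) + 3 * d + 7) + 2) + 2) + (n * (3 * d + 8) + 4))) \<le> 50 * (m * n * d)"
  proof -
    let ?X = "m * n * d"
    have nd: "n \<le> n * d" "d \<le> n * d" using rg by auto
    then have X: "n * d \<le> ?X" "m * (n * d) = ?X" using rg by (auto simp: mult.assoc)
    have "m * ((3 * (n + k) + 3 * d + 7) + 2) \<le> m * (18 * (n * d))"
    proof (rule mult_le_mono2)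
      have sum: "3 * (n + k) + 3 * d + 7 + 2 \<le> 18 * Y" if "n \<le> Y" "d \<le> Y" for Y
        using that \<open>k \<le> n\<close> \<open>1 \<le> d\<close> \<open>1 \<le> n\<close> by simp
      show "3 * (n + k) + 3 * d + 7 + 2 \<le> 18 * (n * d)" by (rule sum[OF nd])
    qed
    also have "\<dots> = 18 * ?X" by simp
    finally have 1: "m * ((3 * (n + k) + 3 * d + 7) + 2) \<le> 18 * ?X" .
    have "n * (3 * d + 8) \<le> n * (11 * d)" using rg by (intro mult_le_mono2) simp
    also have "\<dots> = 11 * (n * d)" by simp
    also have "\<dots> \<le> 11 * ?X" using X by (intro mult_le_mono2)
    finally have 2: "n * (3 * d + 8) \<le> 11 * ?X" .
    have 3: "1 \<le> ?X" using rg by simp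
    have 4: "?i \<le> ?X" "d \<le> ?X" using nd X(1) rg by linarith+
    have sum: "(i * (1 + 2) + 2) + ((d * (1 + 2) + 2) + ((A + 2) + (B + 4))) \<le> 50 * Y"
      if "A \<le> 18 * Y" "B \<le> 11 * Y" "1 \<le> Y" "i \<le> Y" "d \<le> Y" for A B Y i :: nat
      using that by simp
    show ?thesis by (rule sum[OF 1 2 3 4])
  qed
  ultimately show ?thesis by (rule wp_mono) auto
qed

lemma wp_copy:
  assumes rg: "regs s"
  shows "wp \<omega> copy_prog (k * (3 * d + 4) + 2) (\<lambda>s'. same_but {n + k..<n + (k + k)} {} (mem s) (mem s') \<and>
    (\<forall>b<k. block d (mem s') (n + (k + b)) = block d (mem s) (n + b))) s"
proof -
  have r: "ireg s 0 = n" "ireg s (Suc 0) = d" "ireg s 2 = k"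
    using rg by (auto simp: regs_def)
  let ?A = "{n + k..<n + (k + k)}"
  let ?Inv = "\<lambda>t M (R :: nat \<Rightarrow> real) (u :: nat). same_but ?A {} (mem s) M \<and>
    (\<forall>b<t. block d M (n + (k + b)) = block d (mem s) (n + b))"
  have "wp \<omega> copy_prog (k * ((d * (1 + 2) + 2) + 2) + 2) (\<lambda>s'. ?Inv k (mem s') (rreg s') (used s')) s"
    unfolding copy_prog_def
  proof (rule wp_For[where Inv = ?Inv], goal_cases)
    case (4 t s1)
    have e1: "ireg s1 0 = n" "ireg s1 (Suc 0) = d" "ireg s1 2 = k" "ireg s1 8 = t"
      using 4 r by (auto simp: keeps_def)
    have sb1: "same_but ?A {} (mem s) (mem s1)" using 4 by simp
    let ?Inv2 = "\<lambda>l M (R :: nat \<Rightarrow> real) (u :: nat). same_but {n + (k + t)} {} (mem s1) M \<and>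
      block d M (n + (k + t)) = (\<lambda>l'. if l' < l then block d (mem s) (n + t) l' else block d (mem s1) (n + (k + t)) l')"
    show ?case
    proof (rule wp_For[where Inv = ?Inv2], goal_cases)
      case (4 l s2)
      have e2: "ireg s2 0 = n" "ireg s2 (Suc 0) = d" "ireg s2 2 = k" "ireg s2 8 = t" "ireg s2 9 = l"
        using 4 e1 by (auto simp: keeps_def)
      have sb2: "same_but {n + (k + t)} {} (mem s1) (mem s2)" using 4 by simp
      have "block d (mem s2) (n + t) = block d (mem s) (n + t)"
        using same_but_blockD[OF sb2, of "n + t"] same_but_blockD[OF sb1, of "n + t"] \<open>t < k\<close> by simp
      then have v: "mem s2 ((n + t) * d + l) = block d (mem s) (n + t) l"
        using 4(1) by (auto simp: block_def fun_eq_iff) metis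
      let ?M = "(mem s2)((n + (k + t)) * d + l := block d (mem s) (n + t) l)"
      have "same_but {n + (k + t)} {} (mem s1) ?M"
        by (rule same_but_Store[OF sb2]) (use 4(1) \<open>t < k\<close> in auto)
      moreover have "block d ?M (n + (k + t)) = (\<lambda>l'. if l' < Suc l then block d (mem s) (n + t) l' else block d (mem s1) (n + (k + t)) l')"
        using 4 by (auto simp: block_Store fun_eq_iff less_Suc_eq)
      ultimately show ?case using e2 v by (intro wp_Store) simp
    next
      case (5 s2)
      have sb2: "same_but {n + (k + t)} {} (mem s1) (mem s2)" using 5 by simp
      have "same_but ?A {} (mem s) (mem s2)"
        by (rule same_but_trans[OF sb1 sb2]) (use \<open>t < k\<close> in auto)
      moreover have "block d (mem s2) (n + (k + t)) = block d (mem s) (n + t)"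
        using 5 by (auto simp: block_def fun_eq_iff)
      moreover have "block d (mem s2) (n + (k + b)) = block d (mem s) (n + b)" if "b < t" for b
        using same_but_blockD[OF sb2, of "n + (k + b)"] 4(1,4) that by auto
      ultimately show ?case by (auto simp: less_Suc_eq)
    qed (use e1 in \<open>auto simp: keeps_def\<close>)
  qed (use r in \<open>auto simp: keeps_def\<close>)
  then show ?thesis by (rule wp_mono) (auto simp: algebra_simps)
qed

text \<open>The case distinction mirrors \<open>best\<close>: value 0 of the attempt counter stands
  for a missing previous best.\<close>

lemma wp_rep:
  assumes rg: "regs s" "1 \<le> n" "k \<le> n" "1 \<le> d" "1 \<le> m" "1 \<le> k"
    and lay: "layout (mem s) []"
    and C_def: "C = rounds \<omega> (used s) k"
  shows "wp \<omega> rep_prog (80 * (k * (m * n * d))) (\<lambda>s'. used s' = used s + k * m \<and>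
    layout (mem s') [] \<and>
    (if ireg s 5 = 0 \<or> mass C < rreg s 5
     then rreg s' 5 = mass C \<and> (\<forall>b<k. block d (mem s') (n + (k + b)) = C ! b)
     else rreg s' 5 = rreg s 5 \<and> (\<forall>b<k. block d (mem s') (n + (k + b)) = block d (mem s) (n + (k + b))))) s"
    (is "wp \<omega> _ _ ?Q s")
proof -
  have r: "ireg s 0 = n" "ireg s (Suc 0) = d" "ireg s 2 = k" "ireg s 3 = m"
    using rg by (auto simp: regs_def)
  let ?X = "m * n * d"
  let ?Inv1 = "\<lambda>t M (R :: nat \<Rightarrow> real) (u :: nat). same_but {} UNIV (mem s) M \<and>
    (\<forall>p<t. M ((n + (k + k)) * d + p) = 1)"
  have "wp \<omega> rep_prog ((n * (1 + 2) + 2) + (1 + ((k * (50 * ?X + 2) + 2) + (1 + (1 + (k * (3 * d + 4) + 2)))))) ?Q s"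
    unfolding rep_prog_def
  proof (intro wp_Seq[of _ "For 8 _ _"], rule wp_For[where Inv = ?Inv1], goal_cases)
    case (4 t s')
    have e: "ireg s' 0 = n" "ireg s' (Suc 0) = d" "ireg s' 2 = k" "ireg s' 8 = t"
      using 4 r by (auto simp: keeps_def)
    let ?M = "(mem s')((n + (k + k)) * d + t := 1)"
    have "same_but {} UNIV (mem s) ?M"
      by (rule same_but_Store_weight[OF conjunct1[OF 4(4)]]) auto
    then show ?case using e 4 by (intro wp_Store) (auto simp: less_Suc_eq)
  next
    case (5 s1)
    have e1: "ireg s1 0 = n" "ireg s1 (Suc 0) = d" "ireg s1 2 = k" "ireg s1 3 = m" "ireg s1 5 = ireg s 5"
      "rreg s1 5 = rreg s 5" "used s1 = used s"
      using 5 r by (auto simp: keeps_def)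
    have sb1: "same_but {} UNIV (mem s) (mem s1)" using 5 by simp
    let ?C = "\<lambda>i. rounds \<omega> (used s) i"
    let ?Inv2 = "\<lambda>i M R u. u = used s + i * m \<and> same_but {n..<n + k} UNIV (mem s1) M \<and>
      layout M (?C i) \<and> weights M (?C i) \<and> R 4 = mass (?C i)"
    show ?case
    proof (intro wp_Seq[of _ "SetR _ _"] wp_SetR wp_Seq[of _ "For 6 _ _"], rule wp_For[where Inv = ?Inv2], goal_cases)
      case 3
      have "layout (mem s1) []" by (rule layout_same[OF lay sb1]) auto
      moreover have "weights (mem s1) []" using 5 by (auto simp: weights_def wt_def)
      ultimately show ?case using e1 by (simp add: mass_def wt_def)
    next
      case (4 i s')
      have e: "ireg s' 0 = n" "ireg s' (Suc 0) = d" "ireg s' 2 = k" "ireg s' 3 = m" "ireg s' 6 = i"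
        using 4 e1 by (auto simp: keeps_def)
      have sb: "same_but {n..<n + k} UNIV (mem s1) (mem s')" using 4 by simp
      show ?case
      proof (rule wp_mono[OF wp_round[where C = "?C i"
              and c = "mean (?C i) (\<lambda>t. pick (?C i) (\<omega> (used s' + t)))"]], goal_cases)
        case (13 s'')
        have "same_but {n..<n + k} UNIV (mem s1) (mem s'')"
          by (rule same_but_trans[OF sb conjunct1[OF conjunct2[OF 13(2)]]]) (use 4 in auto)
        then show ?case using 13 4 by simp
      qed (use e 4 rg in \<open>auto simp: regs_def\<close>)
    next
      case (5 s2)
      have e2: "ireg s2 0 = n" "ireg s2 (Suc 0) = d" "ireg s2 2 = k" "ireg s2 3 = m" "ireg s2 5 = ireg s 5"
        using 5 e1 by (auto simp: keeps_def)
      have m2: "rreg s2 4 = mass C" "layout (mem s2) C" "used s2 = used s + k * m" using 5 by (auto simp: C_def)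
      have sb2: "same_but {n..<n + k} UNIV (mem s1) (mem s2)" using 5 by simp
      have lay2: "layout (mem s2) []" using m2 by (simp add: layout_def)
      have keep_best: "block d (mem s2) (n + (k + b)) = block d (mem s) (n + (k + b))" if "b < k" for b
        using same_but_blockD[OF sb2, of "n + (k + b)"] same_but_blockD[OF sb1, of "n + (k + b)"] that by simp
      have new: "block d (mem s2) (n + b) = C ! b" if "b < k" for b
        using m2(2) that by (simp add: layout_def C_def)
      have r5: "rreg s2 5 = rreg s 5"
        using 5 e1 by (auto simp: keeps_def)
      show ?case
      proof (intro wp_Cond, goal_cases)
        case 1
        then have c: "ireg s 5 = 0 \<or> mass C < rreg s 5" using e2 m2 r5 by auto
        show ?case
        proof (intro wp_Seq[of _ "SetR _ _"] wp_SetR, rule wp_mono[OF wp_copy], goal_cases)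
          case (3 s3)
          have "layout (mem s3) []"
            by (rule layout_same[OF lay2, of "{n + k..<n + (k + k)}" "{}"]) (use 3 in auto)
          moreover have "used s3 = used s + k * m" "rreg s3 5 = mass C"
            using 3(1) m2 by (auto simp: keeps_def)
          ultimately show ?case using c 3(2) new by simp
        qed (use e2 in \<open>auto simp: regs_def\<close>)
      next
        case 2
        then have c: "\<not> (ireg s 5 = 0 \<or> mass C < rreg s 5)" using e2 m2 r5 by auto
        have "wp \<omega> Skip 1 ?Q s2" using c lay2 m2 keep_best r5 by (intro wp_Skip) simp
        then show ?case by (rule wp_mono) auto
      qed
    qed (use e1 in \<open>auto simp: keeps_def\<close>)
  qed (use r rg in \<open>auto simp: keeps_def\<close>)
  moreover have "(n * (1 + 2) + 2) + (1 + ((k * (50 * ?X + 2) + 2) + (1 + (1 + (k * (3 * d + 4) + 2))))) \<le> 80 * (k * ?X)"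
  proof -
    have X: "1 \<le> ?X" using rg by simp
    have kX: "?X \<le> k * ?X" "k \<le> k * ?X" 
      using mult_le_mono1[OF rg(6), of ?X] mult_le_mono2[OF X, of k] by (simp_all only: mult_1 mult_1_right)
    have nd: "n \<le> n * d" "d \<le> n * d" "n * d \<le> ?X" using rg by (auto simp: mult.assoc)
    have "k * (3 * d + 4) \<le> k * (7 * ?X)" using nd X by (intro mult_le_mono2) linarith
    also have "\<dots> = 7 * (k * ?X)" by simp
    finally have B: "k * (3 * d + 4) \<le> 7 * (k * ?X)" .
    have A: "k * (50 * ?X + 2) = 50 * (k * ?X) + 2 * k" by (simp add: algebra_simps)
    have sum: "n * (1 + 2) + 2 + (1 + ((A + 2) + (1 + (1 + (B + 2))))) \<le> 80 * Y"
      if "A = 50 * Y + 2 * k" "B \<le> 7 * Y" "n \<le> Y" "k \<le> Y" "1 \<le> Y" for A B Y :: nat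
      using that by simp
    show ?thesis
      by (rule sum[OF A B order_trans[OF nd(1) order_trans[OF nd(3) kX(1)]] kX(2) order_trans[OF X kX(1)]])
  qed
  ultimately show ?thesis by (rule wp_mono) auto
qed

text \<open>Each attempt consumes exactly \<open>k * m\<close> entries, so attempt \<open>t\<close>
  started at the current tape position is \<open>run \<omega> t\<close>.\<close>

lemma wp_main_loop:
  assumes rg: "regs s" "1 \<le> n" "k \<le> n" "1 \<le> d" "1 \<le> m" "1 \<le> k"
    and lay: "layout (mem s) []" and u: "used s = 0" and R: "ireg s 4 = R"
  shows "wp \<omega> (For 5 (IReg 4) rep_prog) (R * (80 * (k * (m * n * d)) + 2) + 2)
    (\<lambda>s'. regs s' \<and> (1 \<le> R \<longrightarrow> (\<forall>b<k. block d (mem s') (n + (k + b)) = best \<omega> R ! b))) s"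
proof -
  let ?Inv = "\<lambda>t M R u. u = t * (k * m) \<and> layout M [] \<and>
    (1 \<le> t \<longrightarrow> R 5 = mass (best \<omega> t) \<and> (\<forall>b<k. block d M (n + (k + b)) = best \<omega> t ! b))"
  show ?thesis
  proof (rule wp_For[where Inv = ?Inv], goal_cases)
    case (4 t s1)
    have e: "regs s1" "ireg s1 5 = t" "used s1 = t * (k * m)" "layout (mem s1) []"
      using 4 rg by (auto simp: keeps_def regs_def)
    show ?case
    proof (rule wp_mono[OF wp_rep[where C = "run \<omega> t"]], goal_cases)
      case (10 s2)
      then show ?case using 4 e by (cases "t = 0 \<or> mass (run \<omega> t) < rreg s1 5") (auto split: if_splits)
    qed (use e rg in \<open>auto simp: run_def\<close>)
  next
    case (5 s')
    then show ?case using rg by (auto simp: keeps_def regs_def)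
  qed (use assms in \<open>auto simp: keeps_def\<close>)
qed

text \<open>The second loop accumulates in index register 4, which the invariant of
  \<open>wp_For\<close> cannot mention; hence \<open>For\<close> is unfolded and
  \<open>wp_While\<close> applied.\<close>

lemma wp_init:
  assumes s: "ireg s 2 = k" "ireg s 3 = 0" "rreg s 0 = \<epsilon>"
    and m: "96 \<le> real m * gap \<epsilon> k" "\<And>j. j < m \<Longrightarrow> real j * gap \<epsilon> k < 96"
  shows "wp \<omega> (init_prog L) (2 * m + 3 * (k * m) + 5)
    (\<lambda>s'. ireg s' 3 = m \<and> ireg s' 4 = L * (m ^ 5) ^ (k * m)) s" (is "wp \<omega> _ _ ?Q s")
proof -
  let ?I1 = "\<lambda>s'. ireg s' 2 = k \<and> ireg s' 3 \<le> m \<and> rreg s' 1 = gap \<epsilon> k"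
  let ?I2 = "\<lambda>s'. ireg s' 2 = k \<and> ireg s' 3 = m \<and> ireg s' 10 \<le> k * m \<and>
    ireg s' 4 = L * (m ^ 5) ^ ireg s' 10"
  let ?f1 = "\<lambda>s'. m - ireg s' 3" and ?f2 = "\<lambda>s'. k * m - ireg s' 10"
  let ?W2 = "While (ILess (IReg 10) (IMul (IReg 2) (IReg 3)))
    (Seq (SetI 4 (IMul (IReg 4) (pow5 (IReg 3)))) (SetI 10 (IAdd (IReg 10) (IConst 1))))"
  have W2: "wp \<omega> ?W2 (k * m * 3 + 1) ?Q s'" if "?I2 s'" "ireg s' 10 = 0" for s'
  proof -
    have "wp \<omega> ?W2 (?f2 s' * ((1 + 1) + 1) + 1) ?Q s'"
    proof (rule wp_While[where Inv = ?I2])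
      fix s1 assume "?I2 s1" "tval s1 (ILess (IReg 10) (IMul (IReg 2) (IReg 3)))"
      then show "wp \<omega> (Seq (SetI 4 (IMul (IReg 4) (pow5 (IReg 3)))) (SetI 10 (IAdd (IReg 10) (IConst 1))))
          (1 + 1) (\<lambda>s2. ?I2 s2 \<and> ?f2 s2 < ?f2 s1) s1"
        by (intro wp_Seq wp_SetI) (auto simp: pow5_def eval_nat_numeral mult_ac)
    qed (use that in auto)
    then show ?thesis by (rule wp_mono) (use that in auto)
  qed
  have "wp \<omega> (init_prog L) (1 + ((?f1 s * (1 + 1) + 1) + (1 + (1 + (k * m * 3 + 1))))) ?Q s"
    unfolding init_prog_def For_def
  proof (intro wp_Seq[of _ "SetR _ _"] wp_SetR wp_Seq[of _ "While _ _"], goal_cases)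
    case 1
    let ?s = "s\<lparr>rreg := (rreg s)(1 := gap \<epsilon> k)\<rparr>"
    have g: "rval s (RDiv (RReg 0) (RMul (RAdd (ROfNat (IConst 1)) (RDiv (RReg 0) (ROfNat (IConst 2)))) (ROfNat (IReg 2)))) = gap \<epsilon> k"
      using s by (simp add: gap_def)
    have "wp \<omega> (While (RLess (RMul (ROfNat (IReg 3)) (RReg 1)) (ROfNat (IConst 96))) (SetI 3 (IAdd (IReg 3) (IConst 1))))
       (?f1 ?s * (1 + 1) + 1)
       (wp \<omega> (Seq (SetI 4 (IConst L)) (Seq (SetI 10 (IConst 0)) ?W2)) (1 + (1 + (k * m * 3 + 1))) ?Q) ?s"
    proof (rule wp_While[where Inv = ?I1])
      fix s1 assume I: "?I1 s1" and t: "tval s1 (RLess (RMul (ROfNat (IReg 3)) (RReg 1)) (ROfNat (IConst 96)))"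
      then have "ireg s1 3 \<noteq> m" using m(1) by auto
      then show "wp \<omega> (SetI 3 (IAdd (IReg 3) (IConst 1))) 1 (\<lambda>s2. ?I1 s2 \<and> ?f1 s2 < ?f1 s1) s1"
        using I by (intro wp_SetI) auto
    next
      fix s1 assume I: "?I1 s1" and t: "\<not> tval s1 (RLess (RMul (ROfNat (IReg 3)) (RReg 1)) (ROfNat (IConst 96)))"
      then have "\<not> ireg s1 3 < m" using m(2)[of "ireg s1 3"] by auto
      then show "wp \<omega> (Seq (SetI 4 (IConst L)) (Seq (SetI 10 (IConst 0)) ?W2)) (1 + (1 + (k * m * 3 + 1))) ?Q s1"
        using I by (intro wp_Seq wp_SetI W2) auto
    qed (use s in auto)
    then show ?case unfolding g by simp
  qed
  then show ?thesis by (rule wp_mono) (use s in auto)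
qed

lemma block_trunc: "trunc (block d M a) = block d M a"
  by (simp add: trunc_def block_def fun_eq_iff)

lemma input_block:
  assumes "length ps = n" "set ps \<subseteq> space_of_dim d" "p < n"
  shows "block d (mem (kmeans_input \<epsilon> k d ps)) p = ps ! p"
proof -
  have "ps ! p \<in> space_of_dim d" using assms by auto
  then have "(ps ! p) l = 0" if "\<not> l < d" for l using that by (auto simp: topspace_Euclidean_space)
  moreover have "p * d + l < n * d" if "l < d" for l using that assms by (intro block_less)
  ultimately show ?thesis using assms(1) by (auto simp: block_def kmeans_input_def fun_eq_iff)
qed

lemma output_block: "ireg s 1 = a * d \<Longrightarrow> kmeans_output d s = (\<lambda>b. block d (mem s) (a + b)) ` {..<ireg s 0}"
  by (auto simp: kmeans_output_def block_def algebra_simps intro!: image_cong)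

lemma wp_kmeans_large:
  assumes "1 \<le> d" "1 \<le> k" "k < n" "1 \<le> m" "1 \<le> L"
    and ps: "length ps = n" "set ps \<subseteq> space_of_dim d" "\<And>p. p < n \<Longrightarrow> x p = ps ! p"
    and m: "96 \<le> real m * gap \<epsilon> k" "\<And>j. j < m \<Longrightarrow> real j * gap \<epsilon> k < 96"
  defines "R \<equiv> L * (m ^ 5) ^ (k * m)"
  shows "wp \<omega> (kmeans_prog L) (100 * (R * (k * (m * n * d))))
    (\<lambda>s. kmeans_output d s = trunc ` set (best \<omega> R)) (kmeans_input \<epsilon> k d ps)" (is "wp \<omega> _ _ ?Q ?s")
proof -
  let ?Y = "k * (m * n * d)"
  have s: "ireg ?s 0 = n" "ireg ?s (Suc 0) = d" "ireg ?s 2 = k" "ireg ?s 3 = 0" "rreg ?s 0 = \<epsilon>" "used ?s = 0"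
    using ps by (auto simp: kmeans_input_def)
  have lay: "layout (mem ?s) []" using input_block[OF ps(1,2)] ps(3) by (simp add: layout_def)
  have R1: "1 \<le> R" using assms by (simp add: R_def)
  have init_mods: "imods (init_prog L) = {3, 4, 10}" "rmods (init_prog L) = {1}"
    "\<not> stores (init_prog L)" "\<not> draws (init_prog L)" by (auto simp: init_prog_def)
  have "wp \<omega> (kmeans_prog L) (1 + ((2 * m + 3 * (k * m) + 5) + ((R * (80 * ?Y + 2) + 2) + (1 + 1)))) ?Q ?s"
    unfolding kmeans_prog_def
  proof (intro wp_Cond wp_Seq[of _ "init_prog L"], goal_cases)
    case 1
    show ?case
    proof (rule wp_mono[OF wp_init[OF s(3,4,5) m]], goal_cases)
      case (3 s1)
      have e: "regs s1" "used s1 = 0" "mem s1 = mem ?s" "ireg s1 4 = R"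
        using 3 s by (auto simp: keeps_def init_mods regs_def R_def)
      show ?case
      proof (rule wp_Seq, rule wp_mono[OF wp_main_loop[where R = R]], goal_cases)
        case (11 s2)
        have b: "block d (mem s2) (n + (k + b)) = best \<omega> R ! b" if "b < k" for b
          using 11 R1 that by simp
        have len: "length (best \<omega> R) = k" using best_is_run[OF R1] by (metis length_run)
        have st: "set (best \<omega> R) = (\<lambda>b. block d (mem s2) (n + (k + b))) ` {..<k}"
          using b len by (force simp: set_conv_nth)
        have "trunc ` set (best \<omega> R) = set (best \<omega> R)"
          unfolding st by (simp add: image_image block_trunc)
        moreover have "kmeans_output d s3 = set (best \<omega> R)"
          if "ireg s3 0 = k" "ireg s3 1 = (n + k) * d" "mem s3 = mem s2" for s3
          unfolding st output_block[OF that(2)] that by (simp add: add.assoc)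
        ultimately show ?case
          using 11(2) by (intro wp_Seq wp_SetI) (simp add: regs_def)
      qed (use e lay assms in auto)
    qed auto
  qed (use s assms in auto)
  moreover have "1 + ((2 * m + 3 * (k * m) + 5) + ((R * (80 * ?Y + 2) + 2) + (1 + 1))) \<le> 100 * (R * ?Y)"
  proof -
    have nd: "1 \<le> n * d" using assms by simp
    have km: "k * m \<le> ?Y" using mult_le_mono2[OF nd, of "k * m"] by (simp add: mult_ac)
    have mm: "m \<le> k * m" using assms by simp
    have one: "1 \<le> ?Y" using assms by simp
    have RY: "?Y \<le> R * ?Y" "R \<le> R * ?Y"
      using mult_le_mono1[OF R1, of ?Y] mult_le_mono2[OF one, of R] by (simp_all only: mult_1 mult_1_right)
    have A: "R * (80 * ?Y + 2) = 80 * (R * ?Y) + 2 * R" by (simp add: algebra_simps)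
    have sum: "1 + ((2 * m + 3 * K + 5) + ((A + 2) + (1 + 1))) \<le> 100 * Z"
      if "A = 80 * Z + 2 * R" "m \<le> Z" "K \<le> Z" "R \<le> Z" "1 \<le> Z" for A K Z :: nat
      using that by simp
    show ?thesis
      by (rule sum[OF A order_trans[OF mm order_trans[OF km RY(1)]] order_trans[OF km RY(1)] RY(2)
            order_trans[OF one RY(1)]])
  qed
  ultimately show ?thesis by (rule wp_mono) auto
qed

end

section \<open>Small inputs, the time bound and the conclusion\<close>

lemma wp_kmeans_small:
  assumes "length ps \<le> k" "set ps \<subseteq> space_of_dim d"
  shows "wp \<omega> (kmeans_prog L) 2 (\<lambda>s. kmeans_output d s = set ps) (kmeans_input \<epsilon> k d ps)"
proof -
  let ?s = "kmeans_input \<epsilon> k d ps"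
  have "wp \<omega> (kmeans_prog L) (1 + 1) (\<lambda>s. kmeans_output d s = set ps) ?s"
    unfolding kmeans_prog_def
  proof (rule wp_Cond)
    assume "tval ?s (ILess (IReg 2) (IReg 0))"
    then show "wp \<omega> (Seq (init_prog L) (Seq (For 5 (IReg 4) rep_prog)
      (Seq (SetI 1 (IMul (IAdd (IReg 0) (IReg 2)) (IReg 1))) (SetI 0 (IReg 2))))) 1
      (\<lambda>s. kmeans_output d s = set ps) ?s"
      using assms by (simp add: kmeans_input_def)
  next
    let ?s' = "?s\<lparr>ireg := (ireg ?s)(1 := 0)\<rparr>"
    have "kmeans_output d ?s' = (\<lambda>b. block d (mem ?s) (0 + b)) ` {..<length ps}"
      by (subst sampling.output_block[of _ 0]) (auto simp: kmeans_input_def)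
    also have "\<dots> = (!) ps ` {..<length ps}"
      using sampling.input_block[OF refl assms(2)] by (intro image_cong) auto
    also have "\<dots> = set ps" by (auto simp: set_conv_nth)
    finally show "wp \<omega> (SetI 1 (IConst 0)) 1 (\<lambda>s. kmeans_output d s = set ps) ?s"
      by (intro wp_SetI) simp
  qed
  then show ?thesis by (rule wp_mono) auto
qed

text \<open>Here k m \<le> M k ^ 2 / \<epsilon> and log m \<le> log M + log (k / \<epsilon>). The
  sum is at most log M + 1 times the maximum, which also covers a small or negative log (k /
  \<epsilon>).\<close>

lemma power_time_bound:
  fixes k m :: nat and \<epsilon> M :: real
  assumes "1 \<le> k" "1 \<le> m" "0 < \<epsilon>" "1 \<le> M" "real m \<le> M * (real k / \<epsilon>)"
  shows "real m ^ (7 * (k * m)) \<le>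
    2 powr (7 * M * (log 2 M + 1) * ((real k)\<^sup>2 / \<epsilon>) * max 1 (log 2 (real k / \<epsilon>)))"
proof -
  let ?x = "real k / \<epsilon>" and ?mx = "max 1 (log 2 (real k / \<epsilon>))"
  have x: "0 < ?x" using assms by simp
  have lM: "0 \<le> log 2 M" using assms by simp
  have "log 2 (real m) \<le> log 2 (M * ?x)" using assms x by (subst log_le_cancel_iff) auto
  also have "\<dots> = log 2 M + log 2 ?x" using assms x by (intro log_mult_pos) auto
  also have "\<dots> \<le> log 2 M * ?mx + ?mx"
    using lM mult_left_mono[of 1 ?mx "log 2 M"] by auto
  finally have 1: "log 2 (real m) \<le> (log 2 M + 1) * ?mx" by (simp add: algebra_simps)
  have "real (7 * (k * m)) * log 2 (real m) \<le> (7 * k * (M * ?x)) * ((log 2 M + 1) * ?mx)"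
  proof (rule mult_mono)
    show "real (7 * (k * m)) \<le> 7 * k * (M * ?x)"
      using mult_left_mono[OF assms(5), of "7 * real k"] by (simp add: mult.assoc)
  qed (use 1 assms in auto)
  also have "\<dots> = 7 * M * (log 2 M + 1) * ((real k)\<^sup>2 / \<epsilon>) * ?mx"
    by (simp add: power2_eq_square)
  finally have e: "real (7 * (k * m)) * log 2 (real m) \<le> 7 * M * (log 2 M + 1) * ((real k)\<^sup>2 / \<epsilon>) * ?mx" .
  have "real m ^ (7 * (k * m)) = real m powr real (7 * (k * m))"
    using assms by (subst powr_realpow) auto
  also have "\<dots> = 2 powr (real (7 * (k * m)) * log 2 (real m))"
    using assms by (simp add: powr_def log_def)
  also have "\<dots> \<le> 2 powr (7 * M * (log 2 M + 1) * ((real k)\<^sup>2 / \<epsilon>) * ?mx)"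
    using e by (intro powr_mono) auto
  finally show ?thesis .
qed

theorem theorem1:
  fixes \<eta> :: real
  assumes "0 < \<eta>" and "\<eta> < 1"
  shows "\<exists>alg :: prog. \<forall>B :: real. \<exists>K c :: real.
    \<forall>(\<epsilon> :: real) (k :: nat) (d :: nat) (n :: nat) (ps :: point list).
      0 < \<epsilon> \<and> \<epsilon> \<le> B \<and> 1 \<le> k \<and> 1 \<le> d \<and> 1 \<le> n \<and>
      length ps = n \<and> distinct ps \<and> set ps \<subseteq> space_of_dim d \<and>
      kmeans_irreducible d k (gap \<epsilon> k) (set ps) \<longrightarrow>
        (\<forall>\<omega> \<in> space random_tape. \<exists>t s. exec \<omega> alg (kmeans_input \<epsilon> k d ps) t s \<and>
            real t \<le> kmeans_time_bound K c \<epsilon> k d n) \<and>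
        \<P>(\<omega> in random_tape. \<exists>t s. exec \<omega> alg (kmeans_input \<epsilon> k d ps) t s \<and>
            kmeans_approx d k (1 + gap \<epsilon> k) (set ps) (kmeans_output d s)) \<ge> 1 - \<eta>"
proof -
  \<comment> \<open>Chosen so that exp (- L) \<le> \<eta>. The program depends on \<eta> through
    \<open>L\<close> alone; \<open>B\<close> enters only the time bound.\<close>
  define L where "L = nat \<lceil>ln (1 / \<eta>)\<rceil>"
  have ln_pos: "0 < ln (1 / \<eta>)" using assms by simp
  have L: "ln (1 / \<eta>) \<le> real L" unfolding L_def by (rule real_nat_ceiling_ge)
  have L1: "1 \<le> L" using L ln_pos by (cases L) auto
  have bound: "(\<forall>\<omega> \<in> space random_tape. \<exists>t s. exec \<omega> (kmeans_prog L) (kmeans_input \<epsilon> k d ps) t s \<and>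
            real t \<le> kmeans_time_bound (100 * real L) (7 * M * (log 2 M + 1)) \<epsilon> k d n) \<and>
        \<P>(\<omega> in random_tape. \<exists>t s. exec \<omega> (kmeans_prog L) (kmeans_input \<epsilon> k d ps) t s \<and>
            kmeans_approx d k (1 + gap \<epsilon> k) (set ps) (kmeans_output d s)) \<ge> 1 - \<eta>"
    if "0 < \<epsilon>" "\<epsilon> \<le> B" "1 \<le> k" "1 \<le> d" "1 \<le> n" "length ps = n" "distinct ps"
      "set ps \<subseteq> space_of_dim d" "kmeans_irreducible d k (gap \<epsilon> k) (set ps)"
      and M: "M = 98 * (1 + \<bar>B\<bar>)"
    for B \<epsilon> M :: real and k d n :: nat and ps :: "point list"
  proof -
    note hyps = that
    let ?s = "kmeans_input \<epsilon> k d ps" and ?\<gamma> = "gap \<epsilon> k"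
    let ?K = "100 * real L" and ?c = "7 * M * (log 2 M + 1)"
    let ?approx = "kmeans_approx d k (1 + ?\<gamma>) (set ps)"
    have c0: "0 \<le> ?c" using M by simp
    have nd: "1 \<le> real n * real d" using that mult_mono[of 1 "real n" 1 "real d"] by simp
    show ?thesis
    proof (cases "n \<le> k")
      case True
      have e: "\<exists>t s. exec \<omega> (kmeans_prog L) ?s t s \<and> t \<le> 2 \<and> kmeans_output d s = set ps" for \<omega>
        using wp_kmeans_small[of ps k d \<omega> L \<epsilon>] True that unfolding wp_def by auto
      have "2 \<le> kmeans_time_bound ?K ?c \<epsilon> k d n"
      proof -
        have "1 \<le> 2 powr (?c * ((real k)\<^sup>2 / \<epsilon>) * max 1 (log 2 (real k / \<epsilon>)))"
          using c0 that by (intro ge_one_powr_ge_zero mult_nonneg_nonneg) auto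
        then have "1 * 1 \<le> (real n * real d) * 2 powr (?c * ((real k)\<^sup>2 / \<epsilon>) * max 1 (log 2 (real k / \<epsilon>)))"
          using nd by (intro mult_mono) auto
        then have "100 * 1 \<le> ?K * ((real n * real d) * 2 powr (?c * ((real k)\<^sup>2 / \<epsilon>) * max 1 (log 2 (real k / \<epsilon>))))"
          using L1 by (intro mult_mono) auto
        then show ?thesis unfolding kmeans_time_bound_def by linarith
      qed
      then have time: "\<exists>t s. exec \<omega> (kmeans_prog L) ?s t s \<and> real t \<le> kmeans_time_bound ?K ?c \<epsilon> k d n" for \<omega>
        using e[of \<omega>] by force
      have "?approx (set ps)"
        using True that by (intro kmeans_approx_self) (auto simp: distinct_card)
      then have "\<exists>t s. exec \<omega> (kmeans_prog L) ?s t s \<and> ?approx (kmeans_output d s)" for \<omega>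
        using e[of \<omega>] by force
      then have "{\<omega> \<in> space random_tape. \<exists>t s. exec \<omega> (kmeans_prog L) ?s t s \<and> ?approx (kmeans_output d s)}
        = space random_tape" by auto
      then have "\<P>(\<omega> in random_tape. \<exists>t s. exec \<omega> (kmeans_prog L) ?s t s \<and> ?approx (kmeans_output d s)) = 1"
        by (simp only: tape_prob.prob_space)
      then show ?thesis using time assms by simp
    next
      case False
      \<comment> \<open>The quotient is below 2 for every \<epsilon>, so \<gamma> k < 2. This yields
        \<gamma> < 2 and, with m * \<gamma> \<ge> 96, also m \<ge> 48 k.\<close>
      have "?\<gamma> * k = \<epsilon> / (1 + \<epsilon> / 2)" using that by (simp add: gap_def)
      also have "\<dots> < 2" using that by (simp add: pos_divide_less_eq)
      finally have \<gamma>: "0 < ?\<gamma>" "?\<gamma> * k < 2" using that by (simp_all add: gap_def)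
      have "?\<gamma> * 1 \<le> ?\<gamma> * k" using \<gamma>(1) that by (intro mult_left_mono) auto
      then have \<gamma>2: "?\<gamma> < 2" using \<gamma>(2) by simp
      define m where "m = (LEAST j. 96 \<le> real j * ?\<gamma>)"
      obtain j where "96 / ?\<gamma> \<le> real j" using real_arch_simple by blast
      then have ex: "96 \<le> real j * ?\<gamma>" using \<gamma>(1) by (simp add: field_simps)
      have m: "96 \<le> real m * ?\<gamma>" unfolding m_def by (rule LeastI[of "\<lambda>j. 96 \<le> real j * ?\<gamma>", OF ex])
      have m_least: "real j * ?\<gamma> < 96" if "j < m" for j
        using not_less_Least[OF that[unfolded m_def]] by simp
      have "48 * real k * ?\<gamma> = 48 * (?\<gamma> * real k)" by simp
      also have "\<dots> \<le> 96" using \<gamma>(2) by (simp add: mult.commute)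
      also note m
      finally have "48 * real k * ?\<gamma> \<le> real m * ?\<gamma>" .
      then have "48 * real k \<le> real m" using \<gamma>(1) by (rule mult_right_le_imp_le)
      then have mk: "48 * k \<le> m" by simp
      then have m48: "48 \<le> m" "k \<le> m" "1 \<le> m" using that by auto
      \<comment> \<open>Minimality of \<open>m\<close> gives m * \<gamma> < 96 + \<gamma> < 98. The
        factor 1 + \<epsilon> / 2 in 98 / \<gamma> is bounded through \<epsilon> \<le> B, whence the
        choice of \<open>M\<close>.\<close>
      have mM: "real m \<le> M * (real k / \<epsilon>)"
      proof -
        have "real (m - 1) * ?\<gamma> < 96" using m48 by (intro m_least) simp
        then have "real m * ?\<gamma> < 98" using m48 \<gamma>2 by (simp add: of_nat_diff algebra_simps)
        then have "real m < 98 / ?\<gamma>" using \<gamma>(1) by (simp add: field_simps)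
        also have "98 / ?\<gamma> = 98 * (1 + \<epsilon> / 2) * (real k / \<epsilon>)" by (simp add: gap_def)
        also have "\<dots> \<le> M * (real k / \<epsilon>)" using that M by (intro mult_right_mono) auto
        finally show ?thesis by simp
      qed
      define x where "x p = ps ! p" for p
      interpret sampling d n k m x .
      define R where "R = L * (m ^ 5) ^ (k * m)"
      have P: "x ` {..<n} = set ps" using that by (auto simp: x_def set_conv_nth)
      have inj: "inj_on x {..<n}" using that by (auto simp: x_def inj_on_def nth_eq_iff_index_eq)
      have R1: "1 \<le> R" using L1 m48 by (simp add: R_def)
      have run: "wp \<omega> (kmeans_prog L) (100 * (R * (k * (m * n * d))))
          (\<lambda>s. kmeans_output d s = trunc ` set (best \<omega> R)) ?s" for \<omega>
        unfolding R_def using that False m48 L1 m m_least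
        by (intro wp_kmeans_large) (auto simp: x_def)
      have "real (100 * (R * (k * (m * n * d)))) \<le> kmeans_time_bound ?K ?c \<epsilon> k d n"
      proof -
        \<comment> \<open>The extra factor k m is at most m ^ 2 and is merged into the power, with 5
          k m + 2 \<le> 7 k m.\<close>
        have "R * (k * (m * n * d)) = L * (n * d) * (m ^ (5 * (k * m)) * (k * m))"
          by (simp add: R_def power_mult[symmetric])
        also have "\<dots> \<le> L * (n * d) * (m ^ (5 * (k * m)) * (m * m))"
          using m48 by (intro mult_le_mono) auto
        also have "m ^ (5 * (k * m)) * (m * m) = m ^ (5 * (k * m) + 2)"
          by (simp add: power_add power2_eq_square)
        also have "L * (n * d) * m ^ (5 * (k * m) + 2) \<le> L * (n * d) * m ^ (7 * (k * m))"
          using m48 that by (intro mult_le_mono2 power_increasing) auto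
        finally have "real (100 * (R * (k * (m * n * d)))) \<le> real (100 * (L * (n * d) * m ^ (7 * (k * m))))"
          by (intro of_nat_mono mult_le_mono2)
        also have "\<dots> = ?K * (real n * real d * real m ^ (7 * (k * m)))" by simp
        also have "\<dots> \<le> kmeans_time_bound ?K ?c \<epsilon> k d n"
          unfolding kmeans_time_bound_def
          using that m48 M mM by (intro mult_left_mono power_time_bound) auto
        finally show ?thesis .
      qed
      then have time: "\<exists>t s. exec \<omega> (kmeans_prog L) ?s t s \<and> real t \<le> kmeans_time_bound ?K ?c \<epsilon> k d n" for \<omega>
        using run[of \<omega>] unfolding wp_def by (meson of_nat_mono order_trans)
      \<comment> \<open>Determinism turns the existence of an execution into a property of
        \<open>best \<omega> R\<close>, a simple function of the tape; so the set is an
        event.\<close>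
      have event: "(\<exists>t s. exec \<omega> (kmeans_prog L) ?s t s \<and> ?approx (kmeans_output d s)) \<longleftrightarrow>
          ?approx (trunc ` set (best \<omega> R))" for \<omega>
        using run[of \<omega>] unfolding wp_def by (metis exec_deterministic)
      obtain a where ic: "irreducible_clustering d n k m x a ?\<gamma>"
        and opt: "ennreal (\<Sum>j<k. clustering.V d n x a j) \<le> opt_cost d k (x ` {..<n})"
        using irreducible_clusteringI[of d k n m ?\<gamma> x] hyps False m48 m \<gamma>(1) \<gamma>2 inj P by auto
      interpret irreducible_clustering d n k m x a ?\<gamma> by (rule ic)
      have good: "space random_tape - fail_event R \<subseteq> {\<omega> \<in> space random_tape. ?approx (trunc ` set (best \<omega> R))}"
      proof
        fix \<omega> assume "\<omega> \<in> space random_tape - fail_event R"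
        then obtain r where r: "r < R" "covers (run \<omega> r)" "\<omega> \<in> space random_tape"
          by (auto simp: fail_event_def failed_def)
        have len: "length (best \<omega> R) = k" using best_is_run[OF R1] by (metis length_run)
        then have "best \<omega> R \<noteq> []" using that by auto
        then have "?approx (trunc ` set (best \<omega> R))"
          using covers_approx[OF inj r(2) _ opt _ mass_best_le[OF r(1)]] len P by simp
        then show "\<omega> \<in> {\<omega> \<in> space random_tape. ?approx (trunc ` set (best \<omega> R))}" using r by simp
      qed
      have "measure random_tape (fail_event R) \<le> \<eta>"
      proof -
        let ?p = "(1 / real m ^ 5) ^ (k * m)"
        have p: "0 \<le> ?p" "?p \<le> 1" using m48 by (auto intro!: power_le_one)
        have "measure random_tape (fail_event R) \<le> (1 - ?p) ^ R" by (rule fail_event_prob)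
        also have "\<dots> \<le> exp (- ?p) ^ R"
          using p exp_ge_add_one_self[of "- ?p"] by (intro power_mono) auto
        also have "\<dots> = exp (- (real R * ?p))" by (simp add: exp_of_nat_mult[symmetric])
        \<comment> \<open>The number of attempts is exactly \<open>L\<close> times the inverse of
          the guaranteed success probability.\<close>
        also have "real R * ?p = L" using m48 by (simp add: R_def power_one_over)
        also have "exp (- real L) \<le> exp (- ln (1 / \<eta>))" using L by simp
        also have "\<dots> = \<eta>" using assms by (simp add: ln_div)
        finally show ?thesis .
      qed
      then have "1 - \<eta> \<le> measure random_tape (space random_tape - fail_event R)"
        by (simp add: tape_prob.prob_compl)
      also have "\<dots> \<le> measure random_tape {\<omega> \<in> space random_tape. ?approx (trunc ` set (best \<omega> R))}"
      proof (rule tape_prob.finite_measure_mono[OF good])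
        show "{\<omega> \<in> space random_tape. ?approx (trunc ` set (best \<omega> R))} \<in> sets random_tape"
          by (rule simple_function_event[OF simple_best]) (use that in simp)
      qed
      finally show ?thesis using time event by simp
    qed
  qed
  show ?thesis
    \<comment> \<open>The constants stay schematic until \<open>bound\<close> is applied; proving
      its premise \<open>M = 98 * (1 + \<bar>B\<bar>)\<close> by reflexivity fixes \<open>M\<close>
      in terms of \<open>B\<close> alone.\<close>
    by (rule exI[of _ "kmeans_prog L"], intro allI, rule exI, rule exI, intro allI impI,
        elim conjE, rule bound) (assumption | rule refl)+
qed

end
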